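(* Let $\mathcal{D}$ be a regular ultrafilter on $I$, $|I|=\lambda\ge\aleph_0$. If $\mathcal{D}$ has $\lambda^+$-treetops, then $\mathcal{D}$ is $\lambda^+$-good.
   Context: An ultrafilter $\mathcal{D}$ on $I$, $|I|=\lambda$, is regular if there is $\{X_i:i<\lambda\}\subseteq\mathcal{D}$ with each $t\in I$ in only finitely many $X_i$. $\mathcal{D}$ is $\lambda^+$-good if every $f:[\lambda]^{<\aleph_0}\to\mathcal{D}$ has a multiplicative refinement $f'$, i.e. $f'(u)\subseteq f(u)$ and $f'(u)\cap f'(v)=f'(u\cup v)$ for all finite $u,v$. $\mathcal{D}$ has $\lambda^+$-treetops if for any $\lambda^+$-saturated model $M$ interpreting a tree $(\mathcal{T}_M,\trianglelefteq)$, with $N=M^I/\mathcal{D}$, every $\trianglelefteq$-increasing sequence $\langle a_i:i<\gamma\rangle$ in $\mathcal{T}_N$ with $\gamma=\operatorname{cf}(\gamma)<\lambda^+$ has an upper bound in $\mathcal{T}_N$. *)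

theory Defs
  imports Main
begin

unbundle cardinal_syntax

section \<open>First-order logic\<close>

text \<open>A symbol applied to \<open>n\<close> arguments is read as the \<open>n\<close>-ary symbol of that name, so every name
  provides one symbol of each arity; constants are function symbols applied to the empty list.\<close>

datatype 'f tm = Var nat | App 'f "'f tm list"

datatype ('f, 'r) fm =
    Equal "'f tm" "'f tm"
  | Atom 'r "'f tm list"
  | Neg "('f, 'r) fm"
  | Conj "('f, 'r) fm" "('f, 'r) fm"
  | Exists nat "('f, 'r) fm"

record ('f, 'r, 'm) struc =
  univ :: "'m set"
  fun_int :: "'f \<Rightarrow> 'm list \<Rightarrow> 'm"
  rel_int :: "'r \<Rightarrow> 'm list \<Rightarrow> bool"

definition is_struc :: "('f, 'r, 'm) struc \<Rightarrow> bool" where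
  "is_struc M \<longleftrightarrow> univ M \<noteq> {} \<and> (\<forall>f xs. set xs \<subseteq> univ M \<longrightarrow> fun_int M f xs \<in> univ M)"

primrec tm_val :: "('f, 'r, 'm) struc \<Rightarrow> (nat \<Rightarrow> 'm) \<Rightarrow> 'f tm \<Rightarrow> 'm" where
  "tm_val M e (Var v) = e v"
| "tm_val M e (App f ts) = fun_int M f (map (tm_val M e) ts)"

primrec sat :: "('f, 'r, 'm) struc \<Rightarrow> (nat \<Rightarrow> 'm) \<Rightarrow> ('f, 'r) fm \<Rightarrow> bool" where
  "sat M e (Equal s t) \<longleftrightarrow> tm_val M e s = tm_val M e t"
| "sat M e (Atom r ts) \<longleftrightarrow> rel_int M r (map (tm_val M e) ts)"
| "sat M e (Neg \<phi>) \<longleftrightarrow> \<not> sat M e \<phi>"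
| "sat M e (Conj \<phi> \<psi>) \<longleftrightarrow> sat M e \<phi> \<and> sat M e \<psi>"
| "sat M e (Exists v \<phi>) \<longleftrightarrow> (\<exists>a\<in>univ M. sat M (e(v := a)) \<phi>)"

primrec fv_tm :: "'f tm \<Rightarrow> nat set" where
  "fv_tm (Var v) = {v}"
| "fv_tm (App f ts) = \<Union> (set (map fv_tm ts))"

primrec fv :: "('f, 'r) fm \<Rightarrow> nat set" where
  "fv (Equal s t) = fv_tm s \<union> fv_tm t"
| "fv (Atom r ts) = \<Union> (fv_tm ` set ts)"
| "fv (Neg \<phi>) = fv \<phi>"
| "fv (Conj \<phi> \<psi>) = fv \<phi> \<union> fv \<psi>"
| "fv (Exists v \<phi>) = fv \<phi> - {v}"

text \<open>A formula in the variable \<open>0\<close> with parameters from \<open>A\<close> is a pair \<open>(\<phi>, e)\<close>, where the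
  assignment \<open>e\<close> supplies the parameters for the free variables of \<open>\<phi>\<close> other than \<open>0\<close>.\<close>

definition fm_over :: "'m set \<Rightarrow> ('f, 'r) fm \<times> (nat \<Rightarrow> 'm) \<Rightarrow> bool" where
  "fm_over A = (\<lambda>(\<phi>, e). \<forall>v\<in>fv \<phi> - {0}. e v \<in> A)"

definition realizes ::
    "('f, 'r, 'm) struc \<Rightarrow> 'm \<Rightarrow> (('f, 'r) fm \<times> (nat \<Rightarrow> 'm)) set \<Rightarrow> bool" where
  "realizes M a p \<longleftrightarrow> (\<forall>(\<phi>, e)\<in>p. sat M (e(0 := a)) \<phi>)"

definition type_over ::
    "('f, 'r, 'm) struc \<Rightarrow> 'm set \<Rightarrow> (('f, 'r) fm \<times> (nat \<Rightarrow> 'm)) set \<Rightarrow> bool" where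
  "type_over M A p \<longleftrightarrow> (\<forall>x\<in>p. fm_over A x) \<and>
     (\<forall>q. q \<subseteq> p \<and> finite q \<longrightarrow> (\<exists>a\<in>univ M. realizes M a q))"

definition saturated :: "'k rel \<Rightarrow> ('f, 'r, 'm) struc \<Rightarrow> bool" where
  "saturated \<kappa> M \<longleftrightarrow> (\<forall>A p. A \<subseteq> univ M \<and> |A| <o \<kappa> \<and> type_over M A p
     \<longrightarrow> (\<exists>a\<in>univ M. realizes M a p))"


section \<open>Ultrafilters and ultrapowers\<close>

definition ultrafilter :: "'i set set \<Rightarrow> bool" where
  "ultrafilter D \<longleftrightarrow> UNIV \<in> D \<and> {} \<notin> D
     \<and> (\<forall>X Y. X \<in> D \<and> Y \<in> D \<longrightarrow> X \<inter> Y \<in> D)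
     \<and> (\<forall>X Y. X \<in> D \<and> X \<subseteq> Y \<longrightarrow> Y \<in> D)
     \<and> (\<forall>X. X \<in> D \<or> - X \<in> D)"

definition up_class :: "'i set set \<Rightarrow> ('f, 'r, 'm) struc \<Rightarrow> ('i \<Rightarrow> 'm) \<Rightarrow> ('i \<Rightarrow> 'm) set" where
  "up_class D M g = {h. (\<forall>t. h t \<in> univ M) \<and> {t. g t = h t} \<in> D}"

definition up_rep :: "('i \<Rightarrow> 'm) set \<Rightarrow> 'i \<Rightarrow> 'm" where
  "up_rep X = (SOME g. g \<in> X)"

definition ultrapower ::
    "'i set set \<Rightarrow> ('f, 'r, 'm) struc \<Rightarrow> ('f, 'r, ('i \<Rightarrow> 'm) set) struc" where
  "ultrapower D M =
    \<lparr> univ = up_class D M ` {g. \<forall>t. g t \<in> univ M},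
      fun_int = (\<lambda>f Xs. up_class D M (\<lambda>t. fun_int M f (map (\<lambda>X. up_rep X t) Xs))),
      rel_int = (\<lambda>r Xs. {t. rel_int M r (map (\<lambda>X. up_rep X t) Xs)} \<in> D) \<rparr>"


section \<open>Interpreted trees\<close>

text \<open>Trees are in the model-theoretic sense: the predecessors of a node are linearly ordered.
  Well-ordered predecessors would be the wrong notion, since in an \<open>\<aleph>\<^sub>0\<close>-saturated model
  every interpreted tree of that kind has finite height.\<close>

definition is_tree :: "'a set \<Rightarrow> 'a rel \<Rightarrow> bool" where
  "is_tree T r \<longleftrightarrow> partial_order_on T r \<and> (\<forall>z\<in>T. total_on {x. (x, z) \<in> r} r)"

text \<open>Interpretations are on \<open>dim\<close>-tuples, modulo a definable equivalence relation, with
  parameters. In \<open>dom_fm\<close> the tuple occupies the variables below \<open>dim\<close>, in \<open>eq_fm\<close> and \<open>le_fm\<close>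
  the two tuples occupy the variables below \<open>2 * dim\<close>; all remaining variables are parameters,
  with values given by the assignment \<open>c\<close>.\<close>

record ('f, 'r) interp =
  dim :: nat
  dom_fm :: "('f, 'r) fm"
  eq_fm :: "('f, 'r) fm"
  le_fm :: "('f, 'r) fm"

definition tuple_asg :: "(nat \<Rightarrow> 'm) \<Rightarrow> 'm list \<Rightarrow> nat \<Rightarrow> 'm" where
  "tuple_asg c xs v = (if v < length xs then xs ! v else c v)"

definition int_dom ::
    "('f, 'r, 'm) struc \<Rightarrow> ('f, 'r) interp \<Rightarrow> (nat \<Rightarrow> 'm) \<Rightarrow> 'm list set" where
  "int_dom M J c = {xs. length xs = dim J \<and> set xs \<subseteq> univ M \<and> sat M (tuple_asg c xs) (dom_fm J)}"

definition int_eq ::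
    "('f, 'r, 'm) struc \<Rightarrow> ('f, 'r) interp \<Rightarrow> (nat \<Rightarrow> 'm) \<Rightarrow> 'm list rel" where
  "int_eq M J c = {(xs, ys). xs \<in> int_dom M J c \<and> ys \<in> int_dom M J c
     \<and> sat M (tuple_asg c (xs @ ys)) (eq_fm J)}"

definition int_le ::
    "('f, 'r, 'm) struc \<Rightarrow> ('f, 'r) interp \<Rightarrow> (nat \<Rightarrow> 'm) \<Rightarrow> 'm list rel" where
  "int_le M J c = {(xs, ys). xs \<in> int_dom M J c \<and> ys \<in> int_dom M J c
     \<and> sat M (tuple_asg c (xs @ ys)) (le_fm J)}"

definition tree_nodes ::
    "('f, 'r, 'm) struc \<Rightarrow> ('f, 'r) interp \<Rightarrow> (nat \<Rightarrow> 'm) \<Rightarrow> 'm list set set" where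
  "tree_nodes M J c = int_dom M J c // int_eq M J c"

definition tree_le ::
    "('f, 'r, 'm) struc \<Rightarrow> ('f, 'r) interp \<Rightarrow> (nat \<Rightarrow> 'm) \<Rightarrow> 'm list set rel" where
  "tree_le M J c = {(X, Y). X \<in> tree_nodes M J c \<and> Y \<in> tree_nodes M J c
     \<and> (\<exists>xs\<in>X. \<exists>ys\<in>Y. (xs, ys) \<in> int_le M J c)}"

definition interprets_tree ::
    "('f, 'r, 'm) struc \<Rightarrow> ('f, 'r) interp \<Rightarrow> (nat \<Rightarrow> 'm) \<Rightarrow> bool" where
  "interprets_tree M J c \<longleftrightarrow> range c \<subseteq> univ M
     \<and> equiv (int_dom M J c) (int_eq M J c)
     \<and> (\<lambda>xs ys. (xs, ys) \<in> int_le M J c) respects2 int_eq M J c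
     \<and> is_tree (tree_nodes M J c) (tree_le M J c)"


section \<open>Regularity, goodness and treetops\<close>

text \<open>Throughout, \<open>D\<close> is an ultrafilter on the set of all elements of the type \<open>'i\<close>, and \<open>\<lambda>\<close> is
  the cardinal \<open>|UNIV :: 'i set|\<close>. This is a well-order with field \<open>UNIV\<close>, so the elements of
  \<open>'i\<close> serve as the indices \<open>i < \<lambda>\<close>.\<close>

definition regular_uf :: "'i set set \<Rightarrow> bool" where
  "regular_uf D \<longleftrightarrow> (\<exists>X :: 'i \<Rightarrow> 'i set. (\<forall>i. X i \<in> D) \<and> (\<forall>t. finite {i. t \<in> X i}))"

definition good_uf :: "'i set set \<Rightarrow> bool" where
  "good_uf D \<longleftrightarrow> (\<forall>f :: 'i set \<Rightarrow> 'i set. (\<forall>u. finite u \<longrightarrow> f u \<in> D) \<longrightarrow>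
     (\<exists>f'. (\<forall>u. finite u \<longrightarrow> f' u \<in> D \<and> f' u \<subseteq> f u)
         \<and> (\<forall>u v. finite u \<and> finite v \<longrightarrow> f' u \<inter> f' v = f' (u \<union> v))))"

text \<open>The models range over the structures with at most \<open>2\<^sup>\<lambda>\<close> elements (subsets of \<open>'i set\<close>) in a
  countable language. This is no restriction. Saturation passes to the reduct to the finitely
  many symbols of the interpretation. Given a sequence of length at most \<open>\<lambda>\<close> in the
  ultrapower, the at most \<open>\<lambda>\<close> elements of \<open>M\<close> that occur in chosen representatives and as
  parameters lie in a \<open>\<lambda>\<^sup>+\<close>-saturated elementary submodel of size at most \<open>2\<^sup>\<lambda>\<close>, and an
  upper bound found in the ultrapower of the submodel is one in the ultrapower of \<open>M\<close>.
  Likewise every cardinal \<open>\<gamma> < \<lambda>\<^sup>+\<close> is isomorphic to a cardinal order on a subset of \<open>'i\<close>.\<close>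

definition has_treetops :: "'i set set \<Rightarrow> bool" where
  "has_treetops D \<longleftrightarrow>
    (\<forall>(M :: (nat, nat, 'i set) struc) J c (\<gamma> :: 'i rel) a.
       is_struc M \<and> saturated (cardSuc |UNIV :: 'i set| ) M \<and> interprets_tree M J c
     \<and> Card_order \<gamma> \<and> infinite (Field \<gamma>) \<and> regularCard \<gamma> \<and> \<gamma> <o cardSuc |UNIV :: 'i set|
     \<longrightarrow> (let N = ultrapower D M; c' = (\<lambda>v. up_class D M (\<lambda>t. c v)) in
          (\<forall>i\<in>Field \<gamma>. a i \<in> tree_nodes N J c')
          \<and> (\<forall>i j. (i, j) \<in> \<gamma> \<longrightarrow> (a i, a j) \<in> tree_le N J c')
          \<longrightarrow> (\<exists>b\<in>tree_nodes N J c'. \<forall>i\<in>Field \<gamma>. (a i, b) \<in> tree_le N J c')))"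

end

theory Submission
  imports Defs "HOL-Library.Sublist" "HOL-Library.Countable"
begin

text \<open>After Malliaris and Shelah. Applied to an iterated ultrapower of the tree of finite sequences
  of natural numbers, which is \<open>\<lambda>\<^sup>+\<close>-saturated because \<open>D\<close> is regular, treetops give upper
  bounds for chains of length at most \<open>\<lambda>\<close> in every ultraproduct of finite trees. It follows that
  the ultrapower of the natural numbers has no cut with both cofinalities at most \<open>\<lambda>\<close>. A cut with
  equal cofinalities is filled by a branch of nested intervals. In a cut with cofinalities
  \<open>\<kappa> < \<theta>\<close> and \<open>\<theta>\<close> minimal, there is enough saturation below \<open>\<theta>\<close> to build a branch of length
  \<open>\<theta>\<close> that codes a coloring of pairs by \<open>\<kappa>\<close> without large sets on which it is bounded, and an upper
  bound of the branch would produce such a set. Goodness asks for an internal set containing all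
  \<open>i < \<lambda>\<close> in a family of finite sets that contains every finite set of such \<open>i\<close>; it is built along
  a branch, and the absence of cuts lets the construction pass limit stages.\<close>

section \<open>Cardinals and cofinal sequences\<close>

text \<open>One obstacle returns in every construction: an upper bound supplied by treetops need not
  satisfy the invariant of the branch. It is trimmed to an initial segment, and the greatest length
  at which one internal condition still holds is again internal, so a single condition costs
  nothing. A limit stage may instead ask for a length above all earlier lengths that respects many
  such bounds at once, which amounts to filling a pregap in the ultrapower of the natural numbers.
  Hence treetops and cuts are intertwined: nested intervals meet one condition per stage and need no
  filling, whereas the branch for an asymmetric cut needs it for sides smaller than
  \<open>\<theta>\<close>. That branch runs through all of \<open>\<theta>\<close> so that its bound
  descends to the cut, but only the stages with at most \<open>\<kappa>\<close> predecessors are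
  counted; they form an initial segment with more than \<open>\<kappa>\<close> elements. Regularity
  of \<open>D\<close> enters twice: it saturates the iterated ultrapower, and it makes the sets
  finite among which the internal set for goodness is sought.\<close>

lemma infinite_Field_card_of: "infinite A \<Longrightarrow> infinite (Field |A| )"
  by (simp add: Field_card_of)

lemma card_of_lists_ordLeq:
  assumes inf: "infinite B" and A: "|A| \<le>o |B|"
  shows "|lists A| \<le>o |B|"
proof -
  define L where "L n = {xs. set xs \<subseteq> A \<and> length xs = n}" for n
  have "|L n| \<le>o |B|" for n
  proof (induction n)
    case 0
    have "L 0 = {[]}" by (auto simp: L_def)
    moreover have "B \<noteq> {}" using inf by auto
    ultimately show ?case by (simp add: card_of_singl_ordLeq)
  next
    case (Suc n)
    have "L (Suc n) \<subseteq> (\<lambda>(a, xs). a # xs) ` (A \<times> L n)"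
    proof
      fix xs assume "xs \<in> L (Suc n)"
      then obtain a ys where "xs = a # ys" "a \<in> A" "ys \<in> L n"
        by (auto simp: L_def length_Suc_conv)
      then show "xs \<in> (\<lambda>(a, xs). a # xs) ` (A \<times> L n)" by force
    qed
    then have "|L (Suc n)| \<le>o |A \<times> L n|"
      by (rule surj_imp_ordLeq)
    also have "|A \<times> L n| \<le>o |B|"
      using card_of_Times_ordLeq_infinite_Field[of "|B|" A "L n"] inf A Suc
      by (simp add: card_of_card_order_on Field_card_of)
    finally show ?case .
  qed
  moreover have "|UNIV :: nat set| \<le>o |B|"
    using inf infinite_iff_card_of_nat by blast
  ultimately have "|\<Union>n\<in>UNIV. L n| \<le>o |B|"
    using card_of_UNION_ordLeq_infinite[OF inf, of UNIV L] by simp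
  moreover have "(\<Union>n\<in>UNIV. L n) = lists A" by (auto simp: L_def)
  ultimately show ?thesis by simp
qed

lemma card_of_Fpow_ordLess:
  assumes "Card_order \<nu>" "infinite (Field \<nu>)" "|K| <o \<nu>"
  shows "|{u. u \<subseteq> K \<and> finite u}| <o \<nu>"
proof (cases "finite K")
  case True
  then have "finite {u. u \<subseteq> K \<and> finite u}" by simp
  then show ?thesis
    by (intro finite_ordLess_infinite)
      (use assms in \<open>auto simp: Field_card_of card_of_well_order_on card_order_on_well_order_on\<close>)
next
  case False
  have "{u. u \<subseteq> K \<and> finite u} \<subseteq> set ` lists K"
    using finite_list by (fastforce simp: image_iff)
  then have "|{u. u \<subseteq> K \<and> finite u}| \<le>o |lists K|" by (rule surj_imp_ordLeq)
  also have "|lists K| \<le>o |K|"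
    by (rule card_of_lists_ordLeq[OF False]) (simp add: ordIso_imp_ordLeq card_of_refl)
  also note \<open>|K| <o \<nu>\<close>
  finally show ?thesis .
qed

lemma finite_total_has_max:
  assumes "finite K" "K \<noteq> {}"
    and "\<And>x y. x \<in> K \<Longrightarrow> y \<in> K \<Longrightarrow> le x y \<or> le y x"
    and "\<And>x y z. x \<in> K \<Longrightarrow> y \<in> K \<Longrightarrow> z \<in> K \<Longrightarrow> le x y \<Longrightarrow> le y z \<Longrightarrow> le x z"
  shows "\<exists>m\<in>K. \<forall>k\<in>K. le k m"
  using assms
proof (induction K rule: finite_ne_induct)
  case (singleton x)
  then show ?case by blast
next
  case (insert x F)
  then obtain m where "m \<in> F" "\<forall>k\<in>F. le k m" by blast
  then show ?case
    using insert.prems(1)[of x m] insert.prems(1)[of x x] insert.prems(2)[of _ m x] by blast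
qed

text \<open>A cofinal subset of least cardinality is enumerated by its cardinal order, and only the
  elements that rise above everything enumerated before are kept, so that the two orders agree.
  Leastness then gives both that the remaining well-order is a cardinal and that it is
  regular.\<close>

lemma cofinal_regular_sequence:
  fixes K :: "'k set"
  assumes tot: "\<And>x y. x \<in> K \<Longrightarrow> y \<in> K \<Longrightarrow> le x y \<or> le y x"
    and trans: "\<And>x y z. x \<in> K \<Longrightarrow> y \<in> K \<Longrightarrow> z \<in> K \<Longrightarrow> le x y \<Longrightarrow> le y z \<Longrightarrow> le x z"
    and ne: "K \<noteq> {}"
    and nomax: "\<And>x. x \<in> K \<Longrightarrow> \<exists>y\<in>K. \<not> le y x"
  obtains \<gamma> :: "'k rel" where "Field \<gamma> \<subseteq> K" "Card_order \<gamma>" "regularCard \<gamma>" "infinite (Field \<gamma>)"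
    and "\<And>i j. (i, j) \<in> \<gamma> \<Longrightarrow> le i j"
    and "\<And>i j. (i, j) \<in> \<gamma> \<Longrightarrow> i \<noteq> j \<Longrightarrow> \<not> le j i"
    and "\<And>k. k \<in> K \<Longrightarrow> \<exists>i\<in>Field \<gamma>. le k i"
proof -
  define cof where "cof C \<longleftrightarrow> C \<subseteq> K \<and> (\<forall>k\<in>K. \<exists>i\<in>C. le k i)" for C
  have "cof K" using tot by (auto simp: cof_def)
  then have "\<exists>r\<in>{|C| | C. cof C}. \<forall>r'\<in>{|C| | C. cof C}. r \<le>o r'"
    by (intro exists_minim_Card_order) (auto simp: card_of_Card_order)
  then obtain C where C: "cof C" and min: "\<And>C'. cof C' \<Longrightarrow> |C| \<le>o |C'|" by auto
  define r where "r = |C|"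
  have wo: "Well_order r" and F: "Field r = C"
    by (auto simp: r_def card_of_well_order_on Field_card_of)
  have wr: "wo_rel r" using wo by (simp add: wo_rel_def)
  define C' where "C' = {k\<in>C. \<forall>j. (j, k) \<in> r \<and> j \<noteq> k \<longrightarrow> \<not> le k j}"
  have CK: "C \<subseteq> K" using C by (simp add: cof_def)
  have refl: "le x x" if "x \<in> K" for x using tot[of x x] that by auto
  have cofC': "\<exists>i\<in>C'. \<not> le i k" if k: "k \<in> K" for k
  proof -
    obtain k' where k': "k' \<in> K" "\<not> le k' k" using nomax k by blast
    obtain k0 where k0: "k0 \<in> C" "le k' k0" using C k' by (auto simp: cof_def)
    have "\<not> le k0 k" using k' k0 trans[of k' k0 k] CK k by blast
    define B where "B = {j\<in>C. \<not> le j k}"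
    have B: "B \<subseteq> Field r" "B \<noteq> {}" using k0 \<open>\<not> le k0 k\<close> by (auto simp: B_def F)
    \<comment> \<open>The first element of \<open>C\<close> not below \<open>k\<close> belongs to
      \<open>C'\<close>: an earlier \<open>j\<close> above it would itself lie below
      \<open>k\<close> and put it below \<open>k\<close>.\<close>
    define i where "i = wo_rel.minim r B"
    have iB: "i \<in> B" unfolding i_def by (rule wo_rel.minim_in[OF wr B])
    have "\<not> le i j" if "(j, i) \<in> r" "j \<noteq> i" for j
    proof
      assume "le i j"
      have "j \<in> C" using that F by (auto simp: Field_def)
      moreover have "j \<notin> B"
      proof
        assume "j \<in> B"
        then have "(i, j) \<in> r" unfolding i_def by (rule wo_rel.minim_least[OF wr B(1)])
        then show False using that wo_rel.ANTISYM[OF wr] by (auto simp: antisym_def)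
      qed
      ultimately have "le j k" by (auto simp: B_def)
      then have "le i k"
        using \<open>le i j\<close> trans[of i j k] CK \<open>j \<in> C\<close> \<open>k \<in> K\<close> iB by (auto simp: B_def)
      then show False using iB by (auto simp: B_def)
    qed
    then have "i \<in> C'" using iB by (auto simp: C'_def B_def)
    then show ?thesis using iB by (auto simp: B_def)
  qed
  have C'C: "C' \<subseteq> C" by (auto simp: C'_def)
  have cofC'2: "\<exists>i\<in>C'. le k i" if "k \<in> K" for k
    using cofC'[OF that] tot that C'C CK by blast
  have "cof C'" using cofC'2 C'C CK by (auto simp: cof_def)
  define \<gamma> where "\<gamma> = Restr r C'"
  have F\<gamma>: "Field \<gamma> = C'"
    unfolding \<gamma>_def using Refl_Field_Restr2[OF wo_rel.REFL[OF wr], of C'] C'C F by simp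
  have wo\<gamma>: "Well_order \<gamma>" unfolding \<gamma>_def using Well_order_Restr[OF wo] .
  have "\<gamma> \<le>o |C'|"
  proof -
    \<comment> \<open>Otherwise \<open>r\<close> would be isomorphic to a proper initial segment of
      \<open>\<gamma>\<close>, which is contained in a proper initial segment of the cardinal order
      \<open>r\<close> and therefore has fewer elements than \<open>C\<close>.\<close>
    have "\<gamma> \<le>o r"
    proof (rule ccontr)
      assume "\<not> \<gamma> \<le>o r"
      then have "r <o \<gamma>" using not_ordLeq_iff_ordLess[OF wo wo\<gamma>] by blast
      then obtain a where a: "a \<in> Field \<gamma>" "r =o Restr \<gamma> (underS \<gamma> a)"
        using ordLess_iff_ordIso_Restr[OF wo\<gamma> wo] by blast
      then obtain f where f: "iso r (Restr \<gamma> (underS \<gamma> a)) f" by (auto simp: ordIso_def)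
      have FR: "Field (Restr \<gamma> (underS \<gamma> a)) = underS \<gamma> a"
        by (rule Field_Restr_ofilter[OF wo\<gamma>])
          (use wo\<gamma> in \<open>simp add: wo_rel_def wo_rel.underS_ofilter\<close>)
      have "|C| =o |underS \<gamma> a|"
        using f FR F card_of_ordIso[of C "underS \<gamma> a"] by (auto simp: iso_def)
      moreover have "|underS \<gamma> a| \<le>o |underS r a|"
        by (rule card_of_mono1) (auto simp: \<gamma>_def underS_def)
      moreover have "|underS r a| <o r"
        using card_of_underS[of r a] a F\<gamma> C'C F by (auto simp: r_def card_of_Card_order)
      ultimately have "|C| <o |C|"
        using ordIso_ordLeq_trans ordLeq_ordLess_trans unfolding r_def by blast
      then show False using ordLess_irreflexive by blast
    qed
    also have "r \<le>o |C'|" unfolding r_def using min[OF \<open>cof C'\<close>] .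
    finally show ?thesis .
  qed
  then have co: "Card_order \<gamma>"
    using Card_order_iff_ordLeq_card_of[of \<gamma>] F\<gamma> by simp
  have le\<gamma>: "\<not> le j i" if "(i, j) \<in> \<gamma>" "i \<noteq> j" for i j
    using that by (auto simp: \<gamma>_def C'_def)
  have le\<gamma>': "le i j" if "(i, j) \<in> \<gamma>" for i j
  proof -
    have "i \<in> K" "j \<in> K" using that C'C CK by (auto simp: \<gamma>_def)
    then show ?thesis using le\<gamma>[OF that] tot refl by blast
  qed
  have reg: "regularCard \<gamma>"
    unfolding regularCard_def
  proof (intro allI impI, elim conjE)
    fix X assume X: "X \<subseteq> Field \<gamma>" "cofinal X \<gamma>"
    have "cof X" unfolding cof_def
    proof (intro conjI ballI)
      show "X \<subseteq> K" using X F\<gamma> C'C CK by blast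
      fix k assume "k \<in> K"
      then obtain i where i: "i \<in> C'" "le k i" using cofC'2 by blast
      then obtain j where "j \<in> X" "(i, j) \<in> \<gamma>" using X F\<gamma> by (auto simp: cofinal_def)
      then show "\<exists>i\<in>X. le k i"
        using le\<gamma>' trans[of k i j] i \<open>k \<in> K\<close> X F\<gamma> C'C CK by blast
    qed
    then have "|C| \<le>o |X|" by (rule min)
    moreover have "\<gamma> \<le>o |C|" using \<open>\<gamma> \<le>o |C'|\<close> card_of_mono1[OF C'C] ordLeq_transitive by blast
    ultimately have "\<gamma> \<le>o |X|" using ordLeq_transitive by blast
    moreover have "|X| \<le>o \<gamma>"
      using card_of_mono1[OF X(1)] card_of_Field_ordIso[OF co] ordLeq_ordIso_trans by blast
    ultimately show "|X| =o \<gamma>" by (simp add: ordIso_iff_ordLeq)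
  qed
  have inf: "infinite (Field \<gamma>)"
  proof
    assume "finite (Field \<gamma>)"
    then have "finite C'" using F\<gamma> by simp
    moreover have "C' \<noteq> {}" using ne cofC' by blast
    ultimately have "\<exists>m\<in>C'. \<forall>k\<in>C'. le k m"
    proof (rule finite_total_has_max)
      show "le x y \<or> le y x" if "x \<in> C'" "y \<in> C'" for x y
        using that C'C CK tot[of x y] by auto
      show "le x z" if "x \<in> C'" "y \<in> C'" "z \<in> C'" "le x y" "le y z" for x y z
        using that C'C CK trans[of x y z] by auto
    qed
    then obtain m where "m \<in> C'" "\<forall>k\<in>C'. le k m" by blast
    then show False using cofC'[of m] C'C CK by blast
  qed
  have sub: "Field \<gamma> \<subseteq> K" using F\<gamma> C'C CK by simp
  have cofinal: "\<exists>i\<in>Field \<gamma>. le k i" if "k \<in> K" for k using cofC'2[OF that] F\<gamma> by simp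
  show ?thesis by (rule that[OF sub co reg inf le\<gamma>' le\<gamma> cofinal])
qed

section \<open>Ultrafilters as filters\<close>

definition uf_filter :: "'i set set \<Rightarrow> 'i filter" where
  "uf_filter D = Abs_filter (\<lambda>P. Collect P \<in> D)"

lemma eventually_uf_filter:
  assumes "ultrafilter D"
  shows "eventually P (uf_filter D) \<longleftrightarrow> {t. P t} \<in> D"
  unfolding uf_filter_def
proof (rule eventually_Abs_filter)
  show "is_filter (\<lambda>P. Collect P \<in> D)"
  proof
    show "Collect (\<lambda>_. True) \<in> D" using assms by (simp add: ultrafilter_def)
    show "Collect (\<lambda>x. P x \<and> Q x) \<in> D" if "Collect P \<in> D" "Collect Q \<in> D" for P Q
    proof -
      have "{x. P x \<and> Q x} = Collect P \<inter> Collect Q" by auto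
      then show ?thesis using that assms by (simp add: ultrafilter_def)
    qed
    show "Collect Q \<in> D" if "\<forall>x. P x \<longrightarrow> Q x" "Collect P \<in> D" for P Q
    proof -
      have "Collect P \<subseteq> Collect Q" using that by auto
      then show ?thesis using that assms unfolding ultrafilter_def by blast
    qed
  qed
qed

locale ultra =
  fixes F :: "'i filter"
  assumes proper: "F \<noteq> bot"
    and ultra: "eventually P F \<or> eventually (\<lambda>t. \<not> P t) F"
begin

lemma ev_not: "eventually (\<lambda>t. \<not> P t) F \<longleftrightarrow> \<not> eventually P F"
proof
  assume n: "eventually (\<lambda>t. \<not> P t) F"
  show "\<not> eventually P F"
  proof
    assume "eventually P F"
    with n have "eventually (\<lambda>t. False) F" by eventually_elim simp
    then show False using proper by simp
  qed
qed (use ultra in blast)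

lemma ev_disj: "eventually (\<lambda>t. P t \<or> Q t) F \<longleftrightarrow> eventually P F \<or> eventually Q F"
proof -
  have "eventually (\<lambda>t. \<not> (\<not> P t \<and> \<not> Q t)) F \<longleftrightarrow> \<not> (eventually (\<lambda>t. \<not> P t) F \<and> eventually (\<lambda>t. \<not> Q t) F)"
    by (simp only: ev_not eventually_conj_iff)
  then show ?thesis by (simp add: ev_not)
qed

end

lemma ultra_uf_filter:
  assumes "ultrafilter D"
  shows "ultra (uf_filter D)"
proof
  show "uf_filter D \<noteq> bot"
    using assms eventually_uf_filter[OF assms, of "\<lambda>_. False"]
    by (auto simp: ultrafilter_def trivial_limit_def)
  show "eventually P (uf_filter D) \<or> (\<forall>\<^sub>F t in uf_filter D. \<not> P t)" for P
  proof -
    have "{t. P t} \<in> D \<or> - {t. P t} \<in> D" using assms unfolding ultrafilter_def by blast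
    moreover have "- {t. P t} = {t. \<not> P t}" by auto
    ultimately show ?thesis by (simp add: eventually_uf_filter[OF assms])
  qed
qed


section \<open>Iterated ultrapowers\<close>

text \<open>The iterated ultrapower along a well-order \<open>S\<close> is presented without a direct limit. Its
  elements are functions of a point \<open>x\<close> of the power \<open>I\<^sup>S\<close> that are evaluated by reading
  coordinates of \<open>x\<close> in strictly decreasing order, each choice depending on the values already
  read; well-foundedness makes every evaluation finite. Quantifying the coordinates in the order
  in which they are read decides the truth of adapted predicates.\<close>

locale iterated_ultra = ultra F for F :: "'i filter" +
  fixes S :: "'o rel"
  assumes wo: "Well_order S"
    and nomax: "\<alpha> \<in> Field S \<Longrightarrow> \<exists>\<beta>. (\<alpha>, \<beta>) \<in> S - Id"
    and S_ne: "Field S \<noteq> {}"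
begin

inductive adapted :: "'o \<Rightarrow> (('o \<Rightarrow> 'i) \<Rightarrow> 'm) \<Rightarrow> bool" where
  const: "\<beta> \<in> Field S \<Longrightarrow> adapted \<beta> (\<lambda>_. c)"
| step: "(\<alpha>, \<beta>) \<in> S - Id \<Longrightarrow> (\<And>t. adapted \<alpha> (H t)) \<Longrightarrow> adapted \<beta> (\<lambda>x. H (x \<alpha>) x)"

inductive truth :: "'o \<Rightarrow> (('o \<Rightarrow> 'i) \<Rightarrow> bool) \<Rightarrow> bool \<Rightarrow> bool" where
  const: "\<beta> \<in> Field S \<Longrightarrow> truth \<beta> (\<lambda>_. b) b"
| step: "(\<alpha>, \<beta>) \<in> S - Id \<Longrightarrow> (\<And>t. truth \<alpha> (P t) (b t)) \<Longrightarrow>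
    truth \<beta> (\<lambda>x. P (x \<alpha>) x) (eventually b F)"

lemma wr: "wo_rel S" using wo by (simp add: wo_rel_def)

lemma S_trans: "(\<alpha>, \<beta>) \<in> S \<Longrightarrow> (\<beta>, \<gamma>) \<in> S \<Longrightarrow> (\<alpha>, \<gamma>) \<in> S"
  using wo_rel.TRANS[OF wr] by (meson transD)

lemma S_less_trans: "(\<alpha>, \<beta>) \<in> S - Id \<Longrightarrow> (\<beta>, \<gamma>) \<in> S \<Longrightarrow> (\<alpha>, \<gamma>) \<in> S - Id"
  using S_trans[of \<alpha> \<beta> \<gamma>] antisymD[OF wo_rel.ANTISYM[OF wr], of \<alpha> \<beta>] by auto

lemma S_refl: "\<alpha> \<in> Field S \<Longrightarrow> (\<alpha>, \<alpha>) \<in> S"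
  using wo_rel.REFL[OF wr] by (auto simp: refl_on_def)

lemma S_total: "\<alpha> \<in> Field S \<Longrightarrow> \<beta> \<in> Field S \<Longrightarrow> (\<alpha>, \<beta>) \<in> S \<or> (\<beta>, \<alpha>) \<in> S"
  using wo_rel.TOTALS[OF wr] by blast

lemma S_less_Field: "(\<alpha>, \<beta>) \<in> S - Id \<Longrightarrow> \<alpha> \<in> Field S"
  by (auto simp: Field_def)

lemma adapted_Field: "adapted \<beta> G \<Longrightarrow> \<beta> \<in> Field S"
  by (erule adapted.cases) (auto simp: Field_def)

lemma adapted_mono:
  assumes "adapted \<beta> G" "(\<beta>, \<gamma>) \<in> S"
  shows "adapted \<gamma> G"
  using assms(1)
proof (cases rule: adapted.cases)
  case (const c)
  then show ?thesis using assms(2) adapted.const[of \<gamma> c] by (auto simp: Field_def)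
next
  case (step \<alpha> H)
  show ?thesis unfolding step(1)
    by (rule adapted.step[OF S_less_trans[OF step(2) assms(2)] step(3)])
qed

lemma truth_mono:
  assumes "truth \<beta> P b" "(\<beta>, \<gamma>) \<in> S"
  shows "truth \<gamma> P b"
  using assms(1)
proof (cases rule: truth.cases)
  case const
  then show ?thesis using assms(2) truth.const[of \<gamma> b] by (auto simp: Field_def)
next
  case (step \<alpha> H c)
  show ?thesis unfolding step(1) step(2)
    by (rule truth.step[OF S_less_trans[OF step(3) assms(2)] step(4)])
qed

lemma adapted_local:
  assumes "adapted \<beta> G" "\<And>\<alpha>. (\<alpha>, \<beta>) \<in> S - Id \<Longrightarrow> x \<alpha> = y \<alpha>"
  shows "G x = G y"
  using assms
proof (induction rule: adapted.induct)
  case (step \<alpha> \<beta> H)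
  have "(\<delta>, \<beta>) \<in> S - Id" if "(\<delta>, \<alpha>) \<in> S - Id" for \<delta>
    using S_less_trans[OF that] step(1) by auto
  then have "H t x = H t y" for t using step by blast
  then show ?case using step.prems[OF step(1)] by simp
qed simp

text \<open>The later of the two coordinates read first can serve both functions: the one that
  starts lower, or is constant, reads it and ignores the value. With this alignment all binary
  operations become a plain induction on the rank.\<close>

lemma adapted_pair_cases:
  assumes "adapted \<beta> G1" "adapted \<beta> G2"
  obtains c1 c2 where "G1 = (\<lambda>_. c1)" "G2 = (\<lambda>_. c2)"
  | \<alpha> H1 H2 where "(\<alpha>, \<beta>) \<in> S - Id" "\<And>t. adapted \<alpha> (H1 t)" "\<And>t. adapted \<alpha> (H2 t)"
      "G1 = (\<lambda>x. H1 (x \<alpha>) x)" "G2 = (\<lambda>x. H2 (x \<alpha>) x)"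
  using assms(1)
proof (cases rule: adapted.cases)
  case c1: (const c1)
  show ?thesis using assms(2)
  proof (cases rule: adapted.cases)
    case (const c2)
    show ?thesis by (rule that(1)[OF c1(1) const(1)])
  next
    case (step \<alpha> H)
    have "adapted \<alpha> (\<lambda>_. c1)" by (rule adapted.const[OF S_less_Field[OF step(2)]])
    then show ?thesis by (rule that(2)[OF step(2) _ step(3) c1(1) step(1)])
  qed
next
  case s1: (step \<alpha>1 H1)
  show ?thesis using assms(2)
  proof (cases rule: adapted.cases)
    case (const c2)
    have "adapted \<alpha>1 (\<lambda>_. c2)" by (rule adapted.const[OF S_less_Field[OF s1(2)]])
    then show ?thesis by (rule that(2)[OF s1(2) s1(3) _ s1(1) const(1)])
  next
    case s2: (step \<alpha>2 H2)
    consider "\<alpha>1 = \<alpha>2" | "(\<alpha>1, \<alpha>2) \<in> S - Id" | "(\<alpha>2, \<alpha>1) \<in> S - Id"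
      using S_total[of \<alpha>1 \<alpha>2] s1(2) s2(2) by (auto simp: Field_def)
    then show ?thesis
    proof cases
      case 1
      show ?thesis by (rule that(2)[OF s1(2) s1(3) s2(3)[folded 1] s1(1) s2(1)[folded 1]])
    next
      case 2
      have "adapted \<alpha>2 G1" unfolding s1(1) by (rule adapted.step[OF 2]) (rule s1)
      then show ?thesis by (rule that(2)[OF s2(2) _ s2(3) _ s2(1), of "\<lambda>_. G1"]) simp
    next
      case 3
      have "adapted \<alpha>1 G2" unfolding s2(1) by (rule adapted.step[OF 3]) (rule s2)
      then show ?thesis by (rule that(2)[OF s1(2) s1(3) _ s1(1), of "\<lambda>_. G2"]) simp
    qed
  qed
qed

text \<open>The same alignment for predicates with their values; since \<open>F\<close> is proper, a
  dummy quantifier over \<open>F\<close> leaves a value unchanged.\<close>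

lemma truth_pair_cases:
  assumes "truth \<beta> P1 b1" "truth \<beta> P2 b2"
  obtains "P1 = (\<lambda>_. b1)" "P2 = (\<lambda>_. b2)"
  | \<alpha> H1 H2 c1 c2 where "(\<alpha>, \<beta>) \<in> S - Id" "\<And>t. truth \<alpha> (H1 t) (c1 t)" "\<And>t. truth \<alpha> (H2 t) (c2 t)"
      "P1 = (\<lambda>x. H1 (x \<alpha>) x)" "P2 = (\<lambda>x. H2 (x \<alpha>) x)" "b1 = eventually c1 F" "b2 = eventually c2 F"
  using assms(1)
proof (cases rule: truth.cases)
  case c1: const
  show ?thesis using assms(2)
  proof (cases rule: truth.cases)
    case const
    show ?thesis by (rule that(1)[OF c1(1) const(1)])
  next
    case (step \<alpha> H c)
    have "truth \<alpha> (\<lambda>_. b1) b1" by (rule truth.const[OF S_less_Field[OF step(3)]])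
    then show ?thesis
      by (rule that(2)[OF step(3) _ step(4) c1(1) step(1) _ step(2)]) (simp add: proper)
  qed
next
  case s1: (step \<alpha>1 H1 c1)
  show ?thesis using assms(2)
  proof (cases rule: truth.cases)
    case const
    have "truth \<alpha>1 (\<lambda>_. b2) b2" by (rule truth.const[OF S_less_Field[OF s1(3)]])
    then show ?thesis
      by (rule that(2)[OF s1(3) s1(4) _ s1(1) const(1) s1(2)]) (simp add: proper)
  next
    case s2: (step \<alpha>2 H2 c2)
    consider "\<alpha>1 = \<alpha>2" | "(\<alpha>1, \<alpha>2) \<in> S - Id" | "(\<alpha>2, \<alpha>1) \<in> S - Id"
      using S_total[of \<alpha>1 \<alpha>2] s1(3) s2(3) by (auto simp: Field_def)
    then show ?thesis
    proof cases
      case 1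
      show ?thesis
        by (rule that(2)[OF s1(3) s1(4) s2(4)[folded 1] s1(1) s2(1)[folded 1] s1(2) s2(2)])
    next
      case 2
      have "truth \<alpha>2 P1 b1" unfolding s1(1) s1(2) by (rule truth.step[OF 2]) (rule s1)
      then show ?thesis
        by (rule that(2)[OF s2(3) _ s2(4) _ s2(1) _ s2(2), of "\<lambda>_. P1" "\<lambda>_. b1"])
          (simp_all add: proper)
    next
      case 3
      have "truth \<alpha>1 P2 b2" unfolding s2(1) s2(2) by (rule truth.step[OF 3]) (rule s2)
      then show ?thesis
        by (rule that(2)[OF s1(3) s1(4) _ s1(1) _ s1(2), of "\<lambda>_. P2" "\<lambda>_. b2"])
          (simp_all add: proper)
    qed
  qed
qed

lemma S_induct [consumes 0, case_names less]:
  assumes "\<And>\<beta>. (\<And>\<alpha>. (\<alpha>, \<beta>) \<in> S - Id \<Longrightarrow> Q \<alpha>) \<Longrightarrow> Q \<beta>"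
  shows "Q \<beta>"
  using wo_rel.WF[OF wr] assms by (rule wf_induct_rule)

lemma adapted_comp2:
  assumes "adapted \<beta> G1" "adapted \<beta> G2"
  shows "adapted \<beta> (\<lambda>x. h (G1 x) (G2 x))"
  using assms
proof (induction \<beta> arbitrary: G1 G2 rule: S_induct)
  case (less \<beta>)
  show ?case using less.prems
  proof (cases rule: adapted_pair_cases)
    case (1 c1 c2)
    then show ?thesis using adapted.const[OF adapted_Field[OF less.prems(1)]] by simp
  next
    case (2 \<alpha> H1 H2)
    show ?thesis unfolding 2(4,5)
      by (rule adapted.step[OF 2(1), where H = "\<lambda>t x. h (H1 t x) (H2 t x)"])
        (rule less.IH[OF 2(1) 2(2) 2(3)])
  qed
qed

lemma truth_adapted: "truth \<beta> P b \<Longrightarrow> adapted \<beta> P"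
proof (induction rule: truth.induct)
  case (const \<beta> b)
  then show ?case by (rule adapted.const)
next
  case (step \<alpha> \<beta> P b)
  show ?case by (rule adapted.step[OF step(1) step(3)])
qed

lemma adapted_truth: "adapted \<beta> P \<Longrightarrow> \<exists>b. truth \<beta> P b"
proof (induction rule: adapted.induct)
  case (step \<alpha> \<beta> H)
  then have "\<exists>b. \<forall>t. truth \<alpha> (H t) (b t)" by (intro choice) blast
  then obtain b where "\<And>t. truth \<alpha> (H t) (b t)" by blast
  then have "truth \<beta> (\<lambda>x. H (x \<alpha>) x) (eventually b F)" by (rule truth.step[OF step(1)])
  then show ?case by blast
next
  case (const \<beta> c)
  then show ?case using truth.const[of \<beta> c] by blast
qed

text \<open>A predicate can be presented with different choices of coordinates. After alignment the
  sections agree, because \<open>H t\<close> reads only coordinates below \<open>\<alpha>\<close>,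
  so that \<open>x \<alpha>\<close> may be set to \<open>t\<close> without affecting it.\<close>

lemma truth_unique:
  assumes "truth \<beta> P b1" "truth \<beta> P b2"
  shows "b1 = b2"
  using assms
proof (induction \<beta> arbitrary: P b1 b2 rule: S_induct)
  case (less \<beta>)
  show ?case using less.prems
  proof (cases rule: truth_pair_cases)
    case 1
    show ?thesis by (rule fun_cong[OF trans[OF 1(1)[symmetric] 1(2)]])
  next
    case (2 \<alpha> H1 H2 c1 c2)
    have "H1 t = H2 t" for t
    proof
      fix x
      have "H1 t (x(\<alpha> := t)) = H2 t (x(\<alpha> := t))"
        using fun_cong[OF trans[OF 2(4)[symmetric] 2(5)], of "x(\<alpha> := t)"] by simp
      moreover have "H1 t x = H1 t (x(\<alpha> := t))"
        by (rule adapted_local[OF truth_adapted[OF 2(2)]]) simp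
      moreover have "H2 t x = H2 t (x(\<alpha> := t))"
        by (rule adapted_local[OF truth_adapted[OF 2(3)]]) simp
      ultimately show "H1 t x = H2 t x" by simp
    qed
    then have "c1 t = c2 t" for t using less.IH[OF 2(1) 2(2)[of t], of "c2 t"] 2(3)[of t] by simp
    then have "c1 = c2" by blast
    then show ?thesis using 2(6,7) by simp
  qed
qed

lemma truth_conj:
  assumes "truth \<beta> P1 b1" "truth \<beta> P2 b2"
  shows "truth \<beta> (\<lambda>x. P1 x \<and> P2 x) (b1 \<and> b2)"
  using assms
proof (induction \<beta> arbitrary: P1 P2 b1 b2 rule: S_induct)
  case (less \<beta>)
  show ?case using less.prems
  proof (cases rule: truth_pair_cases)
    case 1
    then show ?thesis
      using truth.const[OF adapted_Field[OF truth_adapted[OF less.prems(1)]]] by simp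
  next
    case (2 \<alpha> H1 H2 c1 c2)
    show ?thesis unfolding 2(4-7) eventually_conj_iff[symmetric]
      by (rule truth.step[OF 2(1), where P = "\<lambda>t x. H1 t x \<and> H2 t x"])
        (rule less.IH[OF 2(1) 2(2) 2(3)])
  qed
qed

lemma truth_neg: "truth \<beta> P b \<Longrightarrow> truth \<beta> (\<lambda>x. \<not> P x) (\<not> b)"
proof (induction rule: truth.induct)
  case (step \<alpha> \<beta> P b)
  show ?case unfolding ev_not[symmetric]
    by (rule truth.step[OF step(1), where P = "\<lambda>t x. \<not> P t x"]) (rule step)
next
  case (const \<beta> b)
  then show ?case by (rule truth.const)
qed

text \<open>Truth is decided for adapted predicates only, so the true ones merely generate a filter.
  It behaves like an ultrafilter on adapted predicates, and Los's theorem needs no more.\<close>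

definition E :: "('o \<Rightarrow> 'i) filter" where
  "E = Abs_filter (\<lambda>P. \<exists>\<beta> P'. truth \<beta> P' True \<and> (\<forall>x. P' x \<longrightarrow> P x))"

lemma common_bound:
  assumes "\<alpha> \<in> Field S" "\<beta> \<in> Field S"
  obtains \<gamma> where "\<gamma> \<in> Field S" "(\<alpha>, \<gamma>) \<in> S" "(\<beta>, \<gamma>) \<in> S"
  using assms S_total[OF assms] S_refl by blast

lemma truth_conj':
  assumes "truth \<alpha> P1 b1" "truth \<beta> P2 b2"
  shows "\<exists>\<gamma>. truth \<gamma> (\<lambda>x. P1 x \<and> P2 x) (b1 \<and> b2)"
proof -
  obtain \<gamma> where "(\<alpha>, \<gamma>) \<in> S" "(\<beta>, \<gamma>) \<in> S"
    using common_bound[OF adapted_Field[OF truth_adapted[OF assms(1)]]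
        adapted_Field[OF truth_adapted[OF assms(2)]]] by blast
  then show ?thesis using truth_conj truth_mono assms by blast
qed

lemma eventually_E: "eventually P E \<longleftrightarrow> (\<exists>\<beta> P'. truth \<beta> P' True \<and> (\<forall>x. P' x \<longrightarrow> P x))"
  unfolding E_def
proof (rule eventually_Abs_filter, rule is_filter.intro)
  show "\<exists>\<beta> P'. truth \<beta> P' True \<and> (\<forall>x. P' x \<longrightarrow> True)"
    using S_ne truth.const[where b = True] by blast
  show "\<exists>\<beta> P'. truth \<beta> P' True \<and> (\<forall>x. P' x \<longrightarrow> P x \<and> Q x)"
    if "\<exists>\<beta> P'. truth \<beta> P' True \<and> (\<forall>x. P' x \<longrightarrow> P x)" "\<exists>\<beta> P'. truth \<beta> P' True \<and> (\<forall>x. P' x \<longrightarrow> Q x)"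
    for P Q
  proof -
    obtain \<alpha> P' \<beta> Q' where *: "truth \<alpha> P' True" "\<forall>x. P' x \<longrightarrow> P x" "truth \<beta> Q' True" "\<forall>x. Q' x \<longrightarrow> Q x"
      using \<open>\<exists>\<beta> P'. truth \<beta> P' True \<and> (\<forall>x. P' x \<longrightarrow> P x)\<close>
        \<open>\<exists>\<beta> P'. truth \<beta> P' True \<and> (\<forall>x. P' x \<longrightarrow> Q x)\<close> by blast
    obtain \<gamma> where "truth \<gamma> (\<lambda>x. P' x \<and> Q' x) True" using truth_conj'[OF *(1,3)] by auto
    then show ?thesis using * by blast
  qed
qed blast

lemma eventually_E_truth:
  assumes "truth \<beta> P b"
  shows "eventually P E \<longleftrightarrow> b"
proof
  assume "eventually P E"
  then obtain \<alpha> P' where *: "truth \<alpha> P' True" "\<forall>x. P' x \<longrightarrow> P x" by (auto simp: eventually_E)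
  show b
  proof (rule ccontr)
    assume "\<not> b"
    then obtain \<gamma> where \<gamma>: "truth \<gamma> (\<lambda>x. P' x \<and> \<not> P x) True"
      using truth_conj'[OF *(1) truth_neg[OF assms]] by auto
    moreover have "(\<lambda>x. P' x \<and> \<not> P x) = (\<lambda>_. False)" using * by blast
    ultimately have "truth \<gamma> (\<lambda>_. False) True" by simp
    moreover have "truth \<gamma> (\<lambda>_. False) False"
      using truth.const adapted_Field[OF truth_adapted[OF \<gamma>]] by blast
    ultimately show False using truth_unique by blast
  qed
next
  assume b
  then show "eventually P E" using assms by (auto simp: eventually_E)
qed

lemma E_proper: "E \<noteq> bot"
proof -
  obtain \<beta> where "\<beta> \<in> Field S" using S_ne by blast
  then have "\<not> eventually (\<lambda>_. False) E" using eventually_E_truth[OF truth.const[of \<beta> False]] by simp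
  then show ?thesis by (simp add: trivial_limit_def)
qed

lemma E_not:
  assumes "adapted \<beta> P"
  shows "eventually (\<lambda>x. \<not> P x) E \<longleftrightarrow> \<not> eventually P E"
proof -
  obtain b where "truth \<beta> P b" using adapted_truth[OF assms] by blast
  then show ?thesis using eventually_E_truth[of \<beta> P b] eventually_E_truth[OF truth_neg] by blast
qed

text \<open>A Fubini rule: \<open>\<alpha>\<close> is read before all coordinates that
  \<open>P t\<close> reads, hence it is quantified outermost. By \<open>nomax\<close> there is a
  rank beyond \<open>\<alpha>\<close> at which the combined predicate is adapted.\<close>

lemma E_step:
  assumes "\<And>t. adapted \<alpha> (P t)"
  shows "eventually (\<lambda>x. P (x \<alpha>) x) E \<longleftrightarrow> (\<forall>\<^sub>F t in F. eventually (P t) E)"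
proof -
  have "\<exists>b. \<forall>t. truth \<alpha> (P t) (b t)" using adapted_truth[OF assms] by (intro choice) blast
  then obtain b where b: "\<And>t. truth \<alpha> (P t) (b t)" by blast
  obtain \<beta> where "(\<alpha>, \<beta>) \<in> S - Id" using nomax adapted_Field[OF assms] by blast
  then have "eventually (\<lambda>x. P (x \<alpha>) x) E \<longleftrightarrow> eventually b F"
    by (rule eventually_E_truth[OF truth.step[OF _ b]])
  also have "\<dots> \<longleftrightarrow> (\<forall>\<^sub>F t in F. eventually (P t) E)"
    using eventually_E_truth[OF b] by simp
  finally show ?thesis .
qed

text \<open>Infinitely many adapted functions need not combine into one. A finite subfamily does,
  with \<open>undefined\<close> as the value elsewhere, and this suffices because a formula looks at
  finitely many variables.\<close>

lemma adapted_restrict: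
  assumes "finite V" "\<And>v. v \<in> V \<Longrightarrow> adapted \<beta> (G v)" "\<beta> \<in> Field S"
  shows "adapted \<beta> (\<lambda>x v. if v \<in> V then G v x else undefined)"
  using assms
proof (induction V rule: finite_induct)
  case empty
  then show ?case using adapted.const by simp
next
  case (insert w V)
  have "(\<lambda>x v. if v \<in> insert w V then G v x else undefined)
    = (\<lambda>x. (\<lambda>c f. f(w := c)) (G w x) (\<lambda>v. if v \<in> V then G v x else undefined))"
    by (auto simp: fun_eq_iff)
  then show ?case
    using adapted_comp2[OF insert.prems(1)[OF insertI1] insert.IH[OF insert.prems(1) insert.prems(2)],
        of "\<lambda>c f. f(w := c)"] by simp
qed

lemma adapted_comp:
  assumes "finite V" "\<And>v. v \<in> V \<Longrightarrow> adapted \<beta> (G v)" "\<beta> \<in> Field S"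
    and "\<And>e e'. (\<And>v. v \<in> V \<Longrightarrow> e v = e' v) \<Longrightarrow> h e = h e'"
  shows "adapted \<beta> (\<lambda>x. h (\<lambda>v. G v x))"
proof -
  have "(\<lambda>x. h (\<lambda>v. G v x)) = (\<lambda>x. h (\<lambda>v. if v \<in> V then G v x else undefined))"
    by (intro ext assms(4)) simp
  moreover have "adapted \<beta> (\<lambda>x v. if v \<in> V then G v x else undefined)"
    by (rule adapted_restrict[OF assms(1-3)])
  from adapted_comp2[OF this this, of "\<lambda>e _. h e"]
  have "adapted \<beta> (\<lambda>x. h (\<lambda>v. if v \<in> V then G v x else undefined))" .
  ultimately show ?thesis by metis
qed

lemma finite_common_bound:
  assumes "finite V" "\<And>v. v \<in> V \<Longrightarrow> \<exists>\<beta>. adapted \<beta> (G v)"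
  shows "\<exists>\<beta>\<in>Field S. \<forall>v\<in>V. adapted \<beta> (G v)"
  using assms
proof (induction V rule: finite_induct)
  case empty
  then show ?case using S_ne by blast
next
  case (insert v V)
  then obtain \<alpha> \<beta> where *: "adapted \<alpha> (G v)" "\<beta> \<in> Field S" "\<forall>v\<in>V. adapted \<beta> (G v)" by blast
  then obtain \<gamma> where "\<gamma> \<in> Field S" "(\<alpha>, \<gamma>) \<in> S" "(\<beta>, \<gamma>) \<in> S"
    using common_bound[OF adapted_Field] by blast
  then show ?case using * adapted_mono by blast
qed

lemma ex_adapted_comp:
  assumes "finite V" "\<And>v. v \<in> V \<Longrightarrow> \<exists>\<beta>. adapted \<beta> (G v)"
    and "\<And>e e'. (\<And>v. v \<in> V \<Longrightarrow> e v = e' v) \<Longrightarrow> h e = h e'"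
  shows "\<exists>\<beta>. adapted \<beta> (\<lambda>x. h (\<lambda>v. G v x))"
proof -
  obtain \<beta> where "\<beta> \<in> Field S" "\<forall>v\<in>V. adapted \<beta> (G v)"
    using finite_common_bound[OF assms(1), of G] assms(2) by blast
  then have "adapted \<beta> (\<lambda>x. h (\<lambda>v. G v x))"
    by (intro adapted_comp[where h = h, OF assms(1) _ _ assms(3)]) auto
  then show ?thesis by blast
qed

end

section \<open>The limit model and its saturation\<close>

lemma finite_fv_tm: "finite (fv_tm s)"
  by (induction s) auto

lemma finite_fv: "finite (fv \<phi>)"
  by (induction \<phi>) (auto simp: finite_fv_tm)

lemma tm_val_cong: "(\<And>v. v \<in> fv_tm s \<Longrightarrow> e v = e' v) \<Longrightarrow> tm_val M e s = tm_val M e' s"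
proof (induction s)
  case (App f ts)
  then have "map (tm_val M e) ts = map (tm_val M e') ts" by auto
  then show ?case by (simp only: tm_val.simps)
qed simp

lemma sat_cong: "(\<And>v. v \<in> fv \<phi> \<Longrightarrow> e v = e' v) \<Longrightarrow> sat M e \<phi> \<longleftrightarrow> sat M e' \<phi>"
proof (induction \<phi> arbitrary: e e')
  case (Equal s t)
  then show ?case using tm_val_cong[of s e e' M] tm_val_cong[of t e e' M] by simp
next
  case (Atom r ts)
  then have "map (tm_val M e) ts = map (tm_val M e') ts" by (auto intro!: tm_val_cong)
  then show ?case by (simp only: sat.simps)
next
  case (Neg \<phi>)
  show ?case using Neg.IH[of e e'] Neg.prems by simp
next
  case (Conj \<phi> \<psi>)
  have "sat M e \<phi> \<longleftrightarrow> sat M e' \<phi>" by (rule Conj.IH(1)) (use Conj.prems in auto)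
  moreover have "sat M e \<psi> \<longleftrightarrow> sat M e' \<psi>" by (rule Conj.IH(2)) (use Conj.prems in auto)
  ultimately show ?case by simp
next
  case (Exists v \<phi>)
  have "sat M (e(v := a)) \<phi> \<longleftrightarrow> sat M (e'(v := a)) \<phi>" for a
    by (rule Exists.IH) (use Exists.prems in auto)
  then show ?case by simp
qed

instance tm :: (countable) countable
  by countable_datatype

instance fm :: (countable, countable) countable
  by countable_datatype

text \<open>The quotient modulo \<open>E\<close> is kept abstract: \<open>dec\<close> yields a
  representative of an element and \<open>cl\<close> the class of an adapted function. The universe
  can then be a subset of any large enough type, as needed because treetops is stated for structures
  on \<open>'i set\<close>.\<close>

locale ultra_limit = iterated_ultra F S for F :: "'i filter" and S :: "'o rel" +
  fixes M0 :: "('f, 'r, 'm) struc" and U :: "'z set"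
    and dec :: "'z \<Rightarrow> ('o \<Rightarrow> 'i) \<Rightarrow> 'm" and cl :: "(('o \<Rightarrow> 'i) \<Rightarrow> 'm) \<Rightarrow> 'z"
  assumes univ_M0: "univ M0 = UNIV"
    and dec_adapted: "z \<in> U \<Longrightarrow> \<exists>\<beta>. adapted \<beta> (dec z)"
    and cl_U: "adapted \<beta> G \<Longrightarrow> cl G \<in> U"
    and dec_cl: "adapted \<beta> G \<Longrightarrow> \<forall>\<^sub>F x in E. dec (cl G) x = G x"
    and dec_eq: "z \<in> U \<Longrightarrow> z' \<in> U \<Longrightarrow> \<forall>\<^sub>F x in E. dec z x = dec z' x \<Longrightarrow> z = z'"
begin

definition LM :: "('f, 'r, 'z) struc" where
  "LM = \<lparr> univ = U,
     fun_int = (\<lambda>f zs. cl (\<lambda>x. fun_int M0 f (map (\<lambda>z. dec z x) zs))),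
     rel_int = (\<lambda>r zs. \<forall>\<^sub>F x in E. rel_int M0 r (map (\<lambda>z. dec z x) zs)) \<rparr>"

lemma LM_simps [simp]:
  "univ LM = U"
  "fun_int LM f zs = cl (\<lambda>x. fun_int M0 f (map (\<lambda>z. dec z x) zs))"
  "rel_int LM r zs \<longleftrightarrow> (\<forall>\<^sub>F x in E. rel_int M0 r (map (\<lambda>z. dec z x) zs))"
  by (simp_all add: LM_def)

lemma adapted_dec_list:
  assumes "set zs \<subseteq> U"
  shows "\<exists>\<beta>. adapted \<beta> (\<lambda>x. h (map (\<lambda>z. dec z x) zs))"
  by (rule ex_adapted_comp[where V = "set zs" and G = dec and h = "\<lambda>e. h (map e zs)"])
    (use assms dec_adapted in \<open>auto cong: map_cong\<close>)

lemma is_struc_LM: "is_struc LM"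
proof -
  obtain \<beta> where "\<beta> \<in> Field S" using S_ne by blast
  then have "cl (\<lambda>_. c) \<in> U" for c using cl_U[OF adapted.const] by blast
  moreover have "fun_int LM f zs \<in> U" if "set zs \<subseteq> U" for f zs
    using adapted_dec_list[OF that, of "fun_int M0 f"] cl_U by auto
  ultimately show ?thesis by (auto simp: is_struc_def)
qed

lemma tm_val_LM:
  assumes "\<And>v. e v \<in> U"
  shows "tm_val LM e s \<in> U \<and> (\<forall>\<^sub>F x in E. dec (tm_val LM e s) x = tm_val M0 (\<lambda>v. dec (e v) x) s)"
proof (induction s)
  case (Var v)
  then show ?case using assms by simp
next
  case (App f ts)
  let ?zs = "map (tm_val LM e) ts"
  have zs: "set ?zs \<subseteq> U" using App by auto
  obtain \<beta> where \<beta>: "adapted \<beta> (\<lambda>x. fun_int M0 f (map (\<lambda>z. dec z x) ?zs))"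
    using adapted_dec_list[OF zs, of "fun_int M0 f"] by blast
  have "\<forall>\<^sub>F x in E. \<forall>s\<in>set ts. dec (tm_val LM e s) x = tm_val M0 (\<lambda>v. dec (e v) x) s"
    by (rule eventually_ball_finite) (use App in auto)
  with dec_cl[OF \<beta>]
  have "\<forall>\<^sub>F x in E. dec (tm_val LM e (App f ts)) x = tm_val M0 (\<lambda>v. dec (e v) x) (App f ts)"
  proof eventually_elim
    case (elim x)
    then have "map (\<lambda>z. dec z x) ?zs = map (tm_val M0 (\<lambda>v. dec (e v) x)) ts" by auto
    then show ?case using elim(1) by (simp only: tm_val.simps LM_simps)
  qed
  moreover have "tm_val LM e (App f ts) \<in> U"
    using cl_U[OF \<beta>] by (simp only: tm_val.simps LM_simps)
  ultimately show ?case by blast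
qed

lemma adapted_sat:
  assumes "\<And>v. e v \<in> U"
  shows "\<exists>\<beta>. adapted \<beta> (\<lambda>x. sat M0 (\<lambda>v. dec (e v) x) \<phi>)"
  by (rule ex_adapted_comp[where V = "fv \<phi>" and G = "\<lambda>v. dec (e v)" and h = "\<lambda>e. sat M0 e \<phi>"])
    (use assms dec_adapted sat_cong finite_fv in blast)+

text \<open>Los's theorem for the filter \<open>E\<close>. Negation is sound because satisfaction is
  an adapted predicate, only finitely many variables being free. For a quantifier, a witness chosen
  pointwise depends on the values of those variables alone and is therefore adapted too.\<close>

lemma sat_LM:
  assumes "\<And>v. e v \<in> U"
  shows "sat LM e \<phi> \<longleftrightarrow> (\<forall>\<^sub>F x in E. sat M0 (\<lambda>v. dec (e v) x) \<phi>)"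
  using assms
proof (induction \<phi> arbitrary: e)
  case (Equal s t)
  note s = tm_val_LM[of e s, OF Equal.prems] and t = tm_val_LM[of e t, OF Equal.prems]
  have "sat LM e (Equal s t) \<longleftrightarrow> (\<forall>\<^sub>F x in E. dec (tm_val LM e s) x = dec (tm_val LM e t) x)"
    using dec_eq s t by auto
  also have "\<dots> \<longleftrightarrow> (\<forall>\<^sub>F x in E. sat M0 (\<lambda>v. dec (e v) x) (Equal s t))"
    by (rule eventually_cong[OF eventually_conj[OF conjunct2[OF s] conjunct2[OF t]]]) auto
  finally show ?case .
next
  case (Atom r ts)
  have "\<forall>\<^sub>F x in E. \<forall>s\<in>set ts. dec (tm_val LM e s) x = tm_val M0 (\<lambda>v. dec (e v) x) s"
    by (rule eventually_ball_finite) (use tm_val_LM[of e, OF Atom.prems] in auto)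
  then have "\<forall>\<^sub>F x in E. map (\<lambda>z. dec z x) (map (tm_val LM e) ts) = map (tm_val M0 (\<lambda>v. dec (e v) x)) ts"
    by eventually_elim auto
  then have "(\<forall>\<^sub>F x in E. rel_int M0 r (map (\<lambda>z. dec z x) (map (tm_val LM e) ts)))
      \<longleftrightarrow> (\<forall>\<^sub>F x in E. rel_int M0 r (map (tm_val M0 (\<lambda>v. dec (e v) x)) ts))"
    by (rule eventually_cong) metis
  then show ?case by (simp only: sat.simps LM_simps)
next
  case (Neg \<phi>)
  obtain \<beta> where "adapted \<beta> (\<lambda>x. sat M0 (\<lambda>v. dec (e v) x) \<phi>)"
    using adapted_sat[of e, OF Neg.prems] by blast
  from E_not[OF this] show ?case using Neg.IH[of e, OF Neg.prems] by simp
next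
  case (Conj \<phi> \<psi>)
  show ?case using Conj.IH(1)[of e, OF Conj.prems] Conj.IH(2)[of e, OF Conj.prems] by (simp add: eventually_conj_iff)
next
  case (Exists v \<phi>)
  have upd: "(\<lambda>w. dec ((e(v := a)) w) x) = (\<lambda>w. dec (e w) x)(v := dec a x)" for a x by auto
  have IH: "sat LM (e(v := a)) \<phi> \<longleftrightarrow> (\<forall>\<^sub>F x in E. sat M0 ((\<lambda>w. dec (e w) x)(v := dec a x)) \<phi>)"
    if "a \<in> U" for a
    unfolding upd[symmetric] by (rule Exists.IH) (use that Exists.prems in auto)
  show ?case
  proof
    assume "sat LM e (Exists v \<phi>)"
    then obtain a where "a \<in> U" "sat LM (e(v := a)) \<phi>" by auto
    with IH have "\<forall>\<^sub>F x in E. sat M0 ((\<lambda>w. dec (e w) x)(v := dec a x)) \<phi>" by blast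
    then show "\<forall>\<^sub>F x in E. sat M0 (\<lambda>v. dec (e v) x) (Exists v \<phi>)"
      by eventually_elim (auto simp: univ_M0)
  next
    assume R: "\<forall>\<^sub>F x in E. sat M0 (\<lambda>v. dec (e v) x) (Exists v \<phi>)"
    define h where "h e = (SOME m. sat M0 (e(v := m)) \<phi>)" for e
    have "\<exists>\<beta>. adapted \<beta> (\<lambda>x. h (\<lambda>w. dec (e w) x))"
    proof (rule ex_adapted_comp[where V = "fv \<phi> - {v}" and G = "\<lambda>w. dec (e w)" and h = h])
      fix e e' :: "nat \<Rightarrow> 'm" assume "\<And>w. w \<in> fv \<phi> - {v} \<Longrightarrow> e w = e' w"
      then have "sat M0 (e(v := m)) \<phi> = sat M0 (e'(v := m)) \<phi>" for m
        by (intro sat_cong) auto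
      then show "h e = h e'" by (simp add: h_def)
    qed (use Exists.prems dec_adapted finite_fv in auto)
    then obtain \<beta> where \<beta>: "adapted \<beta> (\<lambda>x. h (\<lambda>w. dec (e w) x))" by blast
    let ?a = "cl (\<lambda>x. h (\<lambda>w. dec (e w) x))"
    from R dec_cl[OF \<beta>] have "\<forall>\<^sub>F x in E. sat M0 ((\<lambda>w. dec (e w) x)(v := dec ?a x)) \<phi>"
    proof eventually_elim
      case (elim x)
      then have "\<exists>m. sat M0 ((\<lambda>w. dec (e w) x)(v := m)) \<phi>" by (auto simp: univ_M0)
      from someI_ex[OF this] show ?case unfolding elim(2) unfolding h_def .
    qed
    then show "sat LM e (Exists v \<phi>)" using IH cl_U[OF \<beta>] by auto
  qed
qed

end

section \<open>Realizing the limit on a prescribed type, and its cardinality\<close>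

context iterated_ultra
begin

lemma ultra_limit_exists:
  fixes M0 :: "('f, 'r, 'm) struc"
  assumes "univ M0 = UNIV"
    and card: "|{G :: ('o \<Rightarrow> 'i) \<Rightarrow> 'm. \<exists>\<beta>. adapted \<beta> G}| \<le>o |UNIV :: 'z set|"
  shows "\<exists>(U :: 'z set) dec cl. ultra_limit F S M0 U dec cl"
proof -
  define AD where "AD = {G :: ('o \<Rightarrow> 'i) \<Rightarrow> 'm. \<exists>\<beta>. adapted \<beta> G}"
  obtain enc :: "(('o \<Rightarrow> 'i) \<Rightarrow> 'm) \<Rightarrow> 'z" where enc: "inj_on enc AD"
    using card card_of_ordLeq[of AD "UNIV :: 'z set"] by (auto simp: AD_def)
  \<comment> \<open>\<open>\<rho> G\<close> depends only on the class of \<open>G\<close> modulo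
    \<open>E\<close>, so its values form a system of representatives, which \<open>enc\<close>
    carries into the prescribed type.\<close>
  define \<rho> where "\<rho> G = (SOME H. H \<in> AD \<and> (\<forall>\<^sub>F x in E. H x = G x))" for G :: "('o \<Rightarrow> 'i) \<Rightarrow> 'm"
  have \<rho>: "\<rho> G \<in> AD \<and> (\<forall>\<^sub>F x in E. \<rho> G x = G x)" if "G \<in> AD" for G
    unfolding \<rho>_def by (rule someI[of _ G]) (use that in simp)
  have \<rho>_eq: "\<rho> G = \<rho> G'" if "\<forall>\<^sub>F x in E. G x = G' x" for G G'
  proof -
    have "(\<forall>\<^sub>F x in E. H x = G x) \<longleftrightarrow> (\<forall>\<^sub>F x in E. H x = G' x)" for H
      by (rule eventually_cong[OF that]) simp
    then show ?thesis by (simp add: \<rho>_def)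
  qed
  define dec where "dec = inv_into AD enc"
  have dec: "dec (enc G) = G" if "G \<in> AD" for G
    unfolding dec_def by (rule inv_into_f_f[OF enc that])
  have "ultra_limit F S M0 ((enc \<circ> \<rho>) ` AD) dec (enc \<circ> \<rho>)"
  proof (unfold_locales, goal_cases)
    case 1
    show ?case by (rule assms(1))
  next
    case (2 z)
    then obtain G where "G \<in> AD" "z = enc (\<rho> G)" by auto
    then have "dec z \<in> AD" using \<rho>[of G] dec[of "\<rho> G"] by simp
    then show ?case by (simp add: AD_def)
  next
    case (3 \<beta> G)
    then show ?case by (auto simp: AD_def)
  next
    case (4 \<beta> G)
    then have "G \<in> AD" by (auto simp: AD_def)
    then show ?case using \<rho>[of G] dec[of "\<rho> G"] by simp
  next
    case (5 z z')
    then obtain G G' where G: "G \<in> AD" "z = enc (\<rho> G)" "G' \<in> AD" "z' = enc (\<rho> G')" by auto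
    then have "\<forall>\<^sub>F x in E. \<rho> G x = \<rho> G' x" using 5(3) \<rho>[of G] \<rho>[of G'] dec[of "\<rho> G"] dec[of "\<rho> G'"] by simp
    then have "\<forall>\<^sub>F x in E. G x = G' x"
      using conjunct2[OF \<rho>[OF G(1)]] conjunct2[OF \<rho>[OF G(3)]] by eventually_elim simp
    then show ?case using \<rho>_eq G by simp
  qed
  then show ?thesis by blast
qed

text \<open>Induction along \<open>S\<close>: an adapted function is a constant or consists of a
  coordinate and an \<open>'i\<close>-indexed family of adapted functions of lower rank, and
  \<open>(2\<^sup>\<lambda>)\<^sup>\<lambda> = 2\<^sup>\<lambda>\<close>.\<close>

lemma card_adapted:
  assumes inf: "infinite (UNIV :: 'i set)"
    and m: "|UNIV :: 'm set| \<le>o |UNIV :: 'i set set|"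
    and o: "|Field S| \<le>o |UNIV :: 'i set set|"
  shows "|{G :: ('o \<Rightarrow> 'i) \<Rightarrow> 'm. \<exists>\<beta>. adapted \<beta> G}| \<le>o |UNIV :: 'i set set|"
proof -
  define A where "A \<beta> = {G :: ('o \<Rightarrow> 'i) \<Rightarrow> 'm. adapted \<beta> G}" for \<beta>
  have inf2: "infinite (UNIV :: 'i set set)" using inf by (simp add: Finite_Set.finite_set)
  obtain f :: "'i \<times> 'i \<Rightarrow> 'i" where f: "inj f"
  proof -
    have "|(UNIV :: 'i set) \<times> (UNIV :: 'i set)| \<le>o |UNIV :: 'i set|"
      using card_of_Times_same_infinite[OF inf] ordIso_imp_ordLeq by blast
    then show thesis using that card_of_ordLeq[of "UNIV \<times> UNIV :: ('i \<times> 'i) set" "UNIV :: 'i set"] by auto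
  qed
  have pw: "|{H. \<forall>t :: 'i. H t \<in> B}| \<le>o |UNIV :: 'i set set|" if B: "|B| \<le>o |UNIV :: 'i set set|" for B :: "'b set"
  proof -
    obtain g :: "'b \<Rightarrow> 'i set" where g: "inj_on g B"
      using B card_of_ordLeq[of B "UNIV :: 'i set set"] by auto
    \<comment> \<open>A family of subsets of \<open>'i\<close> is coded as one subset, its disjoint
      union, by means of the pairing \<open>f\<close>.\<close>
    define k where "k H = f ` {(t, s). s \<in> g (H t)}" for H
    have "inj_on k {H. \<forall>t. H t \<in> B}"
    proof (rule inj_onI)
      fix H H' assume H: "H \<in> {H. \<forall>t. H t \<in> B}" "H' \<in> {H. \<forall>t. H t \<in> B}" and "k H = k H'"
      then have "{(t, s). s \<in> g (H t)} = {(t, s). s \<in> g (H' t)}"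
        using f by (simp add: k_def inj_image_eq_iff)
      then have "g (H t) = g (H' t)" for t by (auto simp: set_eq_iff)
      then show "H = H'" using g H by (auto simp: inj_on_def)
    qed
    then show ?thesis using card_of_ordLeq[of "{H. \<forall>t. H t \<in> B}" "UNIV :: 'i set set"] by blast
  qed
  have A: "|A \<beta>| \<le>o |UNIV :: 'i set set|" for \<beta>
  proof (induction \<beta> rule: S_induct)
    case (less \<beta>)
    define C where "C = range (\<lambda>c :: 'm. \<lambda>_ :: 'o \<Rightarrow> 'i. c)"
    define B where "B = (\<Union>\<alpha>\<in>{\<alpha>\<in>Field S. (\<alpha>, \<beta>) \<in> S - Id}. (\<lambda>H x. H (x \<alpha>) x) ` {H. \<forall>t. H t \<in> A \<alpha>})"
    have "|C| \<le>o |UNIV :: 'i set set|"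
      unfolding C_def using card_of_image m ordLeq_transitive by blast
    moreover have "|B| \<le>o |UNIV :: 'i set set|" unfolding B_def
    proof (rule card_of_UNION_ordLeq_infinite[OF inf2])
      show "|{\<alpha>\<in>Field S. (\<alpha>, \<beta>) \<in> S - Id}| \<le>o |UNIV :: 'i set set|"
        by (rule ordLeq_transitive[OF card_of_mono1 o]) auto
      show "\<forall>\<alpha>\<in>{\<alpha>\<in>Field S. (\<alpha>, \<beta>) \<in> S - Id}.
          |(\<lambda>H x. H (x \<alpha>) x) ` {H. \<forall>t. H t \<in> A \<alpha>}| \<le>o |UNIV :: 'i set set|"
        using ordLeq_transitive[OF card_of_image pw] less by blast
    qed
    ultimately have "|C \<union> B| \<le>o |UNIV :: 'i set set|"
      by (rule card_of_Un_ordLeq_infinite_Field[OF infinite_Field_card_of[OF inf2] _ _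
            card_of_Card_order])
    moreover have "A \<beta> \<subseteq> C \<union> B"
    proof
      fix G assume "G \<in> A \<beta>"
      then have "adapted \<beta> G" by (simp add: A_def)
      then show "G \<in> C \<union> B"
      proof (cases rule: adapted.cases)
        case (const c)
        then show ?thesis by (auto simp: C_def)
      next
        case (step \<alpha> H)
        then have "H \<in> {H. \<forall>t. H t \<in> A \<alpha>}" by (simp add: A_def)
        then show ?thesis unfolding step(1) B_def using step(2) S_less_Field[OF step(2)] by blast
      qed
    qed
    ultimately show ?case using card_of_mono1 ordLeq_transitive by blast
  qed
  have "|\<Union>\<beta>\<in>Field S. A \<beta>| \<le>o |UNIV :: 'i set set|"
    by (rule card_of_UNION_ordLeq_infinite[OF inf2 o]) (use A in blast)
  moreover have "{G. \<exists>\<beta>. adapted \<beta> G} \<subseteq> (\<Union>\<beta>\<in>Field S. A \<beta>)"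
    using adapted_Field by (auto simp: A_def)
  ultimately show ?thesis using card_of_mono1 ordLeq_transitive by blast
qed

end

text \<open>The formulas are indexed by \<open>'i\<close>, and \<open>X\<close> allots finitely many
  of them to each \<open>t\<close>. All parameters are adapted at a common \<open>\<beta>\<close>,
  so coordinate \<open>\<beta>\<close> is still unread: the new element reads \<open>t\<close> there
  and then realizes the finite part allotted to \<open>t\<close>. Each formula is in that part for
  almost all \<open>t\<close>.\<close>

lemma (in ultra_limit) realizes_type_LM:
  fixes X :: "'i \<Rightarrow> 'i set"
  assumes inf: "infinite (UNIV :: 'i set)"
    and X: "\<And>i. \<forall>\<^sub>F t in F. t \<in> X i" "\<And>t. finite {i. t \<in> X i}"
    and bd: "\<And>B. B \<subseteq> Field S \<Longrightarrow> |B| \<le>o |UNIV :: 'i set| \<Longrightarrow> \<exists>\<beta>\<in>Field S. \<forall>\<alpha>\<in>B. (\<alpha>, \<beta>) \<in> S"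
    and cnt: "|UNIV :: ('f, 'r) fm set| \<le>o |UNIV :: 'i set|"
    and A: "A \<subseteq> U" "|A| \<le>o |UNIV :: 'i set|" and p: "type_over LM A p"
  shows "\<exists>a\<in>U. realizes LM a p"
proof -
  obtain z0 where z0: "z0 \<in> U" using is_struc_LM by (auto simp: is_struc_def)
  define A' where "A' = insert z0 A"
  have A'U: "A' \<subseteq> U" using z0 A by (simp add: A'_def)
  have "|{z0} \<union> A| \<le>o |UNIV :: 'i set|"
    by (rule card_of_Un_ordLeq_infinite_Field[OF infinite_Field_card_of[OF inf]
          card_of_singl_ordLeq A(2) card_of_Card_order]) simp
  then have cA': "|A'| \<le>o |UNIV :: 'i set|" by (simp add: A'_def)
  \<comment> \<open>Values of \<open>e\<close> off the free variables are reset to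
    \<open>z0\<close>. Otherwise the type could contain more than \<open>\<lambda>\<close>
    assignments that differ only there, and the indexing \<open>j\<close> would not exist.\<close>
  define nrm where "nrm = (\<lambda>(\<phi> :: ('f, 'r) fm, e). (\<phi>, \<lambda>v. if v \<in> fv \<phi> - {0} then e v else z0))"
  define P where "P = nrm ` p"
  have nrm_simp: "nrm (\<phi>, e) = (\<phi>, \<lambda>v. if v \<in> fv \<phi> - {0} then e v else z0)" for \<phi> e
    by (simp add: nrm_def)
  have PA: "snd y v \<in> A'" if yP: "y \<in> P" for y v
  proof -
    obtain \<phi> e where y: "(\<phi>, e) \<in> p" "y = nrm (\<phi>, e)" using yP by (auto simp: P_def)
    then have "\<forall>v\<in>fv \<phi> - {0}. e v \<in> A" using p by (auto simp: type_over_def fm_over_def)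
    then show ?thesis by (auto simp: y nrm_simp A'_def)
  qed
  have P_off: "snd y v = z0" if "y \<in> P" "v \<notin> fv (fst y) - {0}" for y v
    using that by (auto simp: P_def nrm_def)
  have "|P| \<le>o |UNIV :: 'i set|"
  proof -
    define c where "c = (\<lambda>(\<phi> :: ('f, 'r) fm, e :: nat \<Rightarrow> 'z). (\<phi>, map e (sorted_list_of_set (fv \<phi>))))"
    have "inj_on c P"
    proof (rule inj_onI)
      fix y y' assume y: "y \<in> P" "y' \<in> P" and "c y = c y'"
      then have 1: "fst y = fst y'" and 2: "\<forall>v\<in>fv (fst y). snd y v = snd y' v"
        by (auto simp: c_def finite_fv split: prod.splits)
      have "snd y v = snd y' v" for v
        using 2 P_off[OF y(1), of v] P_off[OF y(2), of v] 1 by (cases "v \<in> fv (fst y)") auto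
      then show "y = y'" using 1 by (simp add: prod_eq_iff fun_eq_iff)
    qed
    moreover have "c ` P \<subseteq> UNIV \<times> lists A'"
      using PA by (force simp: c_def)
    ultimately have "|P| \<le>o |(UNIV :: ('f, 'r) fm set) \<times> lists A'|"
      using card_of_ordLeq[of P] by blast
    also have "|(UNIV :: ('f, 'r) fm set) \<times> lists A'| \<le>o |UNIV :: 'i set|"
      by (rule card_of_Times_ordLeq_infinite_Field[OF infinite_Field_card_of[OF inf] cnt
            card_of_lists_ordLeq[OF inf cA'] card_of_Card_order])
    finally show ?thesis .
  qed
  then obtain j :: "('f, 'r) fm \<times> (nat \<Rightarrow> 'z) \<Rightarrow> 'i" where j: "inj_on j P"
    using card_of_ordLeq[of P "UNIV :: 'i set"] by auto
  obtain rk where rk: "\<And>a. a \<in> U \<Longrightarrow> adapted (rk a) (dec a)"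
    using dec_adapted by metis
  have "rk ` A' \<subseteq> Field S" using rk A'U adapted_Field by blast
  moreover have "|rk ` A'| \<le>o |UNIV :: 'i set|"
    using card_of_image cA' ordLeq_transitive by blast
  ultimately obtain \<beta> where \<beta>: "\<beta> \<in> Field S" "\<forall>\<alpha>\<in>rk ` A'. (\<alpha>, \<beta>) \<in> S" using bd by blast
  have ad: "adapted \<beta> (dec a)" if "a \<in> A'" for a
    using adapted_mono[OF rk] \<beta> that A'U by blast
  define u where "u t = {y\<in>P. t \<in> X (j y)}" for t
  have fin_u: "finite (u t)" for t
  proof -
    have "finite (j -` {i. t \<in> X i} \<inter> P)" by (rule finite_vimage_IntI[OF X(2) j])
    moreover have "j -` {i. t \<in> X i} \<inter> P = u t" by (auto simp: u_def)
    ultimately show ?thesis by simp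
  qed
  define h where "h t e = (SOME m. \<forall>y\<in>u t. sat M0 ((\<lambda>v. e (y, v))(0 := m)) (fst y))" for t e
  define w where "w t x = h t (\<lambda>(y, v). dec (snd y v) x)" for t x
  have ad_w: "adapted \<beta> (w t)" for t
  proof -
    have "adapted \<beta> (\<lambda>x. h t (\<lambda>yv. (\<lambda>(y, v). dec (snd y v)) yv x))"
    proof (rule adapted_comp[where V = "SIGMA y:u t. fv (fst y)" and h = "h t"])
      show "finite (SIGMA y:u t. fv (fst y))" using fin_u finite_fv by blast
      show "adapted \<beta> ((\<lambda>(y, v). dec (snd y v)) yv)" if "yv \<in> (SIGMA y:u t. fv (fst y))" for yv
        using that ad PA by (auto simp: u_def)
      show "\<beta> \<in> Field S" by (rule \<beta>)
      fix e e' :: "(('f, 'r) fm \<times> (nat \<Rightarrow> 'z)) \<times> nat \<Rightarrow> 'm"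
      assume e: "\<And>v. v \<in> (SIGMA y:u t. fv (fst y)) \<Longrightarrow> e v = e' v"
      have "sat M0 ((\<lambda>v. e (y, v))(0 := m)) (fst y) \<longleftrightarrow> sat M0 ((\<lambda>v. e' (y, v))(0 := m)) (fst y)"
        if "y \<in> u t" for y m
        by (rule sat_cong) (use that e in auto)
      then show "h t e = h t e'" by (simp add: h_def cong: ball_cong)
    qed
    moreover have "(\<lambda>x. h t (\<lambda>yv. (\<lambda>(y, v). dec (snd y v)) yv x)) = w t"
      by (auto simp: w_def fun_eq_iff case_prod_unfold)
    ultimately show ?thesis by simp
  qed
  have upd: "(\<lambda>v. dec ((e(0 := a)) v) x) = (\<lambda>v. dec (e v) x)(0 := dec a x)" for e a x by auto
  \<comment> \<open>A realization of the finite part in the limit model solves it at almost every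
    \<open>x\<close>, so the pointwise choice in \<open>h\<close> succeeds there; the chosen values
    need not be those of that realization.\<close>
  have wit: "\<forall>\<^sub>F x in E. \<forall>y\<in>u t. sat M0 ((\<lambda>v. dec (snd y v) x)(0 := w t x)) (fst y)" for t
  proof -
    have "u t \<subseteq> nrm ` p" by (auto simp: u_def P_def)
    then obtain q where q: "q \<subseteq> p" "finite q" "u t = nrm ` q"
      using finite_subset_image[OF fin_u] by metis
    then obtain a where a: "a \<in> U" "realizes LM a q" using p by (auto simp: type_over_def)
    have *: "\<forall>\<^sub>F x in E. sat M0 ((\<lambda>v. dec (snd y v) x)(0 := dec a x)) (fst y)" if yu: "y \<in> u t" for y
    proof -
      obtain \<phi> e where y: "(\<phi>, e) \<in> q" "y = nrm (\<phi>, e)" using yu q by auto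
      have "sat LM (e(0 := a)) \<phi>" using a y by (auto simp: realizes_def)
      also have "sat LM (e(0 := a)) \<phi> \<longleftrightarrow> sat LM ((snd y)(0 := a)) \<phi>"
        by (rule sat_cong) (auto simp: y nrm_simp)
      finally have "sat LM ((snd y)(0 := a)) (fst y)" by (simp add: y nrm_simp)
      moreover have "((snd y)(0 := a)) v \<in> U" for v
        using a PA[of y v] A'U yu by (auto simp: u_def)
      ultimately show ?thesis using sat_LM[of "(snd y)(0 := a)" "fst y"] unfolding upd by blast
    qed
    have "\<forall>\<^sub>F x in E. \<forall>y\<in>u t. sat M0 ((\<lambda>v. dec (snd y v) x)(0 := dec a x)) (fst y)"
      by (rule eventually_ball_finite[OF fin_u ballI[OF *]])
    then show ?thesis
    proof eventually_elim
      case (elim x)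
      then have "\<exists>m. \<forall>y\<in>u t. sat M0 ((\<lambda>v. dec (snd y v) x)(0 := m)) (fst y)" by blast
      from someI_ex[OF this] show ?case by (simp add: w_def h_def)
    qed
  qed
  obtain \<gamma> where \<gamma>: "(\<beta>, \<gamma>) \<in> S - Id" using nomax \<beta> by blast
  have ad_g: "adapted \<gamma> (\<lambda>x. w (x \<beta>) x)" by (rule adapted.step[OF \<gamma> ad_w])
  define a where "a = cl (\<lambda>x. w (x \<beta>) x)"
  have aU: "a \<in> U" unfolding a_def by (rule cl_U[OF ad_g])
  have "sat LM (e(0 := a)) \<phi>" if "(\<phi>, e) \<in> p" for \<phi> e
  proof -
    define y where "y = nrm (\<phi>, e)"
    have y: "y \<in> P" "fst y = \<phi>"
      unfolding y_def P_def using that by (rule imageI) (simp add: nrm_simp)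
    define Q where "Q t x \<longleftrightarrow> sat M0 ((\<lambda>v. dec (snd y v) x)(0 := w t x)) \<phi>" for t x
    have "adapted \<beta> (Q t)" for t
    proof -
      have "adapted \<beta> (\<lambda>x. sat M0 (\<lambda>v. (if v = 0 then w t else dec (snd y v)) x) \<phi>)"
      proof (rule adapted_comp[where V = "fv \<phi>" and h = "\<lambda>e. sat M0 e \<phi>"])
        show "adapted \<beta> (if v = 0 then w t else dec (snd y v))" for v
          using ad_w ad PA[OF y(1)] by simp
      qed (rule finite_fv \<beta> sat_cong, assumption?)+
      moreover have "(\<lambda>v. (if v = 0 then w t else dec (snd y v)) x) = (\<lambda>v. dec (snd y v) x)(0 := w t x)" for x
        by auto
      ultimately show ?thesis by (simp add: Q_def[abs_def])
    qed
    moreover have "\<forall>\<^sub>F t in F. eventually (Q t) E"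
      using X(1)[of "j y"]
    proof eventually_elim
      case (elim t)
      then have "y \<in> u t" using y by (simp add: u_def)
      from wit[of t] show ?case by eventually_elim (use \<open>y \<in> u t\<close> y in \<open>auto simp: Q_def\<close>)
    qed
    ultimately have "\<forall>\<^sub>F x in E. Q (x \<beta>) x" using E_step[of \<beta> Q] by blast
    then have "\<forall>\<^sub>F x in E. sat M0 ((\<lambda>v. dec (snd y v) x)(0 := dec a x)) \<phi>"
      using dec_cl[OF ad_g] by eventually_elim (simp add: Q_def a_def)
    moreover have "((snd y)(0 := a)) v \<in> U" for v using aU PA[OF y(1), of v] A'U by auto
    ultimately have "sat LM ((snd y)(0 := a)) \<phi>"
      using sat_LM[of "(snd y)(0 := a)" \<phi>] unfolding upd by blast
    also have "sat LM ((snd y)(0 := a)) \<phi> \<longleftrightarrow> sat LM (e(0 := a)) \<phi>"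
      by (rule sat_cong) (auto simp: y_def nrm_simp)
    finally show ?thesis .
  qed
  then show ?thesis using aU by (auto simp: realizes_def)
qed

lemma card_of_countable_ordLeq:
  assumes "infinite A"
  shows "|UNIV :: 'b::countable set| \<le>o |A|"
proof -
  have "|UNIV :: 'b set| \<le>o |UNIV :: nat set|"
    using card_of_ordLeq[of "UNIV :: 'b set" "UNIV :: nat set"] inj_to_nat by blast
  also have "|UNIV :: nat set| \<le>o |A|" using assms infinite_iff_card_of_nat by blast
  finally show ?thesis .
qed

section \<open>A saturated tree containing the finite sequences of natural numbers\<close>

definition prefix_struc :: "(nat, nat, nat list) struc" where
  "prefix_struc = \<lparr> univ = UNIV, fun_int = (\<lambda>_ _. []),
     rel_int = (\<lambda>_ xs. case xs of [x, y] \<Rightarrow> prefix x y | _ \<Rightarrow> False) \<rparr>"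

lemma saturated_tree_exists:
  fixes D :: "'i set set"
  assumes inf: "infinite (UNIV :: 'i set)" and uf: "ultrafilter D" and reg: "regular_uf D"
  obtains M :: "(nat, nat, 'i set) struc" and k :: "nat list \<Rightarrow> 'i set" where
    "is_struc M" "saturated (cardSuc |UNIV :: 'i set| ) M"
    "\<And>x. x \<in> univ M \<Longrightarrow> rel_int M 0 [x, x]"
    "\<And>x y. x \<in> univ M \<Longrightarrow> y \<in> univ M \<Longrightarrow> rel_int M 0 [x, y] \<Longrightarrow> rel_int M 0 [y, x] \<Longrightarrow> x = y"
    "\<And>x y z. rel_int M 0 [x, y] \<Longrightarrow> rel_int M 0 [y, z] \<Longrightarrow> rel_int M 0 [x, z]"
    "\<And>x y z. x \<in> univ M \<Longrightarrow> y \<in> univ M \<Longrightarrow> rel_int M 0 [x, z] \<Longrightarrow> rel_int M 0 [y, z]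
      \<Longrightarrow> rel_int M 0 [x, y] \<or> rel_int M 0 [y, x]"
    "\<And>l. k l \<in> univ M" "\<And>l l'. rel_int M 0 [k l, k l'] \<longleftrightarrow> prefix l l'"
proof -
  define F where "F = uf_filter D"
  \<comment> \<open>The length \<open>\<lambda>\<^sup>+\<close> is regular, so any
    \<open>\<lambda>\<close> parameters have a common rank below it, and it is at most
    \<open>2\<^sup>\<lambda>\<close>, so the limit still fits on \<open>'i set\<close>.\<close>
  define S where "S = cardSuc |UNIV :: 'i set|"
  have ultF: "ultra F" unfolding F_def by (rule ultra_uf_filter[OF uf])
  have co: "Card_order S" unfolding S_def by (rule cardSuc_Card_order[OF card_of_Card_order])
  have infS: "infinite (Field S)"
    using cardSuc_finite[OF card_of_Card_order, of "UNIV :: 'i set"] inf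
    by (simp add: S_def Field_card_of)
  interpret iterated_ultra F S
  proof (intro iterated_ultra.intro ultF iterated_ultra_axioms.intro)
    show "Well_order S" using co card_order_on_well_order_on by blast
    show "\<exists>\<beta>. (\<alpha>, \<beta>) \<in> S - Id" if "\<alpha> \<in> Field S" for \<alpha>
      using infinite_Card_order_limit[OF co infS that] by auto
    show "Field S \<noteq> {}" using infS by auto
  qed
  have cardFS: "|Field S| \<le>o |UNIV :: 'i set set|" by (rule card_of_mono1) simp
  have ile: "|UNIV :: 'i set| \<le>o |UNIV :: 'i set set|"
    using card_of_Pow[of "UNIV :: 'i set"] ordLess_imp_ordLeq by (simp add: Pow_UNIV) 
  obtain U :: "'i set set" and dec cl where "ultra_limit F S prefix_struc U dec cl"
    using ultra_limit_exists[of prefix_struc, OF _ card_adapted[OF inf _ cardFS]]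
      ordLeq_transitive[OF card_of_countable_ordLeq[OF inf] ile]
    by (auto simp: prefix_struc_def)
  then interpret ultra_limit F S prefix_struc U dec cl .
  have rel: "rel_int LM 0 [x, y] \<longleftrightarrow> (\<forall>\<^sub>F t in E. prefix (dec x t) (dec y t))" for x y
    unfolding LM_simps by (simp add: prefix_struc_def)
  obtain X :: "'i \<Rightarrow> 'i set" where X: "\<And>i. X i \<in> D" "\<And>t. finite {i. t \<in> X i}"
    using reg by (auto simp: regular_uf_def)
  have XF: "\<forall>\<^sub>F t in F. t \<in> X i" for i using X by (simp add: F_def eventually_uf_filter[OF uf])
  have bd: "\<exists>\<beta>\<in>Field S. \<forall>\<alpha>\<in>B. (\<alpha>, \<beta>) \<in> S" if B: "B \<subseteq> Field S" "|B| \<le>o |UNIV :: 'i set|" for B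
  proof (rule ccontr)
    assume n: "\<not> (\<exists>\<beta>\<in>Field S. \<forall>\<alpha>\<in>B. (\<alpha>, \<beta>) \<in> S)"
    have "cofinal B S" unfolding cofinal_def
    proof
      fix a assume a: "a \<in> Field S"
      then obtain b where b: "b \<in> B" "(b, a) \<notin> S" using n by blast
      then have "(a, b) \<in> S" "a \<noteq> b" using S_total[of a b] S_refl[of a] a B(1) by auto
      then show "\<exists>b\<in>B. a \<noteq> b \<and> (a, b) \<in> S" using b by blast
    qed
    moreover have "regularCard S" unfolding S_def
      by (rule infinite_cardSuc_regularCard) (use inf in \<open>simp_all add: card_of_card_order_on Field_card_of\<close>)
    ultimately have "|B| =o S" using B by (auto simp: regularCard_def)
    moreover have "|UNIV :: 'i set| <o S" unfolding S_def by (rule cardSuc_greater[OF card_of_Card_order])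
    ultimately have "|B| <o |B|"
      using ordLess_ordIso_trans[OF ordLeq_ordLess_trans[OF B(2)] ordIso_symmetric] by blast
    then show False using ordLess_irreflexive by blast
  qed
  have "saturated S LM"
    unfolding saturated_def
  proof (intro allI impI, elim conjE)
    fix A and p :: "((nat, nat) fm \<times> (nat \<Rightarrow> 'i set)) set"
    assume A: "A \<subseteq> univ LM" "|A| <o S" "type_over LM A p"
    have "|A| \<le>o |UNIV :: 'i set|"
      by (rule A(2)[unfolded S_def cardSuc_ordLeq_ordLess[OF card_of_Card_order card_of_Card_order]])
    then show "\<exists>a\<in>univ LM. realizes LM a p"
      using realizes_type_LM[where X = X, OF inf XF X(2) bd card_of_countable_ordLeq[OF inf] _ _ A(3)] A(1)
      by simp
  qed
  moreover obtain \<beta> where \<beta>: "\<beta> \<in> Field S" using S_ne by blast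
  define k where "k l = cl (\<lambda>_. l)" for l
  have k: "\<forall>\<^sub>F x in E. dec (k l) x = l" for l unfolding k_def by (rule dec_cl[OF adapted.const[OF \<beta>]])
  have kU: "k l \<in> U" for l unfolding k_def by (rule cl_U[OF adapted.const[OF \<beta>]])
  have krel: "rel_int LM 0 [k l, k l'] \<longleftrightarrow> prefix l l'" for l l'
  proof -
    have "rel_int LM 0 [k l, k l'] \<longleftrightarrow> (\<forall>\<^sub>F x in E. prefix l l')"
      unfolding rel by (rule eventually_cong[OF eventually_conj[OF k[of l] k[of l']]]) auto
    then show ?thesis using E_proper by simp
  qed
  show thesis
  proof (rule that[of LM k])
    show "is_struc LM" by (rule is_struc_LM)
    show "saturated (cardSuc |UNIV :: 'i set| ) LM" using \<open>saturated S LM\<close> by (simp add: S_def)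
    show "rel_int LM 0 [x, x]" for x unfolding rel by simp
    show "x = y" if "x \<in> univ LM" "y \<in> univ LM" "rel_int LM 0 [x, y]" "rel_int LM 0 [y, x]" for x y
    proof (rule dec_eq)
      show "\<forall>\<^sub>F t in E. dec x t = dec y t"
        using that(3,4) unfolding rel by eventually_elim (rule prefix_order.antisym)
    qed (use that in auto)
    show "rel_int LM 0 [x, z]" if "rel_int LM 0 [x, y]" "rel_int LM 0 [y, z]" for x y z
      using that unfolding rel by eventually_elim (rule prefix_order.trans)
    show "rel_int LM 0 [x, y] \<or> rel_int LM 0 [y, x]"
      if xyz: "x \<in> univ LM" "y \<in> univ LM" "rel_int LM 0 [x, z]" "rel_int LM 0 [y, z]" for x y z
    proof (rule disjCI)
      assume n: "\<not> rel_int LM 0 [y, x]"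
      obtain \<gamma> where "adapted \<gamma> (\<lambda>t. prefix (dec y t) (dec x t))"
        using adapted_dec_list[of "[y, x]" "\<lambda>xs. prefix (xs ! 0) (xs ! 1)"] xyz by auto
      from E_not[OF this] have "\<forall>\<^sub>F t in E. \<not> prefix (dec y t) (dec x t)" using n rel by blast
      then show "rel_int LM 0 [x, y]" using xyz(3,4) unfolding rel
        by eventually_elim (use prefix_same_cases in blast)
    qed
    show "k l \<in> univ LM" for l using kU by simp
    show "rel_int LM 0 [k l, k l'] \<longleftrightarrow> prefix l l'" for l l' by (rule krel)
  qed
qed

section \<open>Treetops for trees of lists\<close>

definition self_interp :: "(nat, nat) interp" where
  "self_interp = \<lparr> dim = 1, dom_fm = Equal (Var 0) (Var 0), eq_fm = Equal (Var 0) (Var 1),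
     le_fm = Atom 0 [Var 0, Var 1] \<rparr>"

lemma self_interp_dom: "int_dom M self_interp c = {[x] | x. x \<in> univ M}"
  by (auto simp: int_dom_def self_interp_def length_Suc_conv)

lemma self_interp_eq: "int_eq M self_interp c = {([x], [x]) | x. x \<in> univ M}"
  unfolding int_eq_def self_interp_dom by (auto simp: self_interp_def tuple_asg_def)

lemma self_interp_le:
  "int_le M self_interp c = {([x], [y]) | x y. x \<in> univ M \<and> y \<in> univ M \<and> rel_int M 0 [x, y]}"
  unfolding int_le_def self_interp_dom by (auto simp: self_interp_def tuple_asg_def)

lemma self_interp_nodes: "tree_nodes M self_interp c = {{[x]} | x. x \<in> univ M}"
  unfolding tree_nodes_def quotient_def self_interp_dom self_interp_eq by auto

lemma self_interp_tree_le:
  "tree_le M self_interp c = {({[x]}, {[y]}) | x y. x \<in> univ M \<and> y \<in> univ M \<and> rel_int M 0 [x, y]}"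
  unfolding tree_le_def self_interp_nodes self_interp_le by auto

lemma self_interp_interprets_tree:
  assumes "range c \<subseteq> univ M"
    and refl: "\<And>x. x \<in> univ M \<Longrightarrow> rel_int M 0 [x, x]"
    and anti: "\<And>x y. x \<in> univ M \<Longrightarrow> y \<in> univ M \<Longrightarrow> rel_int M 0 [x, y] \<Longrightarrow> rel_int M 0 [y, x] \<Longrightarrow> x = y"
    and trans: "\<And>x y z. rel_int M 0 [x, y] \<Longrightarrow> rel_int M 0 [y, z] \<Longrightarrow> rel_int M 0 [x, z]"
    and tree: "\<And>x y z. x \<in> univ M \<Longrightarrow> y \<in> univ M \<Longrightarrow> rel_int M 0 [x, z] \<Longrightarrow> rel_int M 0 [y, z]
      \<Longrightarrow> rel_int M 0 [x, y] \<or> rel_int M 0 [y, x]"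
  shows "interprets_tree M self_interp c"
  unfolding interprets_tree_def
proof (intro conjI)
  show "range c \<subseteq> univ M" by fact
  show "equiv (int_dom M self_interp c) (int_eq M self_interp c)"
    unfolding self_interp_dom self_interp_eq
    by (auto simp: equiv_def refl_on_def sym_def trans_def)
  show "(\<lambda>xs ys. (xs, ys) \<in> int_le M self_interp c) respects2 int_eq M self_interp c"
    unfolding self_interp_eq by (auto simp: congruent2_def)
  show "is_tree (tree_nodes M self_interp c) (tree_le M self_interp c)"
    unfolding is_tree_def
  proof (intro conjI ballI)
    show "partial_order_on (tree_nodes M self_interp c) (tree_le M self_interp c)"
      unfolding partial_order_on_def preorder_on_def
    proof (intro conjI)
      show "refl_on (tree_nodes M self_interp c) (tree_le M self_interp c)"
        unfolding refl_on_def self_interp_nodes self_interp_tree_le using refl by auto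
      show "tree_le M self_interp c \<subseteq> tree_nodes M self_interp c \<times> tree_nodes M self_interp c"
        unfolding self_interp_nodes self_interp_tree_le by auto
      show "trans (tree_le M self_interp c)"
      proof (rule transI)
        fix X Y Z assume "(X, Y) \<in> tree_le M self_interp c" "(Y, Z) \<in> tree_le M self_interp c"
        then obtain x y z where "X = {[x]}" "Y = {[y]}" "Z = {[z]}" "x \<in> univ M" "z \<in> univ M"
          "rel_int M 0 [x, y]" "rel_int M 0 [y, z]"
          unfolding self_interp_tree_le by auto
        then show "(X, Z) \<in> tree_le M self_interp c"
          unfolding self_interp_tree_le using trans[of x y z] by auto
      qed
      show "antisym (tree_le M self_interp c)"
        unfolding self_interp_tree_le using anti by (auto simp: antisym_def)
    qed
    fix Z assume "Z \<in> tree_nodes M self_interp c"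
    show "total_on {X. (X, Z) \<in> tree_le M self_interp c} (tree_le M self_interp c)"
    proof (rule total_onI)
      fix X Y assume "X \<in> {X. (X, Z) \<in> tree_le M self_interp c}" "Y \<in> {X. (X, Z) \<in> tree_le M self_interp c}"
      then obtain x y z where "X = {[x]}" "Y = {[y]}" "x \<in> univ M" "y \<in> univ M"
        "rel_int M 0 [x, z]" "rel_int M 0 [y, z]"
        unfolding self_interp_tree_le by auto
      then show "(X, Y) \<in> tree_le M self_interp c \<or> (Y, X) \<in> tree_le M self_interp c"
        unfolding self_interp_tree_le using tree[of x y z] by auto
    qed
  qed
qed

lemma prefix_map_injD:
  assumes "prefix (map f xs) (map f ys)" "inj_on f (set xs \<union> set ys)"
  shows "prefix xs ys"
proof -
  have "take (length xs) (map f ys) = map f xs"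
    using assms(1) by (auto simp: prefix_def)
  then have "map f (take (length xs) ys) = map f xs" by (simp add: take_map)
  moreover have "inj_on f (set (take (length xs) ys) \<union> set xs)"
    using assms(2) by (rule inj_on_subset) (auto dest: in_set_takeD)
  ultimately have "take (length xs) ys = xs" by (simp add: inj_on_map_eq_map)
  then show ?thesis using take_is_prefix by metis
qed

locale treetops_uf =
  fixes D :: "'i set set"
  assumes inf: "infinite (UNIV :: 'i set)"
    and uf: "ultrafilter D" and reg: "regular_uf D" and tt: "has_treetops D"
begin

abbreviation F :: "'i filter" where "F \<equiv> uf_filter D"

sublocale ultra F by (rule ultra_uf_filter[OF uf])

lemma ev_F: "eventually P F \<longleftrightarrow> {t. P t} \<in> D"
  by (rule eventually_uf_filter[OF uf])

lemma up_rep_up_class: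
  assumes "\<And>t. g t \<in> univ M"
  shows "\<forall>\<^sub>F t in F. up_rep (up_class D M g) t = g t"
proof -
  have "g \<in> up_class D M g" using assms uf by (simp add: up_class_def ultrafilter_def)
  then have "up_rep (up_class D M g) \<in> up_class D M g" unfolding up_rep_def by (rule someI[of "\<lambda>h. h \<in> up_class D M g"])
  then have "\<forall>\<^sub>F t in F. g t = up_rep (up_class D M g) t" by (simp add: up_class_def ev_F)
  then show ?thesis by eventually_elim simp
qed

text \<open>A finite tree embeds into the saturated tree, and an upper bound there is replaced by the
  longest node of the finite tree below it.\<close>

lemma treetop_regular:
  fixes T :: "'i \<Rightarrow> 'b list set" and a :: "'i \<Rightarrow> 'i \<Rightarrow> 'b list" and \<gamma> :: "'i rel"
  assumes \<gamma>: "Card_order \<gamma>" "infinite (Field \<gamma>)" "regularCard \<gamma>"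
    and fin: "\<And>t. finite (T t)" and ne: "\<And>t. T t \<noteq> {}"
    and aT: "\<And>i t. i \<in> Field \<gamma> \<Longrightarrow> a i t \<in> T t"
    and mono: "\<And>i j. (i, j) \<in> \<gamma> \<Longrightarrow> \<forall>\<^sub>F t in F. prefix (a i t) (a j t)"
  shows "\<exists>b. (\<forall>t. b t \<in> T t) \<and> (\<forall>i\<in>Field \<gamma>. \<forall>\<^sub>F t in F. prefix (a i t) (b t))"
proof (rule saturated_tree_exists[OF inf uf reg])
  fix M :: "(nat, nat, 'i set) struc" and k :: "nat list \<Rightarrow> 'i set"
  assume M: "is_struc M"
    "saturated (cardSuc |UNIV :: 'i set| ) M"
    and Mrefl: "\<And>x. x \<in> univ M \<Longrightarrow> rel_int M 0 [x, x]"
    and Manti: "\<And>x y. x \<in> univ M \<Longrightarrow> y \<in> univ M \<Longrightarrow> rel_int M 0 [x, y] \<Longrightarrow> rel_int M 0 [y, x] \<Longrightarrow> x = y"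
    and Mtrans: "\<And>x y z. rel_int M 0 [x, y] \<Longrightarrow> rel_int M 0 [y, z] \<Longrightarrow> rel_int M 0 [x, z]"
    and Mtree: "\<And>x y z. x \<in> univ M \<Longrightarrow> y \<in> univ M \<Longrightarrow> rel_int M 0 [x, z] \<Longrightarrow> rel_int M 0 [y, z]
      \<Longrightarrow> rel_int M 0 [x, y] \<or> rel_int M 0 [y, x]"
    and k: "\<And>l. k l \<in> univ M" "\<And>l l'. rel_int M 0 [k l, k l'] \<longleftrightarrow> prefix l l'"
  \<comment> \<open>The standard nodes of the saturated tree are sequences of natural numbers, so
    the finitely many labels of each \<open>T t\<close> are numbered, separately for every
    \<open>t\<close>.\<close>
  have "\<exists>f :: 'b \<Rightarrow> nat. inj_on f (\<Union>(set ` T t))" for t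
    using finite_imp_inj_to_nat_seg[of "\<Union>(set ` T t)"] fin by auto
  then obtain f :: "'i \<Rightarrow> 'b \<Rightarrow> nat" where f: "\<And>t. inj_on (f t) (\<Union>(set ` T t))" by metis
  define N where "N = ultrapower D M"
  define c where "c = (\<lambda>v :: nat. k [])"
  define c' where "c' = (\<lambda>v. up_class D M (\<lambda>t. c v))"
  have univN: "univ N = up_class D M ` {g. \<forall>t. g t \<in> univ M}" by (simp add: N_def ultrapower_def)
  have relN: "rel_int N 0 [up_class D M g, up_class D M h] \<longleftrightarrow> (\<forall>\<^sub>F t in F. rel_int M 0 [g t, h t])"
    if "\<And>t. g t \<in> univ M" "\<And>t. h t \<in> univ M" for g h
  proof -
    have "rel_int N 0 [up_class D M g, up_class D M h]
      \<longleftrightarrow> (\<forall>\<^sub>F t in F. rel_int M 0 [up_rep (up_class D M g) t, up_rep (up_class D M h) t])"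
      by (simp add: N_def ultrapower_def ev_F)
    also have "\<dots> \<longleftrightarrow> (\<forall>\<^sub>F t in F. rel_int M 0 [g t, h t])"
      by (rule eventually_cong[OF eventually_conj[OF up_rep_up_class[of g M] up_rep_up_class[of h M]]])
        (use that in auto)
    finally show ?thesis .
  qed
  define g where "g i t = k (map (f t) (a i t))" for i t
  have gM: "g i t \<in> univ M" for i t by (simp add: g_def k)
  define A where "A i = {[up_class D M (g i)]}" for i
  have tree: "interprets_tree M self_interp c"
    by (rule self_interp_interprets_tree) (use k Mrefl Manti Mtrans Mtree in \<open>auto simp: c_def\<close>)
  have small: "\<gamma> <o cardSuc |UNIV :: 'i set|"
  proof -
    have "\<gamma> =o |Field \<gamma>|" using \<gamma>(1) card_of_Field_ordIso ordIso_symmetric by blast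
    also have "|Field \<gamma>| \<le>o |UNIV :: 'i set|" by (rule card_of_mono1) simp
    also have "|UNIV :: 'i set| <o cardSuc |UNIV :: 'i set|" by (rule cardSuc_greater[OF card_of_Card_order])
    finally show ?thesis .
  qed
  have upN: "up_class D M h \<in> univ N" if "\<And>t. h t \<in> univ M" for h using that by (auto simp: univN)
  have gN: "up_class D M (g i) \<in> univ N" for i by (rule upN) (rule gM)
  have "\<forall>i\<in>Field \<gamma>. A i \<in> tree_nodes N self_interp c'"
    unfolding self_interp_nodes A_def using gN by auto
  moreover have "(A i, A j) \<in> tree_le N self_interp c'" if "(i, j) \<in> \<gamma>" for i j
  proof -
    have "\<forall>\<^sub>F t in F. rel_int M 0 [g i t, g j t]"
      using mono[OF that] by eventually_elim (simp add: g_def k map_mono_prefix)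
    then have "rel_int N 0 [up_class D M (g i), up_class D M (g j)]"
      by (subst relN) (rule gM)+
    then show ?thesis unfolding self_interp_tree_le A_def using gN by auto
  qed
  ultimately have "\<exists>b\<in>tree_nodes N self_interp c'. \<forall>i\<in>Field \<gamma>. (A i, b) \<in> tree_le N self_interp c'"
    using tt[unfolded has_treetops_def, rule_format, of M self_interp c \<gamma> A] M tree \<gamma> small
    by (simp add: Let_def N_def c'_def)
  then obtain B where B: "B \<in> univ N" "\<And>i. i \<in> Field \<gamma> \<Longrightarrow> rel_int N 0 [up_class D M (g i), B]"
    unfolding self_interp_tree_le self_interp_nodes A_def by auto
  then obtain h where h: "\<And>t. h t \<in> univ M" "B = up_class D M h" by (auto simp: univN)
  have gh: "\<forall>\<^sub>F t in F. rel_int M 0 [g i t, h t]" if "i \<in> Field \<gamma>" for i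
    using B(2)[OF that] relN[of "g i" h] gM h by simp
  define C where "C t = {x\<in>T t. rel_int M 0 [k (map (f t) x), h t]}" for t
  have "\<exists>b\<in>T t. \<forall>x\<in>C t. prefix x b" for t
  proof (cases "C t = {}")
    case True
    then show ?thesis using ne by blast
  next
    case False
    have "finite (C t)" using fin by (simp add: C_def)
    then have "Max (length ` C t) \<in> length ` C t" "\<forall>x\<in>C t. length x \<le> Max (length ` C t)"
      using False by auto
    then obtain b where b: "b \<in> C t" "\<And>x. x \<in> C t \<Longrightarrow> length x \<le> length b" by auto
    have "prefix x b" if x: "x \<in> C t" for x
    proof -
      have "rel_int M 0 [k (map (f t) x), k (map (f t) b)] \<or> rel_int M 0 [k (map (f t) b), k (map (f t) x)]"
        using Mtree[of "k (map (f t) x)" "k (map (f t) b)" "h t"] k b x by (auto simp: C_def)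
      then have "prefix (map (f t) x) (map (f t) b) \<or> prefix (map (f t) b) (map (f t) x)" by (simp add: k)
      moreover have "inj_on (f t) (set x \<union> set b)" "inj_on (f t) (set b \<union> set x)"
        by (rule inj_on_subset[OF f[of t]], use x b in \<open>auto simp: C_def\<close>)+
      ultimately have "prefix x b \<or> prefix b x" using prefix_map_injD by blast
      then show ?thesis
        using b(2)[OF x] by (auto simp: prefix_def)
    qed
    then show ?thesis using b by (auto simp: C_def)
  qed
  then obtain b where b: "\<And>t. b t \<in> T t" "\<And>t x. x \<in> C t \<Longrightarrow> prefix x (b t)" by metis
  have "\<forall>\<^sub>F t in F. prefix (a i t) (b t)" if "i \<in> Field \<gamma>" for i
    using gh[OF that] by eventually_elim (use b(2) aT[OF that] in \<open>auto simp: C_def g_def\<close>)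
  then show ?thesis using b(1) by blast
qed

text \<open>Unless the chain is empty or has a largest node, it has a cofinal sequence of regular
  length. An injection into \<open>'i\<close> moves the index order to the type for which treetops
  is stated.\<close>

lemma treetop_chain:
  fixes T :: "'i \<Rightarrow> 'b list set" and a :: "'k \<Rightarrow> 'i \<Rightarrow> 'b list" and K :: "'k set"
  assumes K: "|K| \<le>o |UNIV :: 'i set|"
    and fin: "\<And>t. finite (T t)" and ne: "\<And>t. T t \<noteq> {}"
    and aT: "\<And>i t. i \<in> K \<Longrightarrow> a i t \<in> T t"
    and chain: "\<And>i j. i \<in> K \<Longrightarrow> j \<in> K \<Longrightarrow>
      (\<forall>\<^sub>F t in F. prefix (a i t) (a j t)) \<or> (\<forall>\<^sub>F t in F. prefix (a j t) (a i t))"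
  shows "\<exists>b. (\<forall>t. b t \<in> T t) \<and> (\<forall>i\<in>K. \<forall>\<^sub>F t in F. prefix (a i t) (b t))"
proof -
  define le where "le i j \<longleftrightarrow> (\<forall>\<^sub>F t in F. prefix (a i t) (a j t))" for i j
  have trans: "le i l" if "le i j" "le j l" for i j l
    using that unfolding le_def by eventually_elim (rule prefix_order.trans)
  consider "K = {}" | m where "m \<in> K" "\<forall>i\<in>K. le i m" | "K \<noteq> {}" "\<And>m. m \<in> K \<Longrightarrow> \<exists>i\<in>K. \<not> le i m"
    by blast
  then show ?thesis
  proof cases
    case 1
    have "\<exists>b. \<forall>t. b t \<in> T t" using ne by (intro choice) blast
    then show ?thesis using 1 by blast
  next
    case 2
    then show ?thesis using aT by (auto simp: le_def)
  next
    case 3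
    obtain \<gamma> where \<gamma>: "Field \<gamma> \<subseteq> K" "Card_order \<gamma>" "regularCard \<gamma>" "infinite (Field \<gamma>)"
      "\<And>i j. (i, j) \<in> \<gamma> \<Longrightarrow> le i j" "\<And>k. k \<in> K \<Longrightarrow> \<exists>i\<in>Field \<gamma>. le k i"
      by (rule cofinal_regular_sequence[of K le]) (use chain trans 3 in \<open>(auto simp: le_def; fail) | blast\<close>)+
    obtain f :: "'k \<Rightarrow> 'i" where f: "inj_on f K" using K card_of_ordLeq[of K "UNIV :: 'i set"] by auto
    then have f\<gamma>: "inj_on f (Field \<gamma>)" using \<gamma>(1) by (rule inj_on_subset)
    define \<delta> where "\<delta> = dir_image \<gamma> f"
    have iso: "\<gamma> =o \<delta>" unfolding \<delta>_def
      by (rule dir_image_ordIso) (use \<gamma>(2) f\<gamma> card_order_on_well_order_on in auto)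
    have F\<delta>: "Field \<delta> = f ` Field \<gamma>" by (simp add: \<delta>_def dir_image_Field)
    define g where "g = inv_into (Field \<gamma>) f"
    have g: "g (f i) = i" if "i \<in> Field \<gamma>" for i using f\<gamma> that by (simp add: g_def)
    have "\<exists>b. (\<forall>t. b t \<in> T t) \<and> (\<forall>i\<in>Field \<delta>. \<forall>\<^sub>F t in F. prefix (a (g i) t) (b t))"
    proof (rule treetop_regular[OF _ _ _ fin ne])
      show "Card_order \<delta>" using Card_order_ordIso2[OF \<gamma>(2) iso] .
      show "infinite (Field \<delta>)" unfolding F\<delta> using \<gamma>(4) f\<gamma> finite_imageD by blast
      show "regularCard \<delta>"
        by (rule regularCard_ordIso[OF iso _ \<gamma>(3)]) (use \<gamma> in \<open>simp add: cinfinite_def\<close>)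
      show "a (g i) t \<in> T t" if "i \<in> Field \<delta>" for i t
        using that g aT \<gamma>(1) by (auto simp: F\<delta>)
      show "\<forall>\<^sub>F t in F. prefix (a (g i) t) (a (g j) t)" if ij: "(i, j) \<in> \<delta>" for i j
      proof -
        obtain i' j' where "i = f i'" "j = f j'" "(i', j') \<in> \<gamma>" using ij unfolding \<delta>_def dir_image_def by blast
        then show ?thesis using \<gamma>(5)[of i' j'] g[OF FieldI1] g[OF FieldI2] by (simp add: le_def)
      qed
    qed
    then obtain b where b: "\<And>t. b t \<in> T t" "\<And>i. i \<in> Field \<delta> \<Longrightarrow> \<forall>\<^sub>F t in F. prefix (a (g i) t) (b t)"
      by blast
    have "\<forall>\<^sub>F t in F. prefix (a i t) (b t)" if i: "i \<in> K" for i
    proof -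
      obtain j where j: "j \<in> Field \<gamma>" "le i j" using \<gamma>(6)[OF i] by blast
      have "\<forall>\<^sub>F t in F. prefix (a j t) (b t)" using b(2)[of "f j"] j g by (auto simp: F\<delta>)
      with j(2)[unfolded le_def] show ?thesis by eventually_elim (rule prefix_order.trans)
    qed
    then show ?thesis using b(1) by blast
  qed
qed

end

section \<open>Interpolation and internal extension\<close>

text \<open>The default \<open>0\<close> makes the maximum exist. Evaluated at each \<open>t\<close>
  it gives an element of the ultrapower, which is how a bound of a branch is trimmed by an internal
  condition.\<close>

definition greatest :: "nat \<Rightarrow> (nat \<Rightarrow> bool) \<Rightarrow> nat" where
  "greatest L P = Max ({m. m \<le> L \<and> P m} \<union> {0})"

lemma greatest_mem: "greatest L P \<in> {m. m \<le> L \<and> P m} \<union> {0}"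
  unfolding greatest_def by (rule Max_in) auto

lemma greatest_le: "greatest L P \<le> L"
  using greatest_mem[of L P] by auto

lemma greatest_holds: "P 0 \<Longrightarrow> P (greatest L P)"
  using greatest_mem[of L P] by auto

lemma greatest_ge: "m \<le> L \<Longrightarrow> P m \<Longrightarrow> m \<le> greatest L P"
  unfolding greatest_def by (rule Max_ge) auto

lemma prefix_take_conv: "prefix xs ys \<longleftrightarrow> length xs \<le> length ys \<and> take (length xs) ys = xs"
  by (metis append_take_drop_id prefix_def prefix_length_le append_eq_conv_conj)

context treetops_uf
begin

text \<open>Transfinite recursion in which treetops bridges the limit stages: \<open>d\<close>
  bounds the earlier nodes but tells nothing about \<open>Q\<close>. The new node has to extend the
  earlier nodes, not \<open>d\<close>, which leaves room for trimming \<open>d\<close>. Condition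
  \<open>adm\<close> makes the recursion legitimate, as \<open>Q\<close> may consult the earlier
  nodes only.\<close>

lemma branch:
  fixes T :: "'i \<Rightarrow> 'b list set" and \<gamma> :: "'k rel"
    and Q :: "('k \<Rightarrow> 'i \<Rightarrow> 'b list) \<Rightarrow> 'k \<Rightarrow> ('i \<Rightarrow> 'b list) \<Rightarrow> bool"
  assumes wo: "Well_order \<gamma>" and card: "|Field \<gamma>| \<le>o |UNIV :: 'i set|"
    and fin: "\<And>t. finite (T t)" and ne: "\<And>t. T t \<noteq> {}"
    and adm: "\<And>c c' \<alpha> e. (\<And>\<beta>. (\<beta>, \<alpha>) \<in> \<gamma> - Id \<Longrightarrow> c \<beta> = c' \<beta>) \<Longrightarrow> Q c \<alpha> e = Q c' \<alpha> e"
    and step: "\<And>c \<alpha> d. \<alpha> \<in> Field \<gamma> \<Longrightarrow> (\<And>\<beta>. (\<beta>, \<alpha>) \<in> \<gamma> - Id \<Longrightarrow> Q c \<beta> (c \<beta>)) \<Longrightarrow>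
      (\<And>\<beta> t. (\<beta>, \<alpha>) \<in> \<gamma> - Id \<Longrightarrow> c \<beta> t \<in> T t) \<Longrightarrow>
      (\<And>\<beta> \<delta>. (\<delta>, \<beta>) \<in> \<gamma> - Id \<Longrightarrow> (\<beta>, \<alpha>) \<in> \<gamma> - Id \<Longrightarrow> \<forall>\<^sub>F t in F. prefix (c \<delta> t) (c \<beta> t)) \<Longrightarrow>
      (\<And>t. d t \<in> T t) \<Longrightarrow> (\<And>\<beta>. (\<beta>, \<alpha>) \<in> \<gamma> - Id \<Longrightarrow> \<forall>\<^sub>F t in F. prefix (c \<beta> t) (d t)) \<Longrightarrow>
      \<exists>e. (\<forall>t. e t \<in> T t) \<and> (\<forall>\<beta>. (\<beta>, \<alpha>) \<in> \<gamma> - Id \<longrightarrow> (\<forall>\<^sub>F t in F. prefix (c \<beta> t) (e t))) \<and> Q c \<alpha> e"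
  shows "\<exists>c d. (\<forall>t. d t \<in> T t) \<and> (\<forall>\<alpha>\<in>Field \<gamma>. Q c \<alpha> (c \<alpha>) \<and> (\<forall>t. c \<alpha> t \<in> T t)
    \<and> (\<forall>\<^sub>F t in F. prefix (c \<alpha> t) (d t))
    \<and> (\<forall>\<beta>. (\<beta>, \<alpha>) \<in> \<gamma> - Id \<longrightarrow> (\<forall>\<^sub>F t in F. prefix (c \<beta> t) (c \<alpha> t))))"
proof -
  have wr: "wo_rel \<gamma>" using wo by (simp add: wo_rel_def)
  define R where "R c \<alpha> e \<longleftrightarrow> (\<alpha> \<in> Field \<gamma> \<longrightarrow> (\<forall>t. e t \<in> T t)
    \<and> (\<forall>\<beta>. (\<beta>, \<alpha>) \<in> \<gamma> - Id \<longrightarrow> (\<forall>\<^sub>F t in F. prefix (c \<beta> t) (e t))) \<and> Q c \<alpha> e)"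
    for c \<alpha> and e :: "'i \<Rightarrow> 'b list"
  have fld: "\<beta> \<in> Field \<gamma>" if "(\<beta>, \<alpha>) \<in> \<gamma> - Id" for \<alpha> \<beta> using that by (auto simp: Field_def)
  have cmp: "\<beta> = \<delta> \<or> (\<beta>, \<delta>) \<in> \<gamma> - Id \<or> (\<delta>, \<beta>) \<in> \<gamma> - Id" if "\<beta> \<in> Field \<gamma>" "\<delta> \<in> Field \<gamma>" for \<beta> \<delta>
    using wo_rel.TOTALS[OF wr] that by blast
  have "\<exists>c. \<forall>\<alpha>. R c \<alpha> (c \<alpha>)"
  proof (rule dependent_wf_choice[OF wo_rel.WF[OF wr]])
    fix c c' :: "'k \<Rightarrow> 'i \<Rightarrow> 'b list" and \<alpha> e
    assume eq: "\<And>\<beta>. (\<beta>, \<alpha>) \<in> \<gamma> - Id \<Longrightarrow> c \<beta> = c' \<beta>"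
    have "Q c \<alpha> e = Q c' \<alpha> e" by (rule adm[OF eq])
    moreover have "(\<forall>\<beta>. (\<beta>, \<alpha>) \<in> \<gamma> - Id \<longrightarrow> (\<forall>\<^sub>F t in F. prefix (c \<beta> t) (e t)))
      \<longleftrightarrow> (\<forall>\<beta>. (\<beta>, \<alpha>) \<in> \<gamma> - Id \<longrightarrow> (\<forall>\<^sub>F t in F. prefix (c' \<beta> t) (e t)))"
      using eq by metis
    ultimately show "R c \<alpha> e = R c' \<alpha> e" unfolding R_def by (simp only:)
  next
    fix \<alpha> and c :: "'k \<Rightarrow> 'i \<Rightarrow> 'b list"
    assume IH: "\<And>\<beta>. (\<beta>, \<alpha>) \<in> \<gamma> - Id \<Longrightarrow> R c \<beta> (c \<beta>)"
    have cT: "c \<beta> t \<in> T t" if "(\<beta>, \<alpha>) \<in> \<gamma> - Id" for \<beta> t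
      using IH[OF that] fld[OF that] by (simp add: R_def)
    have cQ: "Q c \<beta> (c \<beta>)" if "(\<beta>, \<alpha>) \<in> \<gamma> - Id" for \<beta>
      using IH[OF that] fld[OF that] by (simp add: R_def)
    have mono: "\<forall>\<^sub>F t in F. prefix (c \<delta> t) (c \<beta> t)"
      if "(\<delta>, \<beta>) \<in> \<gamma> - Id" "(\<beta>, \<alpha>) \<in> \<gamma> - Id" for \<beta> \<delta>
      using IH[OF that(2)] fld[OF that(2)] that(1) by (simp add: R_def)
    have "\<exists>d. (\<forall>t. d t \<in> T t) \<and> (\<forall>\<beta>\<in>{\<beta>. (\<beta>, \<alpha>) \<in> \<gamma> - Id}. \<forall>\<^sub>F t in F. prefix (c \<beta> t) (d t))"
    proof (rule treetop_chain[OF _ fin ne])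
      show "|{\<beta>. (\<beta>, \<alpha>) \<in> \<gamma> - Id}| \<le>o |UNIV :: 'i set|"
        by (rule ordLeq_transitive[OF card_of_mono1 card]) (use fld in blast)
      show "c \<beta> t \<in> T t" if "\<beta> \<in> {\<beta>. (\<beta>, \<alpha>) \<in> \<gamma> - Id}" for \<beta> t using cT that by blast
      show "(\<forall>\<^sub>F t in F. prefix (c \<beta> t) (c \<delta> t)) \<or> (\<forall>\<^sub>F t in F. prefix (c \<delta> t) (c \<beta> t))"
        if "\<beta> \<in> {\<beta>. (\<beta>, \<alpha>) \<in> \<gamma> - Id}" "\<delta> \<in> {\<beta>. (\<beta>, \<alpha>) \<in> \<gamma> - Id}" for \<beta> \<delta>
        using cmp[of \<beta> \<delta>] mono[of \<beta> \<delta>] mono[of \<delta> \<beta>] fld[of \<beta> \<alpha>] fld[of \<delta> \<alpha>] that by auto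
    qed
    then obtain d where d: "\<And>t. d t \<in> T t" "\<And>\<beta>. (\<beta>, \<alpha>) \<in> \<gamma> - Id \<Longrightarrow> \<forall>\<^sub>F t in F. prefix (c \<beta> t) (d t)"
      by blast
    show "\<exists>e. R c \<alpha> e"
    proof (cases "\<alpha> \<in> Field \<gamma>")
      case True
      from step[OF True cQ cT mono d(1) d(2)] show ?thesis unfolding R_def by blast
    next
      case False
      then show ?thesis by (simp add: R_def)
    qed
  qed
  then obtain c where c: "\<And>\<alpha>. R c \<alpha> (c \<alpha>)" by blast
  have mono: "\<forall>\<^sub>F t in F. prefix (c \<beta> t) (c \<alpha> t)" if "(\<beta>, \<alpha>) \<in> \<gamma> - Id" for \<alpha> \<beta>
  proof -
    have "\<alpha> \<in> Field \<gamma>" using that by (auto simp: Field_def)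
    then show ?thesis using c[of \<alpha>] that by (simp add: R_def)
  qed
  have "\<exists>d. (\<forall>t. d t \<in> T t) \<and> (\<forall>\<beta>\<in>Field \<gamma>. \<forall>\<^sub>F t in F. prefix (c \<beta> t) (d t))"
  proof (rule treetop_chain[OF card fin ne])
    show "c \<beta> t \<in> T t" if "\<beta> \<in> Field \<gamma>" for \<beta> t using c[of \<beta>] that by (simp add: R_def)
    show "(\<forall>\<^sub>F t in F. prefix (c \<beta> t) (c \<delta> t)) \<or> (\<forall>\<^sub>F t in F. prefix (c \<delta> t) (c \<beta> t))"
      if "\<beta> \<in> Field \<gamma>" "\<delta> \<in> Field \<gamma>" for \<beta> \<delta>
      using cmp[OF that] mono[of \<beta> \<delta>] mono[of \<delta> \<beta>] by auto
  qed
  then obtain d where d: "\<And>t. d t \<in> T t" "\<And>\<beta>. \<beta> \<in> Field \<gamma> \<Longrightarrow> \<forall>\<^sub>F t in F. prefix (c \<beta> t) (d t)"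
    by blast
  have "Q c \<alpha> (c \<alpha>) \<and> (\<forall>t. c \<alpha> t \<in> T t)" if "\<alpha> \<in> Field \<gamma>" for \<alpha> using c[of \<alpha>] that by (simp add: R_def)
  then show ?thesis using d mono by blast
qed

text \<open>This is the part of saturation that concerns the order of the ultrapower of the natural
  numbers, stated with representatives in place of classes. The condition
  \<open>B \<noteq> {}\<close> avoids asking for a bound of \<open>A\<close> where none is
  given.\<close>

definition fills :: "'v rel \<Rightarrow> bool" where
  "fills \<nu> \<longleftrightarrow> (\<forall>A B :: ('i \<Rightarrow> nat) set. |A| <o \<nu> \<and> |B| <o \<nu> \<and> B \<noteq> {}
      \<and> (\<forall>a\<in>A. \<forall>b\<in>B. \<forall>\<^sub>F t in F. a t \<le> b t)
    \<longrightarrow> (\<exists>c. (\<forall>a\<in>A. \<forall>\<^sub>F t in F. a t \<le> c t) \<and> (\<forall>b\<in>B. \<forall>\<^sub>F t in F. c t \<le> b t)))"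

text \<open>The bound \<open>L\<close> stands in for the upper side when \<open>Y\<close> is empty.
  Truncating by it gives \<open>m t \<le> L t\<close> at every \<open>t\<close>, so that
  \<open>m\<close> can be used as a length of an initial segment.\<close>

lemma fills_indexed:
  fixes f :: "'x \<Rightarrow> 'i \<Rightarrow> nat" and g :: "'y \<Rightarrow> 'i \<Rightarrow> nat"
  assumes "fills \<nu>" "|X| <o \<nu>" "|Y| <o \<nu>"
    and fg: "\<And>x y. x \<in> X \<Longrightarrow> y \<in> Y \<Longrightarrow> \<forall>\<^sub>F t in F. f x t \<le> g y t"
    and fL: "\<And>x. x \<in> X \<Longrightarrow> \<forall>\<^sub>F t in F. f x t \<le> L t"
  shows "\<exists>m. (\<forall>t. m t \<le> L t) \<and> (\<forall>x\<in>X. \<forall>\<^sub>F t in F. f x t \<le> m t) \<and> (\<forall>y\<in>Y. \<forall>\<^sub>F t in F. m t \<le> g y t)"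
proof (cases "Y = {}")
  case True
  then show ?thesis using fL by blast
next
  case False
  have "|f ` X| <o \<nu>" "|g ` Y| <o \<nu>"
    using ordLeq_ordLess_trans[OF card_of_image] assms by blast+
  then obtain c where c: "\<forall>a\<in>f ` X. \<forall>\<^sub>F t in F. a t \<le> c t" "\<forall>b\<in>g ` Y. \<forall>\<^sub>F t in F. c t \<le> b t"
    using assms(1)[unfolded fills_def, rule_format, of "f ` X" "g ` Y"] fg False by auto
  have "\<forall>\<^sub>F t in F. f x t \<le> min (c t) (L t)" if x: "x \<in> X" for x
  proof -
    have "\<forall>\<^sub>F t in F. f x t \<le> c t" using c x by blast
    with fL[OF x] show ?thesis by eventually_elim simp
  qed
  moreover have "\<forall>\<^sub>F t in F. min (c t) (L t) \<le> g y t" if y: "y \<in> Y" for y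
  proof -
    have "\<forall>\<^sub>F t in F. c t \<le> g y t" using c y by blast
    then show ?thesis by eventually_elim simp
  qed
  ultimately show ?thesis by (intro exI[of _ "\<lambda>t. min (c t) (L t)"]) simp
qed

text \<open>The branch grows a list of members; at limit stages the upper bound is cut off, using \<open>fills\<close>,
  before the point where its initial segments stop being compatible with some finite set of the
  \<open>s k\<close>.\<close>

lemma internal_extension:
  fixes K :: "'k set" and P :: "'i \<Rightarrow> 'b set set" and s :: "'k \<Rightarrow> 'i \<Rightarrow> 'b"
  assumes \<nu>: "fills \<nu>" "Card_order \<nu>" "infinite (Field \<nu>)" and K\<nu>: "|K| <o \<nu>"
    and KI: "|K| \<le>o |UNIV :: 'i set|"
    and fin: "\<And>t. finite (\<Union>(P t))" and empty: "\<And>t. {} \<in> P t"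
    and down: "\<And>t A B. A \<in> P t \<Longrightarrow> B \<subseteq> A \<Longrightarrow> B \<in> P t"
    and fip: "\<And>u. u \<subseteq> K \<Longrightarrow> finite u \<Longrightarrow> \<forall>\<^sub>F t in F. (\<lambda>k. s k t) ` u \<in> P t"
  shows "\<exists>A. (\<forall>t. A t \<in> P t) \<and> (\<forall>k\<in>K. \<forall>\<^sub>F t in F. s k t \<in> A t)"
proof -
  define \<gamma> where "\<gamma> = |K|"
  \<comment> \<open>Lists without repetition over the finite set \<open>\<Union>(P t)\<close> form a
    finite tree; the order in a list makes initial segments available for trimming.\<close>
  define T where "T t = {xs. distinct xs \<and> set xs \<in> P t}" for t
  \<comment> \<open>Membership of \<open>s \<alpha>\<close> alone would not allow further elements
    to be added; compatibility with every finite set of the \<open>s k\<close> is carried along for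
    that purpose.\<close>
  define Q where "Q c \<alpha> e \<longleftrightarrow> (\<forall>\<^sub>F t in F. s \<alpha> t \<in> set (e t)) \<and>
      (\<forall>u. u \<subseteq> K \<and> finite u \<longrightarrow> (\<forall>\<^sub>F t in F. set (e t) \<union> (\<lambda>k. s k t) ` u \<in> P t))"
    for c :: "'k \<Rightarrow> 'i \<Rightarrow> 'b list" and \<alpha> e
  have F\<gamma>: "Field \<gamma> = K" by (simp add: \<gamma>_def Field_card_of)
  have "\<exists>c d. (\<forall>t. d t \<in> T t) \<and> (\<forall>\<alpha>\<in>Field \<gamma>. Q c \<alpha> (c \<alpha>) \<and> (\<forall>t. c \<alpha> t \<in> T t)
    \<and> (\<forall>\<^sub>F t in F. prefix (c \<alpha> t) (d t))
    \<and> (\<forall>\<beta>. (\<beta>, \<alpha>) \<in> \<gamma> - Id \<longrightarrow> (\<forall>\<^sub>F t in F. prefix (c \<beta> t) (c \<alpha> t))))"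
  proof (rule branch)
    show "Well_order \<gamma>" by (simp add: \<gamma>_def card_of_well_order_on Field_card_of)
    show "|Field \<gamma>| \<le>o |UNIV :: 'i set|" using KI F\<gamma> by simp
    show "finite (T t)" for t
      by (rule finite_subset[OF _ finite_subset_distinct[OF fin[of t]]]) (auto simp: T_def)
    show "T t \<noteq> {}" for t using empty by (auto simp: T_def intro!: exI[of _ "[]"])
    show "Q c \<alpha> e = Q c' \<alpha> e" for c c' \<alpha> e by (simp add: Q_def)
  next
    fix c \<alpha> d
    assume \<alpha>: "\<alpha> \<in> Field \<gamma>"
      and cQ: "\<And>\<beta>. (\<beta>, \<alpha>) \<in> \<gamma> - Id \<Longrightarrow> Q c \<beta> (c \<beta>)"
      and d: "\<And>t. d t \<in> T t" "\<And>\<beta>. (\<beta>, \<alpha>) \<in> \<gamma> - Id \<Longrightarrow> \<forall>\<^sub>F t in F. prefix (c \<beta> t) (d t)"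
    define X where "X = {\<beta>. (\<beta>, \<alpha>) \<in> \<gamma> - Id}"
    define g where "g u t = greatest (length (d t)) (\<lambda>m. set (take m (d t)) \<union> (\<lambda>k. s k t) ` u \<in> P t)" for u t
    have "\<exists>m. (\<forall>t. m t \<le> length (d t)) \<and> (\<forall>\<beta>\<in>X. \<forall>\<^sub>F t in F. length (c \<beta> t) \<le> m t)
      \<and> (\<forall>u\<in>{u. u \<subseteq> K \<and> finite u}. \<forall>\<^sub>F t in F. m t \<le> g u t)"
    proof (rule fills_indexed[OF \<nu>(1)])
      have "X \<subseteq> K" using F\<gamma> by (auto simp: X_def Field_def)
      then show "|X| <o \<nu>" using card_of_mono1 ordLeq_ordLess_trans K\<nu> by blast
      show "|{u. u \<subseteq> K \<and> finite u}| <o \<nu>" by (rule card_of_Fpow_ordLess[OF \<nu>(2,3) K\<nu>])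
      fix \<beta> assume \<beta>: "\<beta> \<in> X"
      from d(2)[of \<beta>] \<beta> have pre: "\<forall>\<^sub>F t in F. prefix (c \<beta> t) (d t)" by (simp add: X_def)
      then show "\<forall>\<^sub>F t in F. length (c \<beta> t) \<le> length (d t)" by eventually_elim (rule prefix_length_le)
      fix u assume "u \<in> {u. u \<subseteq> K \<and> finite u}"
      then have "\<forall>\<^sub>F t in F. set (c \<beta> t) \<union> (\<lambda>k. s k t) ` u \<in> P t"
        using cQ[of \<beta>] \<beta> by (simp add: Q_def X_def)
      with pre show "\<forall>\<^sub>F t in F. length (c \<beta> t) \<le> g u t"
        unfolding g_def by eventually_elim (auto simp: prefix_take_conv intro!: greatest_ge)
    qed
    then obtain m where m: "\<And>t. m t \<le> length (d t)" "\<And>\<beta>. \<beta> \<in> X \<Longrightarrow> \<forall>\<^sub>F t in F. length (c \<beta> t) \<le> m t"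
      "\<And>u. u \<subseteq> K \<Longrightarrow> finite u \<Longrightarrow> \<forall>\<^sub>F t in F. m t \<le> g u t" by blast
    define e0 where "e0 t = take (m t) (d t)" for t
    have e0P: "\<forall>\<^sub>F t in F. set (e0 t) \<union> (\<lambda>k. s k t) ` u \<in> P t" if u: "u \<subseteq> K" "finite u" for u
      using m(3)[OF u] fip[OF u]
    proof eventually_elim
      case (elim t)
      then have "set (take (g u t) (d t)) \<union> (\<lambda>k. s k t) ` u \<in> P t"
        unfolding g_def
        using greatest_holds[of "\<lambda>m. set (take m (d t)) \<union> (\<lambda>k. s k t) ` u \<in> P t" "length (d t)"] by simp
      moreover have "set (e0 t) \<subseteq> set (take (g u t) (d t))"
        unfolding e0_def using elim(1) by (rule set_take_subset_set_take)
      ultimately show ?case by (intro down[of _ t "set (e0 t) \<union> (\<lambda>k. s k t) ` u"]) auto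
    qed
    have e0T: "e0 t \<in> T t" for t
      using d(1)[of t] down[of "set (d t)" t "set (e0 t)"] by (auto simp: T_def e0_def dest: in_set_takeD)
    \<comment> \<open>The guards keep \<open>e t\<close> in \<open>T t\<close> at every
      \<open>t\<close>. Almost everywhere the enlarged set is in \<open>P t\<close>, so
      \<open>s \<alpha> t\<close> does occur in \<open>e t\<close>.\<close>
    define e where "e t = (if s \<alpha> t \<in> set (e0 t) \<or> insert (s \<alpha> t) (set (e0 t)) \<notin> P t then e0 t
      else e0 t @ [s \<alpha> t])" for t
    have "e t \<in> T t" for t using e0T[of t] by (auto simp: e_def T_def)
    moreover have "\<forall>\<^sub>F t in F. prefix (c \<beta> t) (e t)" if \<beta>: "(\<beta>, \<alpha>) \<in> \<gamma> - Id" for \<beta>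
      using d(2)[OF \<beta>] m(2)[of \<beta>, unfolded X_def, OF CollectI, OF \<beta>]
    proof eventually_elim
      case (elim t)
      then have "prefix (c \<beta> t) (e0 t)" by (auto simp: prefix_take_conv e0_def min_absorb2 min_absorb1)
      then show ?case by (auto simp: e_def)
    qed
    moreover have "Q c \<alpha> e"
    proof -
      have \<alpha>K: "\<alpha> \<in> K" using \<alpha> F\<gamma> by simp
      have "\<forall>\<^sub>F t in F. set (e0 t) \<union> (\<lambda>k. s k t) ` {\<alpha>} \<in> P t" by (rule e0P) (use \<alpha>K in auto)
      then have set_e: "\<forall>\<^sub>F t in F. set (e t) = insert (s \<alpha> t) (set (e0 t))"
        by eventually_elim (auto simp: e_def)
      have "\<forall>\<^sub>F t in F. set (e t) \<union> (\<lambda>k. s k t) ` u \<in> P t" if u: "u \<subseteq> K" "finite u" for u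
      proof -
        have "\<forall>\<^sub>F t in F. set (e0 t) \<union> (\<lambda>k. s k t) ` insert \<alpha> u \<in> P t" by (rule e0P) (use u \<alpha>K in auto)
        with set_e show ?thesis by eventually_elim simp
      qed
      moreover from set_e have "\<forall>\<^sub>F t in F. s \<alpha> t \<in> set (e t)" by eventually_elim simp
      ultimately show ?thesis by (simp add: Q_def)
    qed
    ultimately show "\<exists>e. (\<forall>t. e t \<in> T t) \<and> (\<forall>\<beta>. (\<beta>, \<alpha>) \<in> \<gamma> - Id \<longrightarrow> (\<forall>\<^sub>F t in F. prefix (c \<beta> t) (e t))) \<and> Q c \<alpha> e"
      by blast
  qed
  then obtain c d where d: "\<And>t. d t \<in> T t" and c: "\<And>\<alpha>. \<alpha> \<in> K \<Longrightarrow> Q c \<alpha> (c \<alpha>) \<and> (\<forall>\<^sub>F t in F. prefix (c \<alpha> t) (d t))"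
    unfolding F\<gamma> by blast
  have "\<forall>\<^sub>F t in F. s k t \<in> set (d t)" if "k \<in> K" for k
  proof -
    have "\<forall>\<^sub>F t in F. s k t \<in> set (c k t)" "\<forall>\<^sub>F t in F. prefix (c k t) (d t)"
      using c[OF that] by (auto simp: Q_def)
    then show ?thesis by eventually_elim (use set_mono_prefix in blast)
  qed
  then show ?thesis using d by (intro exI[of _ "\<lambda>t. set (d t)"]) (simp add: T_def)
qed

end

section \<open>Cuts\<close>

lemma sorted_wrt_last:
  assumes "sorted_wrt R xs" "p \<in> set xs" "\<And>x. R x x"
  shows "R p (last xs)"
  using assms by (induction xs rule: rev_induct) (auto simp: sorted_wrt_append)

text \<open>The order induced on \<open>W\<close> cannot be longer than \<open>\<kappa>\<close>,
  since it would then have a proper initial segment of type \<open>\<kappa>\<close>, which is too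
  large.\<close>

lemma card_of_small_segments:
  assumes wo: "Well_order \<theta>" and W: "W \<subseteq> Field \<theta>" and \<kappa>: "Card_order \<kappa>"
    and small: "\<And>\<beta>. \<beta> \<in> W \<Longrightarrow> |W \<inter> underS \<theta> \<beta>| <o \<kappa>"
  shows "|W| \<le>o \<kappa>"
proof -
  define r where "r = Restr \<theta> W"
  have wor: "Well_order r" unfolding r_def by (rule Well_order_Restr[OF wo])
  have wo\<kappa>: "Well_order \<kappa>" using \<kappa> by (rule card_order_on_well_order_on)
  have Fr: "Field r = W"
    unfolding r_def using Refl_Field_Restr2[of \<theta> W] wo W
    by (simp add: well_order_on_def linear_order_on_def partial_order_on_def preorder_on_def)
  have "r \<le>o \<kappa>"
  proof (rule ccontr)
    assume "\<not> r \<le>o \<kappa>"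
    then have "\<kappa> <o r" using not_ordLeq_iff_ordLess[OF wo\<kappa> wor] by blast
    then obtain b where b: "b \<in> Field r" "\<kappa> =o Restr r (underS r b)"
      using ordLess_iff_ordIso_Restr[OF wor wo\<kappa>] by blast
    have FR: "Field (Restr r (underS r b)) = underS r b"
      by (rule Field_Restr_ofilter[OF wor])
        (use wor in \<open>simp add: wo_rel_def wo_rel.underS_ofilter\<close>)
    have "|Field \<kappa>| =o |underS r b|" using card_of_cong[OF b(2)] unfolding FR .
    with card_of_Field_ordIso[OF \<kappa>] have "\<kappa> =o |underS r b|"
      using ordIso_symmetric ordIso_transitive by blast
    also have "|underS r b| \<le>o |W \<inter> underS \<theta> b|"
      by (rule card_of_mono1) (auto simp: r_def underS_def)
    also have "|W \<inter> underS \<theta> b| <o \<kappa>" using small b Fr by blast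
    finally show False using ordLess_irreflexive by blast
  qed
  moreover have "|W| \<le>o r" using card_of_least[of W r] wor Fr by simp
  ultimately show ?thesis using ordLeq_transitive by blast
qed

text \<open>The set is an initial segment that plays the role of \<open>\<kappa>\<^sup>+\<close>
  inside \<open>\<theta>\<close>. If it had at most \<open>\<kappa>\<close> elements, the first
  element beyond it would have at most \<open>\<kappa>\<close> predecessors and so belong to
  it.\<close>

lemma many_small_segments:
  assumes \<theta>: "Card_order \<theta>" and \<kappa>: "\<kappa> <o \<theta>"
  shows "\<not> |{\<beta>\<in>Field \<theta>. |underS \<theta> \<beta>| \<le>o \<kappa>}| \<le>o \<kappa>"
proof
  define Y where "Y = {\<beta>\<in>Field \<theta>. |underS \<theta> \<beta>| \<le>o \<kappa>}"
  assume "|{\<beta>\<in>Field \<theta>. |underS \<theta> \<beta>| \<le>o \<kappa>}| \<le>o \<kappa>"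
  then have Y: "|Y| \<le>o \<kappa>" by (simp add: Y_def)
  have wr: "wo_rel \<theta>" using \<theta> card_order_on_well_order_on by (auto simp: wo_rel_def)
  have "Y \<noteq> Field \<theta>"
  proof
    assume "Y = Field \<theta>"
    then have "|Field \<theta>| <o \<theta>" using Y \<kappa> ordLeq_ordLess_trans by auto
    then show False using card_of_Field_ordIso[OF \<theta>] not_ordLess_ordIso by blast
  qed
  then have B: "Field \<theta> - Y \<subseteq> Field \<theta>" "Field \<theta> - Y \<noteq> {}" by (auto simp: Y_def)
  define \<beta> where "\<beta> = wo_rel.minim \<theta> (Field \<theta> - Y)"
  have \<beta>: "\<beta> \<in> Field \<theta> - Y" unfolding \<beta>_def by (rule wo_rel.minim_in[OF wr B])
  have "underS \<theta> \<beta> \<subseteq> Y"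
  proof
    fix \<alpha> assume \<alpha>: "\<alpha> \<in> underS \<theta> \<beta>"
    show "\<alpha> \<in> Y"
    proof (rule ccontr)
      assume "\<alpha> \<notin> Y"
      then have "\<alpha> \<in> Field \<theta> - Y" using \<alpha> by (auto simp: underS_def Field_def)
      then have "(\<beta>, \<alpha>) \<in> \<theta>" unfolding \<beta>_def by (rule wo_rel.minim_least[OF wr B(1)])
      then show False using \<alpha> antisymD[OF wo_rel.ANTISYM[OF wr], of \<alpha> \<beta>] by (auto simp: underS_def)
    qed
  qed
  then have "|underS \<theta> \<beta>| \<le>o \<kappa>" using card_of_mono1 ordLeq_transitive Y by blast
  then show False using \<beta> by (auto simp: Y_def)
qed

section \<open>Cuts with equal cofinalities\<close>

context treetops_uf
begin

text \<open>At stage \<open>\<alpha>\<close> the bound is trimmed as long as its intervals contain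
  \<open>[a \<alpha>, b \<alpha>]\<close>. This is one internal condition, so no smaller cut has to
  be filled. In the final bound the last interval lies inside all the others, and its left end fills
  the cut.\<close>

lemma symmetric_cut:
  fixes \<gamma> :: "'k rel" and a b :: "'k \<Rightarrow> 'i \<Rightarrow> nat"
  assumes wo: "Well_order \<gamma>" and ne: "Field \<gamma> \<noteq> {}" and card: "|Field \<gamma>| \<le>o |UNIV :: 'i set|"
    and a: "\<And>i j. (i, j) \<in> \<gamma> \<Longrightarrow> \<forall>\<^sub>F t in F. a i t \<le> a j t"
    and b: "\<And>i j. (i, j) \<in> \<gamma> \<Longrightarrow> \<forall>\<^sub>F t in F. b j t \<le> b i t"
    and ab: "\<And>i. i \<in> Field \<gamma> \<Longrightarrow> \<forall>\<^sub>F t in F. a i t \<le> b i t"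
  shows "\<exists>c. \<forall>i\<in>Field \<gamma>. (\<forall>\<^sub>F t in F. a i t \<le> c t) \<and> (\<forall>\<^sub>F t in F. c t \<le> b i t)"
proof -
  have wr: "wo_rel \<gamma>" using wo by (simp add: wo_rel_def)
  \<comment> \<open>The largest upper end \<open>b i0\<close> bounds the endpoints of all intervals
    and so makes the trees finite.\<close>
  define i0 where "i0 = wo_rel.minim \<gamma> (Field \<gamma>)"
  have i0: "(i0, i) \<in> \<gamma>" if "i \<in> Field \<gamma>" for i
    unfolding i0_def by (rule wo_rel.minim_least[OF wr order_refl that])
  define R where "R = (\<lambda>p q :: nat \<times> nat. fst p \<le> fst q \<and> snd q \<le> snd p)"
  define T where "T t = {xs. distinct xs \<and> sorted_wrt R xs \<and> set xs \<subseteq> {p. fst p \<le> snd p \<and> snd p \<le> b i0 t}}" for t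
  define Q where "Q c \<alpha> e \<longleftrightarrow> (\<forall>\<^sub>F t in F. (a \<alpha> t, b \<alpha> t) \<in> set (e t)
      \<and> (\<forall>p\<in>set (e t). fst p \<le> a \<alpha> t \<and> b \<alpha> t \<le> snd p))"
    for c :: "'k \<Rightarrow> 'i \<Rightarrow> (nat \<times> nat) list" and \<alpha> e
  have "\<exists>c d. (\<forall>t. d t \<in> T t) \<and> (\<forall>\<alpha>\<in>Field \<gamma>. Q c \<alpha> (c \<alpha>) \<and> (\<forall>t. c \<alpha> t \<in> T t)
    \<and> (\<forall>\<^sub>F t in F. prefix (c \<alpha> t) (d t))
    \<and> (\<forall>\<beta>. (\<beta>, \<alpha>) \<in> \<gamma> - Id \<longrightarrow> (\<forall>\<^sub>F t in F. prefix (c \<beta> t) (c \<alpha> t))))"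
  proof (rule branch[OF wo card])
    show "finite (T t)" for t
    proof -
      have fp: "finite {p :: nat \<times> nat. fst p \<le> snd p \<and> snd p \<le> b i0 t}"
        by (rule finite_subset[of _ "{..b i0 t} \<times> {..b i0 t}"]) auto
      show ?thesis by (rule finite_subset[OF _ finite_subset_distinct[OF fp]]) (auto simp: T_def)
    qed
    show "T t \<noteq> {}" for t by (auto simp: T_def intro!: exI[of _ "[]"])
    show "Q c \<alpha> e = Q c' \<alpha> e" for c c' \<alpha> e by (simp add: Q_def)
  next
    fix c \<alpha> d
    assume \<alpha>: "\<alpha> \<in> Field \<gamma>"
      and cQ: "\<And>\<beta>. (\<beta>, \<alpha>) \<in> \<gamma> - Id \<Longrightarrow> Q c \<beta> (c \<beta>)"
      and d: "\<And>t. d t \<in> T t" "\<And>\<beta>. (\<beta>, \<alpha>) \<in> \<gamma> - Id \<Longrightarrow> \<forall>\<^sub>F t in F. prefix (c \<beta> t) (d t)"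
    define G where "G t m \<longleftrightarrow> (\<forall>p\<in>set (take m (d t)). fst p \<le> a \<alpha> t \<and> b \<alpha> t \<le> snd p)" for t m
    define m where "m t = greatest (length (d t)) (G t)" for t
    define e0 where "e0 t = take (m t) (d t)" for t
    have Gm: "G t (m t)" for t unfolding m_def by (rule greatest_holds) (simp add: G_def)
    have e0T: "e0 t \<in> T t" for t
      using d(1)[of t] by (auto simp: T_def e0_def sorted_wrt_take dest!: in_set_takeD)
    define e where "e t = (if (a \<alpha> t, b \<alpha> t) \<in> set (e0 t) \<or> \<not> (a \<alpha> t \<le> b \<alpha> t \<and> b \<alpha> t \<le> b i0 t) then e0 t
      else e0 t @ [(a \<alpha> t, b \<alpha> t)])" for t
    have "e t \<in> T t" for t
      using e0T[of t] Gm[of t] by (auto simp: e_def T_def sorted_wrt_append R_def G_def e0_def)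
    moreover have "\<forall>\<^sub>F t in F. prefix (c \<beta> t) (e t)" if \<beta>: "(\<beta>, \<alpha>) \<in> \<gamma> - Id" for \<beta>
    proof -
      have ba: "(\<beta>, \<alpha>) \<in> \<gamma>" using \<beta> by simp
      from d(2)[OF \<beta>] cQ[OF \<beta>, unfolded Q_def] a[OF ba] b[OF ba] show ?thesis
      proof eventually_elim
        case (elim t)
        then have "G t (length (c \<beta> t))" by (force simp: G_def prefix_take_conv)
        then have "length (c \<beta> t) \<le> m t"
          unfolding m_def using elim(1) by (intro greatest_ge) (auto simp: prefix_take_conv)
        then have "prefix (c \<beta> t) (e0 t)" using elim(1) by (auto simp: prefix_take_conv e0_def min_absorb1)
        then show ?case by (auto simp: e_def)
      qed
    qed
    moreover have "Q c \<alpha> e" unfolding Q_def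
      using ab[OF \<alpha>] b[OF i0[OF \<alpha>]]
    proof eventually_elim
      case (elim t)
      then show ?case using Gm[of t] by (auto simp: e_def G_def e0_def)
    qed
    ultimately show "\<exists>e. (\<forall>t. e t \<in> T t) \<and> (\<forall>\<beta>. (\<beta>, \<alpha>) \<in> \<gamma> - Id \<longrightarrow> (\<forall>\<^sub>F t in F. prefix (c \<beta> t) (e t))) \<and> Q c \<alpha> e"
      by blast
  qed
  then obtain c d where d: "\<And>t. d t \<in> T t"
    and c: "\<And>\<alpha>. \<alpha> \<in> Field \<gamma> \<Longrightarrow> Q c \<alpha> (c \<alpha>) \<and> (\<forall>\<^sub>F t in F. prefix (c \<alpha> t) (d t))"
    by blast
  have "(\<forall>\<^sub>F t in F. a i t \<le> fst (last (d t))) \<and> (\<forall>\<^sub>F t in F. fst (last (d t)) \<le> b i t)"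
    if i: "i \<in> Field \<gamma>" for i
    unfolding eventually_conj_iff[symmetric]
    using conjunct1[OF c[OF i], unfolded Q_def] conjunct2[OF c[OF i]]
  proof eventually_elim
    case (elim t)
    then have mem: "(a i t, b i t) \<in> set (d t)" using set_mono_prefix by blast
    then have "R (a i t, b i t) (last (d t))"
      using sorted_wrt_last[of R "d t"] d[of t] by (auto simp: T_def R_def)
    moreover have "last (d t) \<in> set (d t)" using mem by (cases "d t") auto
    ultimately show ?case using d[of t] by (auto simp: T_def R_def)
  qed
  then show ?thesis by (intro exI[of _ "\<lambda>t. fst (last (d t))"]) blast
qed

end

section \<open>Cuts with unequal cofinalities\<close>

text \<open>An entry \<open>(e, H)\<close> at position \<open>n\<close> of a history assigns by \<open>H\<close> distances at most \<open>e\<close> from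
  \<open>n\<close> to the earlier positions that are still active, that is, in the domain of \<open>H\<close>; any two of
  these must already be at distance at most \<open>e\<close> from each other.\<close>

definition admissible :: "(nat \<times> (nat \<times> nat) set) list \<Rightarrow> nat \<Rightarrow> nat \<Rightarrow> (nat \<times> nat) set \<Rightarrow> bool" where
  "admissible c n e H \<longleftrightarrow> H \<subseteq> {..<n} \<times> {..e} \<and> single_valued H
    \<and> (\<forall>x v x' v'. (x, v) \<in> H \<and> (x', v') \<in> H \<and> x < x' \<longrightarrow> (\<exists>w\<le>e. (x, w) \<in> snd (c ! x')))"

text \<open>Strictly falling levels starting at most at \<open>N\<close> make the tree finite. They
  also let the level of an entry measure how far a history has descended towards the cut.\<close>

definition history_tree :: "nat \<Rightarrow> (nat \<times> (nat \<times> nat) set) list set" where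
  "history_tree N = {c. sorted_wrt (\<lambda>p q. fst q < fst p) c \<and> (\<forall>p\<in>set c. fst p \<le> N)
    \<and> (\<forall>n<length c. admissible c n (fst (c ! n)) (snd (c ! n)))}"

lemma prefix_nth_last:
  assumes "prefix xs ys" "xs \<noteq> []"
  shows "length xs - 1 < length ys \<and> ys ! (length xs - 1) = last xs"
proof -
  obtain us u where "xs = us @ [u]" using assms(2) by (cases xs rule: rev_cases) auto
  then show ?thesis using assms(1) by (auto simp: prefix_def nth_append)
qed

lemma admissible_cong:
  assumes "\<And>x. x < n \<Longrightarrow> c ! x = c' ! x"
  shows "admissible c n e H \<longleftrightarrow> admissible c' n e H"
  unfolding admissible_def using assms by (smt (verit) SigmaD1 lessThan_iff subsetD)

lemma admissible_subset: "admissible c n e H \<Longrightarrow> H' \<subseteq> H \<Longrightarrow> admissible c n e H'"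
  unfolding admissible_def by (meson subset_iff single_valued_subset)

lemma finite_history_tree: "finite (history_tree N)"
proof (rule finite_subset)
  show "history_tree N \<subseteq> {c. set c \<subseteq> {..N} \<times> Pow ({..N} \<times> {..N}) \<and> length c \<le> Suc N}"
  proof (rule subsetI, rule CollectI, rule conjI)
    fix c assume c: "c \<in> history_tree N"
    have "sorted_wrt (\<lambda>p q. q < p) (map fst c)"
      using c by (auto simp: history_tree_def sorted_wrt_map)
    moreover have "distinct xs" if "sorted_wrt (\<lambda>p q. q < p) xs" for xs :: "nat list"
      using that by (induction xs) auto
    ultimately have "distinct (map fst c)" by blast
    then have "length c = card (fst ` set c)" by (metis distinct_card length_map set_map)
    also have "\<dots> \<le> card {..N}" by (rule card_mono) (use c in \<open>auto simp: history_tree_def\<close>)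
    finally show len: "length c \<le> Suc N" by simp
    show "set c \<subseteq> {..N} \<times> Pow ({..N} \<times> {..N})"
    proof
      fix p assume p: "p \<in> set c"
      then obtain n where n: "n < length c" "p = c ! n" by (auto simp: in_set_conv_nth)
      have "fst p \<le> N" using c p by (auto simp: history_tree_def)
      moreover have "snd p \<subseteq> {..<n} \<times> {..fst p}"
        using c n by (auto simp: history_tree_def admissible_def)
      moreover have "n \<le> N" using n len by simp
      ultimately have "snd p \<subseteq> {..N} \<times> {..N}" by force
      then show "p \<in> {..N} \<times> Pow ({..N} \<times> {..N})" using \<open>fst p \<le> N\<close> by (cases p) auto
    qed
  qed
qed (intro finite_lists_length_le finite_SigmaI; simp)

lemma history_tree_take:
  assumes "c \<in> history_tree N"
  shows "take m c \<in> history_tree N"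
proof -
  have "admissible (take m c) n (fst (take m c ! n)) (snd (take m c ! n))" if n: "n < length (take m c)" for n
  proof -
    have "admissible c n (fst (c ! n)) (snd (c ! n))" using assms n by (simp add: history_tree_def)
    also have "admissible c n (fst (c ! n)) (snd (c ! n)) \<longleftrightarrow> admissible (take m c) n (fst (c ! n)) (snd (c ! n))"
      by (rule admissible_cong) (use n in simp)
    finally show ?thesis using n by simp
  qed
  then show ?thesis using assms by (auto simp: history_tree_def sorted_wrt_take dest: in_set_takeD)
qed

lemma history_tree_snoc:
  assumes "c \<in> history_tree N" "\<And>p. p \<in> set c \<Longrightarrow> e < fst p" "e \<le> N" "admissible c (length c) e H"
  shows "c @ [(e, H)] \<in> history_tree N"
proof -
  have "admissible (c @ [(e, H)]) n (fst ((c @ [(e, H)]) ! n)) (snd ((c @ [(e, H)]) ! n))"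
    if n: "n < length (c @ [(e, H)])" for n
  proof -
    have *: "admissible (c @ [(e, H)]) n e' H' \<longleftrightarrow> admissible c n e' H'" for e' H'
      by (rule admissible_cong) (use n in \<open>simp add: nth_append\<close>)
    show ?thesis
    proof (cases "n < length c")
      case True
      then show ?thesis unfolding * using assms(1) by (simp add: nth_append history_tree_def)
    next
      case False
      then have "n = length c" using n by simp
      then show ?thesis unfolding * using assms(4) by simp
    qed
  qed
  then show ?thesis using assms(1-3) by (auto simp: history_tree_def sorted_wrt_append)
qed

lemma history_tree_last:
  assumes "c \<in> history_tree N" "p \<in> set c"
  shows "fst (last c) \<le> fst p"
proof -
  have "sorted_wrt (\<lambda>p q. fst q \<le> fst p) c"
    using assms(1) by (auto simp: history_tree_def intro: sorted_wrt_mono_rel[of c "\<lambda>p q. fst q < fst p"])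
  then show ?thesis by (rule sorted_wrt_last[OF _ assms(2)]) simp
qed

lemma history_tree_antimono:
  assumes "c \<in> history_tree N" "m \<le> n" "n < length c"
  shows "fst (c ! n) \<le> fst (c ! m)"
  using assms sorted_wrt_nth_less[of "\<lambda>p q. fst q < fst p" c m n]
  by (cases "m = n") (auto simp: history_tree_def)

context treetops_uf
begin

text \<open>The entry at stage \<open>\<alpha>\<close> is placed at level \<open>b \<alpha>\<close>, at distance \<open>a (g \<alpha> \<beta>)\<close> from the
  position of stage \<open>\<beta>\<close>, where \<open>g \<alpha>\<close> is injective whenever \<open>\<alpha>\<close> has at most \<open>\<kappa>\<close> predecessors.
  In an upper bound each position stays active down to a level below all \<open>b\<close>, hence below some
  \<open>a i\<close> if the cut is not filled. More than \<open>\<kappa>\<close> positions share the same \<open>i\<close>, and their mutual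
  distances are all below \<open>a i\<close>, which contradicts injectivity.\<close>

lemma asymmetric_cut:
  fixes \<kappa> :: "'k rel" and \<theta> :: "'l rel" and a :: "'k \<Rightarrow> 'i \<Rightarrow> nat" and b :: "'l \<Rightarrow> 'i \<Rightarrow> nat"
  assumes \<kappa>: "Card_order \<kappa>" "infinite (Field \<kappa>)" and \<theta>: "Card_order \<theta>" and \<kappa>\<theta>: "\<kappa> <o \<theta>"
    and card: "|Field \<theta>| \<le>o |UNIV :: 'i set|" and fills: "fills \<theta>"
    and a: "\<And>i j. (i, j) \<in> \<kappa> \<Longrightarrow> \<forall>\<^sub>F t in F. a i t \<le> a j t"
    and b: "\<And>i j. (i, j) \<in> \<theta> - Id \<Longrightarrow> \<forall>\<^sub>F t in F. b j t < b i t"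
    and ab: "\<And>i j. i \<in> Field \<kappa> \<Longrightarrow> j \<in> Field \<theta> \<Longrightarrow> \<forall>\<^sub>F t in F. a i t \<le> b j t"
  shows "\<exists>c. (\<forall>i\<in>Field \<kappa>. \<forall>\<^sub>F t in F. a i t \<le> c t) \<and> (\<forall>j\<in>Field \<theta>. \<forall>\<^sub>F t in F. c t \<le> b j t)"
proof (rule ccontr)
  assume cut: "\<nexists>c. (\<forall>i\<in>Field \<kappa>. \<forall>\<^sub>F t in F. a i t \<le> c t) \<and> (\<forall>j\<in>Field \<theta>. \<forall>\<^sub>F t in F. c t \<le> b j t)"
  have wo: "Well_order \<theta>" using \<theta> by (rule card_order_on_well_order_on)
  have wr: "wo_rel \<theta>" using wo by (simp add: wo_rel_def)
  have wr\<kappa>: "wo_rel \<kappa>" using \<kappa>(1) card_order_on_well_order_on by (auto simp: wo_rel_def)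
  have inf\<theta>: "infinite (Field \<theta>)"
  proof
    assume "finite (Field \<theta>)"
    moreover have "|Field \<kappa>| \<le>o |Field \<theta>|" by (rule card_of_mono2[OF ordLess_imp_ordLeq[OF \<kappa>\<theta>]])
    ultimately show False using \<kappa>(2) card_of_ordLeq_finite by blast
  qed
  have fld: "\<beta> \<in> Field \<theta>" if "(\<beta>, \<alpha>) \<in> \<theta> - Id" for \<alpha> \<beta> using that by (auto simp: Field_def)
  have cmp: "\<beta> = \<delta> \<or> (\<beta>, \<delta>) \<in> \<theta> - Id \<or> (\<delta>, \<beta>) \<in> \<theta> - Id" if "\<beta> \<in> Field \<theta>" "\<delta> \<in> Field \<theta>" for \<beta> \<delta>
    using wo_rel.TOTALS[OF wr] that by blast
  obtain i1 where i1: "i1 \<in> Field \<kappa>" using \<kappa>(2) by fastforce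
  define Y where "Y = {\<beta>\<in>Field \<theta>. |underS \<theta> \<beta>| \<le>o \<kappa>}"
  \<comment> \<open>Beyond \<open>Y\<close> there may be no injection into
    \<open>Field \<kappa>\<close>; a constant map keeps the construction defined there, and the
    final count is over \<open>Y\<close> alone.\<close>
  have "\<exists>g. (\<forall>\<alpha>. g \<alpha> \<in> Field \<kappa>) \<and> (\<beta> \<in> Y \<longrightarrow> inj_on g (underS \<theta> \<beta>))" for \<beta>
  proof (cases "\<beta> \<in> Y")
    case True
    then have "|underS \<theta> \<beta>| \<le>o \<kappa>" by (simp add: Y_def)
    then have "|underS \<theta> \<beta>| \<le>o |Field \<kappa>|"
      by (rule ordLeq_ordIso_trans[OF _ ordIso_symmetric[OF card_of_Field_ordIso[OF \<kappa>(1)]]])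
    then obtain g where g: "inj_on g (underS \<theta> \<beta>)" "g ` underS \<theta> \<beta> \<subseteq> Field \<kappa>"
      using card_of_ordLeq[of "underS \<theta> \<beta>" "Field \<kappa>"] by blast
    define g' where "g' \<alpha> = (if \<alpha> \<in> underS \<theta> \<beta> then g \<alpha> else i1)" for \<alpha>
    have "inj_on g' (underS \<theta> \<beta>)" using g(1) by (auto simp: g'_def inj_on_def)
    moreover have "g' \<alpha> \<in> Field \<kappa>" for \<alpha> using g(2) i1 by (auto simp: g'_def)
    ultimately show ?thesis by blast
  next
    case False
    then show ?thesis using i1 by (intro exI[of _ "\<lambda>_. i1"]) simp
  qed
  then obtain g where g: "\<And>\<beta> \<alpha>. g \<beta> \<alpha> \<in> Field \<kappa>" "\<And>\<beta>. \<beta> \<in> Y \<Longrightarrow> inj_on (g \<beta>) (underS \<theta> \<beta>)" by metis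
  define j0 where "j0 = wo_rel.minim \<theta> (Field \<theta>)"
  have bN: "\<forall>\<^sub>F t in F. b j t \<le> b j0 t" if j: "j \<in> Field \<theta>" for j
  proof -
    have "(j0, j) \<in> \<theta>" unfolding j0_def by (rule wo_rel.minim_least[OF wr order_refl j])
    then show ?thesis using b[of j0 j] by (cases "j = j0") (auto elim: eventually_mono)
  qed
  define T where "T t = history_tree (b j0 t)" for t
  \<comment> \<open>The entry contributed by stage \<open>\<beta>\<close> is the last one of
    \<open>c \<beta> t\<close>, and it keeps this position in every extension.\<close>
  define pos where "pos c \<beta> t = length (c \<beta> t) - 1" for c :: "'l \<Rightarrow> 'i \<Rightarrow> (nat \<times> (nat \<times> nat) set) list" and \<beta> t
  \<comment> \<open>The clause on \<open>n\<close> concerns all entries, also those of the bounds at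
    which no stage ends. Only so does activity extend over an initial stretch of the bound, whose
    length \<open>active\<close> then measures.\<close>
  define Q where "Q c \<alpha> e \<longleftrightarrow> (\<forall>\<^sub>F t in F. e t \<noteq> [] \<and> fst (last (e t)) = b \<alpha> t) \<and>
      (\<forall>\<beta>. (\<beta>, \<alpha>) \<in> \<theta> - Id \<longrightarrow> (\<forall>\<^sub>F t in F. (pos c \<beta> t, a (g \<alpha> \<beta>) t) \<in> snd (last (e t))
        \<and> (\<forall>n. pos c \<beta> t < n \<and> n < length (e t) \<longrightarrow> pos c \<beta> t \<in> Domain (snd (e t ! n)))))"
    for c \<alpha> e
  define active where "active c d \<beta> t = greatest (length (d t))
      (\<lambda>m. \<forall>n. pos c \<beta> t < n \<and> n < m \<longrightarrow> pos c \<beta> t \<in> Domain (snd (d t ! n)))"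
    for c \<beta> and d :: "'i \<Rightarrow> (nat \<times> (nat \<times> nat) set) list" and t
  have activeD: "pos c \<beta> t \<in> Domain (snd (d t ! n))" if "pos c \<beta> t < n" "n < active c d \<beta> t" for c \<beta> d t n
    using greatest_holds[of "\<lambda>m. \<forall>n. pos c \<beta> t < n \<and> n < m \<longrightarrow> pos c \<beta> t \<in> Domain (snd (d t ! n))" "length (d t)"] that
    by (auto simp: active_def)
  have QD1: "\<forall>\<^sub>F t in F. c \<beta> t \<noteq> [] \<and> fst (last (c \<beta> t)) = b \<beta> t" if "Q c \<beta> (c \<beta>)" for c \<beta>
    using that by (simp add: Q_def)
  have QD: "\<forall>\<^sub>F t in F. (pos c \<beta> t, a (g \<delta> \<beta>) t) \<in> snd (last (c \<delta> t))
      \<and> (\<forall>n. pos c \<beta> t < n \<and> n < length (c \<delta> t) \<longrightarrow> pos c \<beta> t \<in> Domain (snd (c \<delta> t ! n)))"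
    if "Q c \<delta> (c \<delta>)" "(\<beta>, \<delta>) \<in> \<theta> - Id" for c \<beta> \<delta>
    using that unfolding Q_def by blast
  have QD2: "\<forall>\<^sub>F t in F. (pos c \<beta> t, a (g \<delta> \<beta>) t) \<in> snd (last (c \<delta> t))"
    if "Q c \<delta> (c \<delta>)" "(\<beta>, \<delta>) \<in> \<theta> - Id" for c \<beta> \<delta>
    using QD[OF that] by eventually_elim blast
  have QD3: "\<forall>\<^sub>F t in F. \<forall>n. pos c \<beta> t < n \<and> n < length (c \<delta> t) \<longrightarrow> pos c \<beta> t \<in> Domain (snd (c \<delta> t ! n))"
    if "Q c \<delta> (c \<delta>)" "(\<beta>, \<delta>) \<in> \<theta> - Id" for c \<beta> \<delta>
    using QD[OF that] by eventually_elim blast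
  have pos_less: "\<forall>\<^sub>F t in F. pos c \<beta> t < pos c \<delta> t"
    if "Q c \<delta> (c \<delta>)" "(\<beta>, \<delta>) \<in> \<theta> - Id" "\<And>t. c \<delta> t \<in> T t" for c \<beta> \<delta>
    using QD1[OF that(1)] QD2[OF that(1,2)]
  proof eventually_elim
    case (elim t)
    then have "pos c \<delta> t < length (c \<delta> t)" "last (c \<delta> t) = c \<delta> t ! pos c \<delta> t"
      by (auto simp: pos_def last_conv_nth)
    then have "admissible (c \<delta> t) (pos c \<delta> t) (fst (last (c \<delta> t))) (snd (last (c \<delta> t)))"
      using that(3)[of t] by (simp add: T_def history_tree_def)
    then show ?case using elim(2) by (auto simp: admissible_def)
  qed
  have len_active: "\<forall>\<^sub>F t in F. length (c \<delta> t) \<le> active c d \<beta> t"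
    if Qs: "Q c \<delta> (c \<delta>)" "Q c \<beta> (c \<beta>)" and pre: "\<forall>\<^sub>F t in F. prefix (c \<delta> t) (d t)"
      and rel: "(\<beta>, \<delta>) \<in> \<theta> - Id \<or> (\<forall>\<^sub>F t in F. prefix (c \<delta> t) (c \<beta> t))" for c d \<beta> \<delta>
  proof -
    have "\<forall>\<^sub>F t in F. \<forall>n. pos c \<beta> t < n \<and> n < length (c \<delta> t) \<longrightarrow> pos c \<beta> t \<in> Domain (snd (c \<delta> t ! n))"
      using rel
    proof
      assume "(\<beta>, \<delta>) \<in> \<theta> - Id"
      then show ?thesis by (rule QD3[OF Qs(1)])
    next
      assume "\<forall>\<^sub>F t in F. prefix (c \<delta> t) (c \<beta> t)"
      \<comment> \<open>Here \<open>\<beta>\<close> is not earlier than \<open>\<delta>\<close>: its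
        position is at or beyond the last entry of \<open>c \<delta>\<close>, and the claim is
        vacuous.\<close>
      with QD1[OF Qs(2)] show ?thesis
        by eventually_elim (auto simp: pos_def dest!: prefix_length_le)
    qed
    with pre show ?thesis
    proof eventually_elim
      case (elim t)
      then have "d t ! n = c \<delta> t ! n" if "n < length (c \<delta> t)" for n
        using that by (auto simp: prefix_def nth_append)
      then show ?case
        unfolding active_def using elim by (intro greatest_ge) (auto simp: prefix_length_le)
    qed
  qed
  have "\<exists>c d. (\<forall>t. d t \<in> T t) \<and> (\<forall>\<alpha>\<in>Field \<theta>. Q c \<alpha> (c \<alpha>) \<and> (\<forall>t. c \<alpha> t \<in> T t)
    \<and> (\<forall>\<^sub>F t in F. prefix (c \<alpha> t) (d t))
    \<and> (\<forall>\<beta>. (\<beta>, \<alpha>) \<in> \<theta> - Id \<longrightarrow> (\<forall>\<^sub>F t in F. prefix (c \<beta> t) (c \<alpha> t))))"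
  proof (rule branch[OF wo card])
    show "finite (T t)" for t unfolding T_def by (rule finite_history_tree)
    show "T t \<noteq> {}" for t by (auto simp: T_def history_tree_def intro!: exI[of _ "[]"])
    show "Q c \<alpha> e = Q c' \<alpha> e" if eq: "\<And>\<beta>. (\<beta>, \<alpha>) \<in> \<theta> - Id \<Longrightarrow> c \<beta> = c' \<beta>" for c c' \<alpha> e
    proof -
      have pos_eq: "pos c \<beta> = pos c' \<beta>" if "(\<beta>, \<alpha>) \<in> \<theta> - Id" for \<beta>
        using eq[OF that] by (simp add: pos_def fun_eq_iff)
      show ?thesis unfolding Q_def
        by (intro arg_cong2[where f = "(\<and>)"] refl all_cong1 imp_cong) (simp only: pos_eq)
    qed
  next
    fix c \<alpha> d
    assume \<alpha>: "\<alpha> \<in> Field \<theta>"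
      and cQ: "\<And>\<beta>. (\<beta>, \<alpha>) \<in> \<theta> - Id \<Longrightarrow> Q c \<beta> (c \<beta>)"
      and cT: "\<And>\<beta> t. (\<beta>, \<alpha>) \<in> \<theta> - Id \<Longrightarrow> c \<beta> t \<in> T t"
      and cc: "\<And>\<beta> \<delta>. (\<delta>, \<beta>) \<in> \<theta> - Id \<Longrightarrow> (\<beta>, \<alpha>) \<in> \<theta> - Id \<Longrightarrow> \<forall>\<^sub>F t in F. prefix (c \<delta> t) (c \<beta> t)"
      and d: "\<And>t. d t \<in> T t" "\<And>\<beta>. (\<beta>, \<alpha>) \<in> \<theta> - Id \<Longrightarrow> \<forall>\<^sub>F t in F. prefix (c \<beta> t) (d t)"
    define X where "X = {\<beta>. (\<beta>, \<alpha>) \<in> \<theta> - Id}"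
    have XF: "X \<subseteq> Field \<theta>" using fld by (auto simp: X_def)
    have "X = underS \<theta> \<alpha>" by (auto simp: X_def underS_def)
    then have X\<theta>: "|X| <o \<theta>" using card_of_underS[OF \<theta> \<alpha>] by simp
    have XI: "|X| \<le>o |UNIV :: 'i set|" by (rule ordLeq_transitive[OF card_of_mono1[OF XF] card])
    define G where "G t m \<longleftrightarrow> (\<forall>p\<in>set (take m (d t)). b \<alpha> t < fst p)" for t m
    \<comment> \<open>The length \<open>m\<close> must exceed the lengths of the earlier nodes, stay
      within the active stretch of each earlier position, and stop before the levels come down to
      \<open>b \<alpha>\<close>; the last condition is internal and serves as \<open>L\<close>. Both
      families have fewer than \<open>\<theta>\<close> members, so \<open>fills\<close>
      applies.\<close>
    have "\<exists>m. (\<forall>t. m t \<le> greatest (length (d t)) (G t)) \<and> (\<forall>\<beta>\<in>X. \<forall>\<^sub>F t in F. length (c \<beta> t) \<le> m t)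
      \<and> (\<forall>\<beta>\<in>X. \<forall>\<^sub>F t in F. m t \<le> active c d \<beta> t)"
    proof (rule fills_indexed[OF fills X\<theta> X\<theta>])
      fix \<delta> assume \<delta>: "\<delta> \<in> X"
      then have \<delta>\<alpha>: "(\<delta>, \<alpha>) \<in> \<theta> - Id" by (simp add: X_def)
      show "\<forall>\<^sub>F t in F. length (c \<delta> t) \<le> greatest (length (d t)) (G t)"
        using d(2)[OF \<delta>\<alpha>] QD1[OF cQ[OF \<delta>\<alpha>]] b[OF \<delta>\<alpha>]
      proof eventually_elim
        case (elim t)
        have "b \<alpha> t < fst p" if "p \<in> set (c \<delta> t)" for p
          using history_tree_last[OF _ that] cT[OF \<delta>\<alpha>, of t] elim by (fastforce simp: T_def)
        then have "G t (length (c \<delta> t))" using elim(1) by (auto simp: G_def prefix_take_conv)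
        then show ?case using elim(1) by (intro greatest_ge) (auto simp: prefix_take_conv)
      qed
      fix \<beta> assume \<beta>: "\<beta> \<in> X"
      then have \<beta>\<alpha>: "(\<beta>, \<alpha>) \<in> \<theta> - Id" by (simp add: X_def)
      show "\<forall>\<^sub>F t in F. length (c \<delta> t) \<le> active c d \<beta> t"
      proof (rule len_active[OF cQ[OF \<delta>\<alpha>] cQ[OF \<beta>\<alpha>] d(2)[OF \<delta>\<alpha>]])
        show "(\<beta>, \<delta>) \<in> \<theta> - Id \<or> (\<forall>\<^sub>F t in F. prefix (c \<delta> t) (c \<beta> t))"
          using cmp[of \<beta> \<delta>] cc[of \<delta> \<beta>] \<beta>\<alpha> fld[OF \<beta>\<alpha>] fld[OF \<delta>\<alpha>] by auto
      qed
    qed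
    then obtain m where m: "\<And>t. m t \<le> greatest (length (d t)) (G t)"
      "\<And>\<beta>. \<beta> \<in> X \<Longrightarrow> \<forall>\<^sub>F t in F. length (c \<beta> t) \<le> m t" "\<And>\<beta>. \<beta> \<in> X \<Longrightarrow> \<forall>\<^sub>F t in F. m t \<le> active c d \<beta> t"
      by blast
    have md: "m t \<le> length (d t)" for t using m(1)[of t] greatest_le[of "length (d t)" "G t"] by simp
    define e0 where "e0 t = take (m t) (d t)" for t
    have len_e0: "length (e0 t) = m t" for t using md[of t] by (simp add: e0_def)
    have e0T: "e0 t \<in> T t" for t using d(1)[of t] by (simp add: T_def e0_def history_tree_take)
    have e0b: "b \<alpha> t < fst p" if "p \<in> set (e0 t)" for t p
    proof -
      have "G t (greatest (length (d t)) (G t))" by (rule greatest_holds) (simp add: G_def)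
      moreover have "set (e0 t) \<subseteq> set (take (greatest (length (d t)) (G t)) (d t))"
        unfolding e0_def by (rule set_take_subset_set_take[OF m(1)])
      ultimately show ?thesis using that by (auto simp: G_def)
    qed
    have pre: "\<forall>\<^sub>F t in F. prefix (c \<beta> t) (e0 t)" if \<beta>: "(\<beta>, \<alpha>) \<in> \<theta> - Id" for \<beta>
    proof -
      have "\<beta> \<in> X" using \<beta> by (simp add: X_def)
      from d(2)[OF \<beta>] m(2)[OF this] show ?thesis
        by eventually_elim (auto simp: prefix_take_conv e0_def min_absorb1)
    qed
    have nth_pos: "\<forall>\<^sub>F t in F. pos c \<beta> t < length (e0 t) \<and> e0 t ! pos c \<beta> t = last (c \<beta> t)"
      if \<beta>: "(\<beta>, \<alpha>) \<in> \<theta> - Id" for \<beta>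
      using pre[OF \<beta>] QD1[OF cQ[OF \<beta>]]
      by eventually_elim (use prefix_nth_last in \<open>auto simp: pos_def\<close>)
    define P where "P t = {H. admissible (e0 t) (length (e0 t)) (b \<alpha> t) H}" for t
    define s where "s \<beta> t = (pos c \<beta> t, a (g \<alpha> \<beta>) t)" for \<beta> t
    \<comment> \<open>\<open>H\<close> has to be internal and yet contain a prescribed pair for
      every earlier stage. Finitely many of these pairs are admissible, because the distance already
      recorded between two earlier positions is some \<open>a (g \<delta> \<beta>)\<close>, which is
      below \<open>b \<alpha>\<close> by the cut.\<close>
    have "\<exists>H. (\<forall>t. H t \<in> P t) \<and> (\<forall>\<beta>\<in>X. \<forall>\<^sub>F t in F. s \<beta> t \<in> H t)"
    proof (rule internal_extension[OF fills \<theta> inf\<theta> X\<theta> XI])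
      show "finite (\<Union>(P t))" for t
        by (rule finite_subset[of _ "{..<length (e0 t)} \<times> {..b \<alpha> t}"]) (auto simp: P_def admissible_def)
      show "{} \<in> P t" for t by (simp add: P_def admissible_def)
      show "B \<in> P t" if "A \<in> P t" "B \<subseteq> A" for t A B using that admissible_subset by (auto simp: P_def)
    next
      fix u assume u: "u \<subseteq> X" "finite u"
      have 1: "\<forall>\<^sub>F t in F. \<forall>\<beta>\<in>u. pos c \<beta> t < length (e0 t) \<and> a (g \<alpha> \<beta>) t \<le> b \<alpha> t"
      proof (rule eventually_ball_finite[OF u(2)], rule ballI)
        fix \<beta> assume "\<beta> \<in> u"
        then have \<beta>: "(\<beta>, \<alpha>) \<in> \<theta> - Id" using u by (auto simp: X_def)
        from nth_pos[OF this] ab[OF g(1) \<alpha>, of \<alpha> \<beta>]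
        show "\<forall>\<^sub>F t in F. pos c \<beta> t < length (e0 t) \<and> a (g \<alpha> \<beta>) t \<le> b \<alpha> t" by eventually_elim simp
      qed
      have 2: "\<forall>\<^sub>F t in F. \<forall>(\<beta>, \<delta>)\<in>u \<times> u. (\<beta>, \<delta>) \<in> \<theta> - Id \<longrightarrow>
          pos c \<beta> t < pos c \<delta> t \<and> (\<exists>w\<le>b \<alpha> t. (pos c \<beta> t, w) \<in> snd (e0 t ! pos c \<delta> t))"
      proof (rule eventually_ball_finite, use u in simp, rule ballI, clarify)
        fix \<beta> \<delta> assume "\<beta> \<in> u" "\<delta> \<in> u"
        then have \<beta>: "(\<beta>, \<alpha>) \<in> \<theta> - Id" and \<delta>: "(\<delta>, \<alpha>) \<in> \<theta> - Id" using u by (auto simp: X_def)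
        show "\<forall>\<^sub>F t in F. (\<beta>, \<delta>) \<in> \<theta> - Id \<longrightarrow>
          pos c \<beta> t < pos c \<delta> t \<and> (\<exists>w\<le>b \<alpha> t. (pos c \<beta> t, w) \<in> snd (e0 t ! pos c \<delta> t))"
        proof (cases "(\<beta>, \<delta>) \<in> \<theta> - Id")
          case True
          from pos_less[OF cQ[OF \<delta>] True cT[OF \<delta>]] QD2[OF cQ[OF \<delta>] True] nth_pos[OF \<delta>]
            ab[OF g(1) \<alpha>, of \<delta> \<beta>]
          show ?thesis by eventually_elim auto
        qed (auto intro: always_eventually)
      qed
      from 1 2 show "\<forall>\<^sub>F t in F. (\<lambda>\<beta>. s \<beta> t) ` u \<in> P t"
      proof eventually_elim
        case (elim t)
        have lt: "pos c \<beta> t < pos c \<delta> t" "\<exists>w\<le>b \<alpha> t. (pos c \<beta> t, w) \<in> snd (e0 t ! pos c \<delta> t)"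
          if "\<beta> \<in> u" "\<delta> \<in> u" "(\<beta>, \<delta>) \<in> \<theta> - Id" for \<beta> \<delta>
          using elim(2) that by auto
        have tri: "\<beta> = \<delta> \<or> (\<beta>, \<delta>) \<in> \<theta> - Id \<or> (\<delta>, \<beta>) \<in> \<theta> - Id" if "\<beta> \<in> u" "\<delta> \<in> u" for \<beta> \<delta>
          using cmp that u XF by blast
        have inj: "\<beta> = \<delta>" if "\<beta> \<in> u" "\<delta> \<in> u" "pos c \<beta> t = pos c \<delta> t" for \<beta> \<delta>
          using tri[OF that(1,2)] lt(1)[of \<beta> \<delta>] lt(1)[of \<delta> \<beta>] that by auto
        have "single_valued ((\<lambda>\<beta>. s \<beta> t) ` u)"
          by (rule single_valuedI) (auto simp: s_def dest: inj)
        moreover have "(\<lambda>\<beta>. s \<beta> t) ` u \<subseteq> {..<length (e0 t)} \<times> {..b \<alpha> t}"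
          using elim(1) by (auto simp: s_def)
        moreover have "\<exists>w\<le>b \<alpha> t. (x, w) \<in> snd (e0 t ! x')"
          if xx: "(x, v) \<in> (\<lambda>\<beta>. s \<beta> t) ` u" "(x', v') \<in> (\<lambda>\<beta>. s \<beta> t) ` u" "x < x'" for x v x' v'
        proof -
          obtain \<beta> \<delta> where *: "\<beta> \<in> u" "\<delta> \<in> u" "x = pos c \<beta> t" "x' = pos c \<delta> t"
            using xx by (auto simp: s_def)
          then have "(\<beta>, \<delta>) \<in> \<theta> - Id" using tri[of \<beta> \<delta>] lt(1)[of \<delta> \<beta>] xx(3) by auto
          then show ?thesis using lt(2)[of \<beta> \<delta>] * by simp
        qed
        ultimately show ?case unfolding P_def admissible_def by blast
      qed
    qed
    then obtain H where H: "\<And>t. admissible (e0 t) (length (e0 t)) (b \<alpha> t) (H t)"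
      "\<And>\<beta>. \<beta> \<in> X \<Longrightarrow> \<forall>\<^sub>F t in F. s \<beta> t \<in> H t"
      unfolding P_def by blast
    \<comment> \<open>On the null set where \<open>b \<alpha>\<close> exceeds the bound
      \<open>b j0\<close> of the tree, nothing is appended.\<close>
    define e where "e t = (if b \<alpha> t \<le> b j0 t then e0 t @ [(b \<alpha> t, H t)] else e0 t)" for t
    have "e t \<in> T t" for t
      using e0T[of t] history_tree_snoc[of "e0 t" "b j0 t" "b \<alpha> t" "H t"] e0b[of _ t] H(1)[of t]
      by (auto simp: e_def T_def)
    moreover have ev_e: "\<forall>\<^sub>F t in F. e t = e0 t @ [(b \<alpha> t, H t)]"
      using bN[OF \<alpha>] by eventually_elim (simp add: e_def)
    moreover have "\<forall>\<^sub>F t in F. prefix (c \<beta> t) (e t)" if \<beta>: "(\<beta>, \<alpha>) \<in> \<theta> - Id" for \<beta>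
      using pre[OF \<beta>] by eventually_elim (auto simp: e_def)
    moreover have "Q c \<alpha> e"
      unfolding Q_def
    proof (intro conjI allI impI)
      show "\<forall>\<^sub>F t in F. e t \<noteq> [] \<and> fst (last (e t)) = b \<alpha> t" using ev_e by eventually_elim simp
      fix \<beta> assume \<beta>: "(\<beta>, \<alpha>) \<in> \<theta> - Id"
      then have \<beta>X: "\<beta> \<in> X" by (simp add: X_def)
      from ev_e H(2)[OF \<beta>X] m(3)[OF \<beta>X]
      show "\<forall>\<^sub>F t in F. (pos c \<beta> t, a (g \<alpha> \<beta>) t) \<in> snd (last (e t))
        \<and> (\<forall>n. pos c \<beta> t < n \<and> n < length (e t) \<longrightarrow> pos c \<beta> t \<in> Domain (snd (e t ! n)))"
      proof eventually_elim
        case (elim t)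
        have mem: "(pos c \<beta> t, a (g \<alpha> \<beta>) t) \<in> H t" using elim(2) by (simp add: s_def)
        have "pos c \<beta> t \<in> Domain (snd (e t ! n))" if n: "pos c \<beta> t < n" "n < length (e t)" for n
        proof (cases "n < m t")
          case True
          then have "e t ! n = d t ! n" using elim(1) len_e0[of t] md[of t] by (simp add: nth_append e0_def)
          then show ?thesis using activeD[of c \<beta> t n d] n(1) True elim(3) by simp
        next
          case False
          then have "n = m t" using n elim(1) len_e0[of t] by simp
          then have "e t ! n = (b \<alpha> t, H t)" using elim(1) len_e0[of t] by (simp add: nth_append)
          then show ?thesis using mem by auto
        qed
        then show ?case using elim(1) mem by simp
      qed
    qed
    ultimately show "\<exists>e. (\<forall>t. e t \<in> T t) \<and> (\<forall>\<beta>. (\<beta>, \<alpha>) \<in> \<theta> - Id \<longrightarrow> (\<forall>\<^sub>F t in F. prefix (c \<beta> t) (e t))) \<and> Q c \<alpha> e"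
      by blast
  qed
  then obtain c d where dT: "\<And>t. d t \<in> T t"
    and cQ: "\<And>\<alpha>. \<alpha> \<in> Field \<theta> \<Longrightarrow> Q c \<alpha> (c \<alpha>)" and cT: "\<And>\<alpha> t. \<alpha> \<in> Field \<theta> \<Longrightarrow> c \<alpha> t \<in> T t"
    and cd: "\<And>\<alpha>. \<alpha> \<in> Field \<theta> \<Longrightarrow> \<forall>\<^sub>F t in F. prefix (c \<alpha> t) (d t)"
    and cc: "\<And>\<alpha> \<beta>. \<alpha> \<in> Field \<theta> \<Longrightarrow> (\<beta>, \<alpha>) \<in> \<theta> - Id \<Longrightarrow> \<forall>\<^sub>F t in F. prefix (c \<beta> t) (c \<alpha> t)"
    by blast
  have act: "\<forall>\<^sub>F t in F. length (c \<delta> t) \<le> active c d \<alpha> t" if "\<alpha> \<in> Field \<theta>" "\<delta> \<in> Field \<theta>" for \<alpha> \<delta>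
  proof (rule len_active[OF cQ[OF that(2)] cQ[OF that(1)] cd[OF that(2)]])
    show "(\<alpha>, \<delta>) \<in> \<theta> - Id \<or> (\<forall>\<^sub>F t in F. prefix (c \<delta> t) (c \<alpha> t))"
      using cmp[OF that] cc[OF that(1), of \<delta>] by auto
  qed
  have nth_pos: "\<forall>\<^sub>F t in F. pos c \<delta> t < length (d t) \<and> d t ! pos c \<delta> t = last (c \<delta> t)"
    if \<delta>: "\<delta> \<in> Field \<theta>" for \<delta>
    using cd[OF \<delta>] QD1[OF cQ[OF \<delta>]]
    by eventually_elim (use prefix_nth_last in \<open>auto simp: pos_def\<close>)
  \<comment> \<open>The level of the last entry in the active stretch of \<open>\<alpha>\<close>.
    Every stage ends within that stretch, so \<open>x \<alpha>\<close> is below all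
    \<open>b \<delta>\<close>; as it does not fill the cut, it is below some
    \<open>a i\<close>.\<close>
  define x where "x \<alpha> t = fst (d t ! (active c d \<alpha> t - 1))" for \<alpha> t
  have xb: "\<forall>\<^sub>F t in F. x \<alpha> t \<le> b \<delta> t" if "\<alpha> \<in> Field \<theta>" "\<delta> \<in> Field \<theta>" for \<alpha> \<delta>
    using act[OF that] nth_pos[OF that(2)] QD1[OF cQ[OF that(2)]]
  proof eventually_elim
    case (elim t)
    have "active c d \<alpha> t \<le> length (d t)" unfolding active_def by (rule greatest_le)
    moreover have "length (c \<delta> t) = Suc (pos c \<delta> t)" using elim(3) by (simp add: pos_def)
    ultimately have "pos c \<delta> t \<le> active c d \<alpha> t - 1" "active c d \<alpha> t - 1 < length (d t)"
      using elim(1) by auto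
    from history_tree_antimono[OF dT[of t, unfolded T_def] this]
    show ?case using elim(2,3) by (simp add: x_def)
  qed
  have "\<exists>i\<in>Field \<kappa>. \<forall>\<^sub>F t in F. x \<alpha> t < a i t" if \<alpha>: "\<alpha> \<in> Field \<theta>" for \<alpha>
  proof -
    obtain i where "i \<in> Field \<kappa>" "\<not> (\<forall>\<^sub>F t in F. a i t \<le> x \<alpha> t)" using cut xb[OF \<alpha>] by blast
    then show ?thesis using ev_not[of "\<lambda>t. a i t \<le> x \<alpha> t"] by (auto simp: not_le)
  qed
  then obtain \<epsilon> where \<epsilon>: "\<And>\<alpha>. \<alpha> \<in> Field \<theta> \<Longrightarrow> \<epsilon> \<alpha> \<in> Field \<kappa>"
    "\<And>\<alpha>. \<alpha> \<in> Field \<theta> \<Longrightarrow> \<forall>\<^sub>F t in F. x \<alpha> t < a (\<epsilon> \<alpha>) t" by metis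
  define W where "W i = {\<alpha>\<in>Y. \<epsilon> \<alpha> = i}" for i
  have YF: "Y \<subseteq> Field \<theta>" by (auto simp: Y_def)
  have key: "g \<beta> \<alpha> \<in> underS \<kappa> i" if W: "\<alpha> \<in> W i" "\<beta> \<in> W i" and ab': "(\<alpha>, \<beta>) \<in> \<theta> - Id" for \<alpha> \<beta> i
  proof -
    have \<alpha>: "\<alpha> \<in> Field \<theta>" and \<beta>: "\<beta> \<in> Field \<theta>" using W YF by (auto simp: W_def)
    \<comment> \<open>A stage after \<open>\<beta>\<close> provides an entry beyond the position of
      \<open>\<beta>\<close> at which both positions are active.\<close>
    obtain \<delta> where \<delta>: "\<delta> \<in> Field \<theta>" "(\<beta>, \<delta>) \<in> \<theta> - Id"
      using infinite_Card_order_limit[OF \<theta> inf\<theta> \<beta>] by auto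
    have "\<forall>\<^sub>F t in F. x \<alpha> t < a i t" "\<forall>\<^sub>F t in F. x \<beta> t < a i t"
      using \<epsilon>(2)[OF \<alpha>] \<epsilon>(2)[OF \<beta>] W by (auto simp: W_def)
    with pos_less[OF cQ[OF \<beta>] ab' cT[OF \<beta>]] pos_less[OF cQ[OF \<delta>(1)] \<delta>(2) cT[OF \<delta>(1)]]
      act[OF \<alpha> \<delta>(1)] act[OF \<beta> \<delta>(1)] QD1[OF cQ[OF \<delta>(1)]] QD2[OF cQ[OF \<beta>] ab'] nth_pos[OF \<beta>]
    have "\<forall>\<^sub>F t in F. a (g \<beta> \<alpha>) t < a i t"
    proof eventually_elim
      case (elim t)
      \<comment> \<open>The last entry at which both positions are active. Its level is
        \<open>x \<alpha>\<close> or \<open>x \<beta>\<close>, hence below \<open>a i\<close>, and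
        admissibility at \<open>l\<close> bounds by this level the distance
        \<open>a (g \<beta> \<alpha>)\<close> recorded when \<open>\<beta>\<close> was
        placed.\<close>
      define l where "l = min (active c d \<alpha> t) (active c d \<beta> t) - 1"
      have "length (c \<delta> t) = Suc (pos c \<delta> t)" using elim(5) by (simp add: pos_def)
      then have l: "pos c \<beta> t < l" "l < active c d \<alpha> t" "l < active c d \<beta> t"
        using elim(2,3,4) by (auto simp: l_def)
      have "pos c \<alpha> t \<in> Domain (snd (d t ! l))" "pos c \<beta> t \<in> Domain (snd (d t ! l))"
        using activeD[of c \<alpha> t l d] activeD[of c \<beta> t l d] l elim(1) by auto
      then obtain v v' where v: "(pos c \<alpha> t, v) \<in> snd (d t ! l)" "(pos c \<beta> t, v') \<in> snd (d t ! l)" by blast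
      have "active c d \<alpha> t \<le> length (d t)" unfolding active_def by (rule greatest_le)
      then have "l < length (d t)" using l by simp
      then have "admissible (d t) l (fst (d t ! l)) (snd (d t ! l))"
        using dT[of t] by (simp add: T_def history_tree_def)
      then obtain w where w: "w \<le> fst (d t ! l)" "(pos c \<alpha> t, w) \<in> snd (d t ! pos c \<beta> t)"
        using v elim(1) unfolding admissible_def by blast
      have "admissible (d t) (pos c \<beta> t) (fst (d t ! pos c \<beta> t)) (snd (d t ! pos c \<beta> t))"
        using dT[of t] conjunct1[OF elim(7)] unfolding T_def history_tree_def by blast
      then have "single_valued (snd (d t ! pos c \<beta> t))" by (simp add: admissible_def)
      moreover have "(pos c \<alpha> t, a (g \<beta> \<alpha>) t) \<in> snd (d t ! pos c \<beta> t)" using elim(6,7) by simp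
      ultimately have "w = a (g \<beta> \<alpha>) t" using w(2) by (auto dest: single_valuedD)
      moreover have "fst (d t ! l) = x \<alpha> t \<or> fst (d t ! l) = x \<beta> t"
        by (auto simp: l_def x_def min_def)
      ultimately show ?case using w(1) elim(8,9) by auto
    qed
    then have n: "\<not> (\<forall>\<^sub>F t in F. a i t \<le> a (g \<beta> \<alpha>) t)"
      using ev_not[of "\<lambda>t. a i t \<le> a (g \<beta> \<alpha>) t"] by (simp add: not_le)
    have iF: "i \<in> Field \<kappa>" using \<epsilon>(1)[OF \<alpha>] W by (simp add: W_def)
    have "(i, g \<beta> \<alpha>) \<notin> \<kappa>" using n a by blast
    then have "(g \<beta> \<alpha>, i) \<in> \<kappa>" "g \<beta> \<alpha> \<noteq> i"
      using wo_rel.TOTALS[OF wr\<kappa>] g(1)[of \<beta> \<alpha>] iF by blast+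
    then show ?thesis by (simp add: underS_def)
  qed
  have "|W i| \<le>o |Field \<kappa>|" if i: "i \<in> Field \<kappa>" for i
  proof -
    have "|W i| \<le>o \<kappa>"
    proof (rule card_of_small_segments[OF wo _ \<kappa>(1)])
      show "W i \<subseteq> Field \<theta>" using YF by (auto simp: W_def)
      fix \<beta> assume \<beta>: "\<beta> \<in> W i"
      then have "inj_on (g \<beta>) (underS \<theta> \<beta>)" using g(2) by (simp add: W_def)
      then have "inj_on (g \<beta>) (W i \<inter> underS \<theta> \<beta>)" by (rule inj_on_subset) simp
      moreover have "g \<beta> ` (W i \<inter> underS \<theta> \<beta>) \<subseteq> underS \<kappa> i"
        using key[OF _ \<beta>] by (auto simp: underS_def)
      ultimately have "|W i \<inter> underS \<theta> \<beta>| \<le>o |underS \<kappa> i|"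
        using card_of_ordLeq[of "W i \<inter> underS \<theta> \<beta>" "underS \<kappa> i"] by blast
      also have "|underS \<kappa> i| <o \<kappa>" by (rule card_of_underS[OF \<kappa>(1) i])
      finally show "|W i \<inter> underS \<theta> \<beta>| <o \<kappa>" .
    qed
    then show ?thesis
      by (rule ordLeq_ordIso_trans[OF _ ordIso_symmetric[OF card_of_Field_ordIso[OF \<kappa>(1)]]])
  qed
  then have "|\<Union>i\<in>Field \<kappa>. W i| \<le>o |Field \<kappa>|"
    by (intro card_of_UNION_ordLeq_infinite[OF \<kappa>(2)]) (auto simp: ordIso_imp_ordLeq card_of_refl)
  moreover have "Y \<subseteq> (\<Union>i\<in>Field \<kappa>. W i)" using \<epsilon>(1) YF by (auto simp: W_def)
  ultimately have "|Y| \<le>o |Field \<kappa>|" using card_of_mono1 ordLeq_transitive by blast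
  then have "|Y| \<le>o \<kappa>" using card_of_Field_ordIso[OF \<kappa>(1)] ordLeq_ordIso_trans by blast
  then show False using many_small_segments[OF \<theta> \<kappa>\<theta>] by (simp add: Y_def)
qed

end

section \<open>Goodness\<close>

context treetops_uf
begin

lemma ev_le_total: "(\<forall>\<^sub>F t in F. x t \<le> (y t :: nat)) \<or> (\<forall>\<^sub>F t in F. y t \<le> x t)"
  unfolding ev_disj[symmetric] by (rule always_eventually) auto

lemma ev_not_le: "\<not> (\<forall>\<^sub>F t in F. x t \<le> (y t :: nat)) \<longleftrightarrow> (\<forall>\<^sub>F t in F. y t < x t)"
  using ev_not[of "\<lambda>t. x t \<le> y t"] by (simp add: not_le)

lemma ev_le_trans:
  fixes x y z :: "'i \<Rightarrow> nat"
  assumes "\<forall>\<^sub>F t in F. x t \<le> y t" "\<forall>\<^sub>F t in F. y t \<le> z t"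
  shows "\<forall>\<^sub>F t in F. x t \<le> z t"
  using assms by eventually_elim (rule order_trans)

text \<open>Raises \<open>fills\<close> from sides smaller than \<open>\<nu>\<close> to sides of
  size at most \<open>\<nu>\<close>. If no member of a side settles the matter, both sides are
  replaced by sequences of regular length, and comparing these lengths leads to the symmetric or the
  asymmetric cut. The bound on \<open>\<nu>\<close> keeps the branches short enough for
  treetops.\<close>

lemma fills_step:
  fixes A B :: "('i \<Rightarrow> nat) set"
  assumes fills: "fills \<nu>" and \<nu>I: "\<nu> \<le>o |UNIV :: 'i set|"
    and A: "|A| \<le>o \<nu>" and B: "|B| \<le>o \<nu>" and B_ne: "B \<noteq> {}"
    and AB: "\<And>a b. a \<in> A \<Longrightarrow> b \<in> B \<Longrightarrow> \<forall>\<^sub>F t in F. a t \<le> b t"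
  shows "\<exists>c. (\<forall>a\<in>A. \<forall>\<^sub>F t in F. a t \<le> c t) \<and> (\<forall>b\<in>B. \<forall>\<^sub>F t in F. c t \<le> b t)"
proof -
  consider "A = {}" | m where "m \<in> A" "\<forall>a\<in>A. \<forall>\<^sub>F t in F. a t \<le> m t"
    | m where "m \<in> B" "\<forall>b\<in>B. \<forall>\<^sub>F t in F. m t \<le> b t"
    | (nomax) "A \<noteq> {}" "\<And>m. m \<in> A \<Longrightarrow> \<exists>a\<in>A. \<not> (\<forall>\<^sub>F t in F. a t \<le> m t)"
        "\<And>m. m \<in> B \<Longrightarrow> \<exists>b\<in>B. \<not> (\<forall>\<^sub>F t in F. m t \<le> b t)"
    by blast
  then show ?thesis
  proof cases
    case 1
    then show ?thesis by (intro exI[of _ "\<lambda>_. 0"]) simp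
  next
    case (2 m)
    then show ?thesis using AB by blast
  next
    case (3 m)
    then show ?thesis using AB by blast
  next
    case nomax
    obtain \<kappa> where \<kappa>: "Field \<kappa> \<subseteq> A" "Card_order \<kappa>"
      and \<kappa>_reg: "regularCard \<kappa>" and \<kappa>_inf: "infinite (Field \<kappa>)"
      and \<kappa>_mono: "\<And>i j. (i, j) \<in> \<kappa> \<Longrightarrow> \<forall>\<^sub>F t in F. i t \<le> j t"
      and \<kappa>_strict: "\<And>i j. (i, j) \<in> \<kappa> \<Longrightarrow> i \<noteq> j \<Longrightarrow> \<not> (\<forall>\<^sub>F t in F. j t \<le> i t)"
      and \<kappa>_cof: "\<And>k. k \<in> A \<Longrightarrow> \<exists>i\<in>Field \<kappa>. \<forall>\<^sub>F t in F. k t \<le> i t"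
    proof (rule cofinal_regular_sequence[of A "\<lambda>x y. \<forall>\<^sub>F t in F. x t \<le> y t"])
      show "\<forall>\<^sub>F t in F. x t \<le> z t" if "\<forall>\<^sub>F t in F. x t \<le> y t" "\<forall>\<^sub>F t in F. y t \<le> z t" for x y z :: "'i \<Rightarrow> nat"
        by (rule ev_le_trans[OF that])
      show "\<exists>y\<in>A. \<not> (\<forall>\<^sub>F t in F. y t \<le> x t)" if "x \<in> A" for x by (rule nomax(2)[OF that])
    qed (rule ev_le_total nomax(1) that; assumption)+
    obtain \<theta> where \<theta>: "Field \<theta> \<subseteq> B" "Card_order \<theta>"
      and \<theta>_reg: "regularCard \<theta>" and \<theta>_inf: "infinite (Field \<theta>)"
      and \<theta>_mono: "\<And>i j. (i, j) \<in> \<theta> \<Longrightarrow> \<forall>\<^sub>F t in F. j t \<le> i t"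
      and \<theta>_strict: "\<And>i j. (i, j) \<in> \<theta> \<Longrightarrow> i \<noteq> j \<Longrightarrow> \<not> (\<forall>\<^sub>F t in F. i t \<le> j t)"
      and \<theta>_cof: "\<And>k. k \<in> B \<Longrightarrow> \<exists>i\<in>Field \<theta>. \<forall>\<^sub>F t in F. i t \<le> k t"
    proof (rule cofinal_regular_sequence[of B "\<lambda>x y. \<forall>\<^sub>F t in F. y t \<le> x t"])
      show "\<forall>\<^sub>F t in F. z t \<le> x t" if "\<forall>\<^sub>F t in F. y t \<le> x t" "\<forall>\<^sub>F t in F. z t \<le> y t" for x y z :: "'i \<Rightarrow> nat"
        by (rule ev_le_trans[OF that(2,1)])
      show "\<exists>y\<in>B. \<not> (\<forall>\<^sub>F t in F. x t \<le> y t)" if "x \<in> B" for x by (rule nomax(3)[OF that])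
    qed (rule ev_le_total B_ne that; assumption)+
    have AB': "\<forall>\<^sub>F t in F. i t \<le> j t" if "i \<in> Field \<kappa>" "j \<in> Field \<theta>" for i j
      using AB \<kappa>(1) \<theta>(1) that by blast
    have \<kappa>\<nu>: "\<kappa> \<le>o \<nu>"
      using ordIso_ordLeq_trans[OF ordIso_symmetric[OF card_of_Field_ordIso[OF \<kappa>(2)]]
          ordLeq_transitive[OF card_of_mono1[OF \<kappa>(1)] A]] .
    have \<theta>\<nu>: "\<theta> \<le>o \<nu>"
      using ordIso_ordLeq_trans[OF ordIso_symmetric[OF card_of_Field_ordIso[OF \<theta>(2)]]
          ordLeq_transitive[OF card_of_mono1[OF \<theta>(1)] B]] .
    have \<kappa>I: "|Field \<kappa>| \<le>o |UNIV :: 'i set|"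
      by (rule ordIso_ordLeq_trans[OF card_of_Field_ordIso[OF \<kappa>(2)] ordLeq_transitive[OF \<kappa>\<nu> \<nu>I]])
    have \<theta>I: "|Field \<theta>| \<le>o |UNIV :: 'i set|"
      by (rule ordIso_ordLeq_trans[OF card_of_Field_ordIso[OF \<theta>(2)] ordLeq_transitive[OF \<theta>\<nu> \<nu>I]])
    have fills_le: "fills r" if "r \<le>o \<nu>" for r :: "('i \<Rightarrow> nat) rel"
      using fills ordLess_ordLeq_trans[OF _ that] unfolding fills_def by blast
    have wo: "Well_order \<kappa>" "Well_order \<theta>" using \<kappa>(2) \<theta>(2) card_order_on_well_order_on by blast+
    have "\<exists>c. (\<forall>i\<in>Field \<kappa>. \<forall>\<^sub>F t in F. i t \<le> c t) \<and> (\<forall>j\<in>Field \<theta>. \<forall>\<^sub>F t in F. c t \<le> j t)"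
    proof -
      consider "\<kappa> <o \<theta>" | "\<theta> <o \<kappa>" | "\<kappa> =o \<theta>"
        using ordLess_or_ordLeq[OF wo] ordLeq_iff_ordLess_or_ordIso ordIso_symmetric by blast
      then show ?thesis
      proof cases
        case 1
        have "\<forall>\<^sub>F t in F. j t < i t" if "(i, j) \<in> \<theta> - Id" for i j
          using \<theta>_strict[of i j] that ev_not_le[of i j] by auto
        then show ?thesis
          using asymmetric_cut[of \<kappa> \<theta> "\<lambda>i. i" "\<lambda>j. j", OF \<kappa>(2) \<kappa>_inf \<theta>(2) 1 \<theta>I fills_le[OF \<theta>\<nu>] \<kappa>_mono] AB'
          by blast
      next
        case 2
        obtain b0 where b0: "b0 \<in> Field \<theta>" using \<theta>_inf by fastforce
        \<comment> \<open>Subtraction from a member \<open>b0\<close> of the upper side reverses the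
          order below \<open>b0\<close> and exchanges the two cofinalities. Truncation at
          \<open>0\<close> can occur only among the images of the old upper side, for which weak
          monotonicity suffices.\<close>
        have "\<exists>c. (\<forall>j\<in>Field \<theta>. \<forall>\<^sub>F t in F. b0 t - j t \<le> c t) \<and> (\<forall>i\<in>Field \<kappa>. \<forall>\<^sub>F t in F. c t \<le> b0 t - i t)"
        proof (rule asymmetric_cut[of \<theta> \<kappa> "\<lambda>j t. b0 t - j t" "\<lambda>i t. b0 t - i t", OF \<theta>(2) \<theta>_inf \<kappa>(2) 2 \<kappa>I fills_le[OF \<kappa>\<nu>]])
          show "\<forall>\<^sub>F t in F. b0 t - i t \<le> b0 t - j t" if "(i, j) \<in> \<theta>" for i j
            using \<theta>_mono[OF that] by eventually_elim simp
          show "\<forall>\<^sub>F t in F. b0 t - j t < b0 t - i t" if ij: "(i, j) \<in> \<kappa> - Id" for i j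
          proof -
            have j: "j \<in> Field \<kappa>" using ij by (auto simp: Field_def)
            have "\<forall>\<^sub>F t in F. i t < j t" using \<kappa>_strict[of i j] ij ev_not_le[of j i] by auto
            with AB'[OF j b0] show ?thesis by eventually_elim simp
          qed
          show "\<forall>\<^sub>F t in F. b0 t - j t \<le> b0 t - i t" if "j \<in> Field \<theta>" "i \<in> Field \<kappa>" for i j
            using AB'[OF that(2,1)] by eventually_elim simp
        qed
        then obtain c where c: "\<And>j. j \<in> Field \<theta> \<Longrightarrow> \<forall>\<^sub>F t in F. b0 t - j t \<le> c t"
          "\<And>i. i \<in> Field \<kappa> \<Longrightarrow> \<forall>\<^sub>F t in F. c t \<le> b0 t - i t" by blast
        have "\<forall>\<^sub>F t in F. i t \<le> b0 t - c t" if "i \<in> Field \<kappa>" for i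
          using c(2)[OF that] AB'[OF that b0] by eventually_elim simp
        moreover have "\<forall>\<^sub>F t in F. b0 t - c t \<le> j t" if "j \<in> Field \<theta>" for j
          using c(1)[OF that] by eventually_elim simp
        ultimately show ?thesis by (intro exI[of _ "\<lambda>t. b0 t - c t"]) blast
      next
        case 3
        then obtain f where f: "iso \<kappa> \<theta> f" by (auto simp: ordIso_def)
        have fF: "f ` Field \<kappa> = Field \<theta>" by (rule iso_Field[OF f])
        have "\<exists>c. \<forall>i\<in>Field \<kappa>. (\<forall>\<^sub>F t in F. i t \<le> c t) \<and> (\<forall>\<^sub>F t in F. c t \<le> f i t)"
        proof (rule symmetric_cut[OF wo(1) _ \<kappa>I])
          show "Field \<kappa> \<noteq> {}" using \<kappa>_inf by auto
          show "\<forall>\<^sub>F t in F. i t \<le> j t" if "(i, j) \<in> \<kappa>" for i j by (rule \<kappa>_mono[OF that])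
          show "\<forall>\<^sub>F t in F. f j t \<le> f i t" if "(i, j) \<in> \<kappa>" for i j
            using \<theta>_mono iso_forward[OF that f] by blast
          show "\<forall>\<^sub>F t in F. i t \<le> f i t" if "i \<in> Field \<kappa>" for i
            using AB' that fF by blast
        qed
        then obtain c where c: "\<And>i. i \<in> Field \<kappa> \<Longrightarrow> \<forall>\<^sub>F t in F. i t \<le> c t"
          "\<And>i. i \<in> Field \<kappa> \<Longrightarrow> \<forall>\<^sub>F t in F. c t \<le> f i t" by blast
        have "\<forall>\<^sub>F t in F. c t \<le> j t" if j: "j \<in> Field \<theta>" for j
        proof -
          obtain i where "i \<in> Field \<kappa>" "j = f i" using j fF by auto
          then show ?thesis using c(2)[of i] by simp
        qed
        then show ?thesis using c(1) by (intro exI[of _ c]) simp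
      qed
    qed
    then obtain c where c: "\<And>i. i \<in> Field \<kappa> \<Longrightarrow> \<forall>\<^sub>F t in F. i t \<le> c t"
      "\<And>j. j \<in> Field \<theta> \<Longrightarrow> \<forall>\<^sub>F t in F. c t \<le> j t" by blast
    have "\<forall>\<^sub>F t in F. x t \<le> c t" if x: "x \<in> A" for x
    proof -
      obtain i where "i \<in> Field \<kappa>" "\<forall>\<^sub>F t in F. x t \<le> i t" using \<kappa>_cof[OF x] by blast
      then show ?thesis using ev_le_trans[of x i c] c(1)[of i] by simp
    qed
    moreover have "\<forall>\<^sub>F t in F. c t \<le> y t" if y: "y \<in> B" for y
    proof -
      obtain j where "j \<in> Field \<theta>" "\<forall>\<^sub>F t in F. j t \<le> y t" using \<theta>_cof[OF y] by blast
      then show ?thesis using ev_le_trans[of c j y] c(2)[of j] by simp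
    qed
    ultimately show ?thesis by (intro exI[of _ c]) simp
  qed
qed

text \<open>The sum \<open>|A <+> B|\<close> measures both sides by one cardinal. For a
  counterexample with least sum, sides smaller than an infinite sum together have a smaller sum and
  cannot form a counterexample, so \<open>fills_step\<close> applies at this cardinal and fills the
  cut.\<close>

lemma fills_all: "fills (cardSuc |UNIV :: 'i set| )"
proof (rule ccontr)
  assume "\<not> fills (cardSuc |UNIV :: 'i set| )"
  define bad where "bad A B \<longleftrightarrow> |A| \<le>o |UNIV :: 'i set| \<and> |B| \<le>o |UNIV :: 'i set| \<and> B \<noteq> {}
      \<and> (\<forall>a\<in>A. \<forall>b\<in>B. \<forall>\<^sub>F t in F. a t \<le> b t)
      \<and> (\<nexists>c. (\<forall>a\<in>A. \<forall>\<^sub>F t in F. a t \<le> c t) \<and> (\<forall>b\<in>B. \<forall>\<^sub>F t in F. c t \<le> b t))"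
    for A B :: "('i \<Rightarrow> nat) set"
  have small: "|A| <o cardSuc |UNIV :: 'i set| \<longleftrightarrow> |A| \<le>o |UNIV :: 'i set|" for A :: "('i \<Rightarrow> nat) set"
    by (rule cardSuc_ordLeq_ordLess[OF card_of_Card_order card_of_Card_order])
  obtain A0 B0 where "bad A0 B0"
    using \<open>\<not> fills (cardSuc |UNIV :: 'i set| )\<close> unfolding fills_def bad_def small by blast
  then have "\<exists>r\<in>{|A <+> B| | A B. bad A B}. \<forall>r'\<in>{|A <+> B| | A B. bad A B}. r \<le>o r'"
    by (intro exists_minim_Card_order) (auto simp: card_of_card_order_on Field_card_of)
  then obtain A B where AB: "bad A B" and "\<forall>r'\<in>{|A <+> B| | A B. bad A B}. |A <+> B| \<le>o r'"
    by blast
  then have min: "|A <+> B| \<le>o |A' <+> B'|" if "bad A' B'" for A' B' using that by blast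
  have I: "|A <+> B| \<le>o |UNIV :: 'i set|"
    by (rule card_of_Plus_ordLeq_infinite_Field[OF infinite_Field_card_of[OF inf] _ _ card_of_Card_order])
      (use AB in \<open>auto simp: bad_def\<close>)
  have "fills |A <+> B|"
  proof (cases "finite (A <+> B)")
    \<comment> \<open>Two sides smaller than a finite sum need not have a smaller sum together;
      instead, a finite \<open>A'\<close> has a largest member up to almost equality.\<close>
    case True
    show ?thesis unfolding fills_def
    proof (intro allI impI, elim conjE)
      fix A' B' :: "('i \<Rightarrow> nat) set"
      assume *: "|A'| <o |A <+> B|" "B' \<noteq> {}" "\<forall>a\<in>A'. \<forall>b\<in>B'. \<forall>\<^sub>F t in F. a t \<le> b t"
      have "finite A'" using card_of_ordLeq_finite[OF ordLess_imp_ordLeq[OF *(1)]] True by blast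
      show "\<exists>c. (\<forall>a\<in>A'. \<forall>\<^sub>F t in F. a t \<le> c t) \<and> (\<forall>b\<in>B'. \<forall>\<^sub>F t in F. c t \<le> b t)"
      proof (cases "A' = {}")
        case True
        then show ?thesis by (intro exI[of _ "\<lambda>_. 0"]) simp
      next
        case False
        have "\<exists>m\<in>A'. \<forall>k\<in>A'. \<forall>\<^sub>F t in F. k t \<le> m t"
          by (rule finite_total_has_max[OF \<open>finite A'\<close> False ev_le_total ev_le_trans])
        then show ?thesis using *(3) by blast
      qed
    qed
  next
    case False
    show ?thesis unfolding fills_def
    proof (intro allI impI, elim conjE, rule ccontr)
      fix A' B' :: "('i \<Rightarrow> nat) set"
      assume *: "|A'| <o |A <+> B|" "|B'| <o |A <+> B|" "B' \<noteq> {}" "\<forall>a\<in>A'. \<forall>b\<in>B'. \<forall>\<^sub>F t in F. a t \<le> b t"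
        "\<nexists>c. (\<forall>a\<in>A'. \<forall>\<^sub>F t in F. a t \<le> c t) \<and> (\<forall>b\<in>B'. \<forall>\<^sub>F t in F. c t \<le> b t)"
      have "bad A' B'" unfolding bad_def
        using * ordLeq_transitive[OF ordLess_imp_ordLeq I] by blast
      then have "|A <+> B| \<le>o |A' <+> B'|" by (rule min)
      moreover have "|A' <+> B'| <o |A <+> B|" by (rule card_of_Plus_ordLess_infinite[OF False *(1,2)])
      ultimately show False using not_ordLess_ordLeq by blast
    qed
  qed
  then have "\<exists>c. (\<forall>a\<in>A. \<forall>\<^sub>F t in F. a t \<le> c t) \<and> (\<forall>b\<in>B. \<forall>\<^sub>F t in F. c t \<le> b t)"
    by (rule fills_step[OF _ I card_of_Plus1 card_of_Plus2]) (use AB in \<open>auto simp: bad_def\<close>)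
  then show False using AB by (auto simp: bad_def)
qed

text \<open>Sets of the form \<open>{t. u \<subseteq> A t}\<close> are multiplicative in
  \<open>u\<close> by their shape, so a refinement amounts to one internal set \<open>A\<close> to
  which every index belongs almost everywhere.\<close>

lemma good: "good_uf D"
  unfolding good_uf_def
proof (intro allI impI)
  fix f :: "'i set \<Rightarrow> 'i set" assume f: "\<forall>u. finite u \<longrightarrow> f u \<in> D"
  obtain X :: "'i \<Rightarrow> 'i set" where X: "\<And>i. X i \<in> D" "\<And>t. finite {i. t \<in> X i}"
    using reg by (auto simp: regular_uf_def)
  define P where "P t = {u. u \<subseteq> {i. t \<in> X i} \<and> (\<forall>v\<subseteq>u. t \<in> f v \<or> v = {})}" for t
  have "\<exists>A. (\<forall>t. A t \<in> P t) \<and> (\<forall>i\<in>UNIV. \<forall>\<^sub>F t in F. i \<in> A t)"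
  proof (rule internal_extension[where s = "\<lambda>i t. i", OF fills_all])
    show "Card_order (cardSuc |UNIV :: 'i set| )" by (rule cardSuc_Card_order[OF card_of_Card_order])
    show "infinite (Field (cardSuc |UNIV :: 'i set| ))"
      using cardSuc_finite[OF card_of_Card_order, of "UNIV :: 'i set"] inf by (simp add: Field_card_of)
    show "|UNIV :: 'i set| <o cardSuc |UNIV :: 'i set|" by (rule cardSuc_greater[OF card_of_Card_order])
    show "|UNIV :: 'i set| \<le>o |UNIV :: 'i set|" by (simp add: ordIso_imp_ordLeq card_of_refl)
    show "finite (\<Union>(P t))" for t by (rule finite_subset[OF _ X(2)[of t]]) (auto simp: P_def)
    show "{} \<in> P t" for t by (auto simp: P_def)
    show "B \<in> P t" if "A \<in> P t" "B \<subseteq> A" for t A B using that by (auto simp: P_def)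
    fix u :: "'i set" assume u: "finite u"
    have "\<forall>\<^sub>F t in F. \<forall>i\<in>u. t \<in> X i"
      by (rule eventually_ball_finite[OF u]) (simp add: ev_F X)
    moreover have "\<forall>\<^sub>F t in F. \<forall>v\<in>Pow u. t \<in> f v"
      by (rule eventually_ball_finite) (use u f finite_subset in \<open>auto simp: ev_F\<close>)
    ultimately show "\<forall>\<^sub>F t in F. (\<lambda>i. i) ` u \<in> P t" by eventually_elim (auto simp: P_def)
  qed
  then obtain A where A: "\<And>t. A t \<in> P t" "\<And>i. \<forall>\<^sub>F t in F. i \<in> A t" by blast
  define f' where "f' u = {t. u \<subseteq> A t} \<inter> f {}" for u
  have "f' u \<in> D \<and> f' u \<subseteq> f u" if u: "finite u" for u
  proof
    have "\<forall>\<^sub>F t in F. \<forall>i\<in>u. i \<in> A t" by (rule eventually_ball_finite[OF u]) (use A in simp)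
    moreover have "\<forall>\<^sub>F t in F. t \<in> f {}" using f by (simp add: ev_F)
    ultimately have "\<forall>\<^sub>F t in F. t \<in> f' u" by eventually_elim (auto simp: f'_def)
    then show "f' u \<in> D" by (simp add: ev_F)
    show "f' u \<subseteq> f u"
    proof
      fix t assume "t \<in> f' u"
      then have t: "u \<subseteq> A t" "t \<in> f {}" by (auto simp: f'_def)
      have "\<forall>v\<subseteq>A t. t \<in> f v \<or> v = {}" using A(1)[of t] by (simp add: P_def)
      then show "t \<in> f u" using t by auto
    qed
  qed
  moreover have "f' u \<inter> f' v = f' (u \<union> v)" for u v by (auto simp: f'_def)
  ultimately show "\<exists>f'. (\<forall>u. finite u \<longrightarrow> f' u \<in> D \<and> f' u \<subseteq> f u)
      \<and> (\<forall>u v. finite u \<and> finite v \<longrightarrow> f' u \<inter> f' v = f' (u \<union> v))"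
    by blast
qed

end

theorem theorem4p26:
  fixes D :: "'i set set"
  assumes "infinite (UNIV :: 'i set)"
    and "ultrafilter D"
    and "regular_uf D"
    and "has_treetops D"
  shows "good_uf D"
  by (rule treetops_uf.good) (rule treetops_uf.intro[OF assms])

end
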